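(* Let $\chi$ be a primitive Dirichlet character modulo $q>1$. Then: (1) If $\chi(-1)=1$ and $q\geq 7$, then $L'(s,\chi)$ has no zeros on $\{\sigma+it:-1\leq\sigma\leq 0,~t\in\mathbb{R}\}$. (2) If $\chi(-1)=-1$ and $q\geq 23$, then $L'(s,\chi)$ has a unique zero on $\{\sigma+it:-2\leq\sigma\leq 0,~t\in\mathbb{R}\}$.
   Context: $L(s,\chi)$ is the Dirichlet $L$-function of $\chi$ and $L'(s,\chi)$ its derivative in $s$. *)

theory Defs
  imports "HOL-Complex_Analysis.Complex_Analysis"
begin

definition dirichlet_character :: "nat \<Rightarrow> (int \<Rightarrow> complex) \<Rightarrow> bool" where
  "dirichlet_character q chi \<longleftrightarrow>
     q > 0 \<and>
     (\<forall>m n. chi (m * n) = chi m * chi n) \<and>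
     (\<forall>n. chi (n + int q) = chi n) \<and>
     (\<forall>n. chi n \<noteq> 0 \<longleftrightarrow> coprime n (int q))"

definition induced_by :: "nat \<Rightarrow> (int \<Rightarrow> complex) \<Rightarrow> nat \<Rightarrow> (int \<Rightarrow> complex) \<Rightarrow> bool" where
  "induced_by q chi d \<psi> \<longleftrightarrow>
     dirichlet_character d \<psi> \<and> d dvd q \<and>
     (\<forall>n. coprime n (int q) \<longrightarrow> chi n = \<psi> n)"

definition primitive_dirichlet_character :: "nat \<Rightarrow> (int \<Rightarrow> complex) \<Rightarrow> bool" where
  "primitive_dirichlet_character q chi \<longleftrightarrow>
     dirichlet_character q chi \<and> \<not> (\<exists>d \<psi>. d < q \<and> induced_by q chi d \<psi>)"

text \<open>
  \<^term>\<open>F\<close> is the meromorphic continuation to the whole plane of the Dirichlet series of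
  \<^term>\<open>chi\<close>. Nice meromorphicity fixes its values: removable singularities are removed, and
  the value at a pole is \<^term>\<open>0\<close>. For nonprincipal \<^term>\<open>chi\<close> there is no pole
  and \<^term>\<open>F\<close> is entire.
\<close>
definition is_Dirichlet_L :: "(int \<Rightarrow> complex) \<Rightarrow> (complex \<Rightarrow> complex) \<Rightarrow> bool" where
  "is_Dirichlet_L chi F \<longleftrightarrow>
     F nicely_meromorphic_on UNIV \<and>
     (\<forall>s. Re s > 1 \<longrightarrow> (\<lambda>n. chi (int (Suc n)) / of_nat (Suc n) powr s) sums F s)"

definition Dirichlet_L :: "(int \<Rightarrow> complex) \<Rightarrow> complex \<Rightarrow> complex" where
  "Dirichlet_L chi = (THE F. is_Dirichlet_L chi F)"

lemma is_Dirichlet_L_unique: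
  assumes F: "is_Dirichlet_L chi F" and G: "is_Dirichlet_L chi G"
  shows "F = G"
proof
  fix z :: complex
  define H where "H = remove_sings (\<lambda>s. F s - G s)"
  have mero: "F meromorphic_on UNIV" "G meromorphic_on UNIV"
    using F G by (auto simp: is_Dirichlet_L_def nicely_meromorphic_on_def)
  have diff: "(\<lambda>s. F s - G s) meromorphic_on UNIV"
    by (intro meromorphic_intros mero)
  have H: "H nicely_meromorphic_on UNIV"
    unfolding H_def by (rule remove_sings_nicely_meromorphic[OF diff])
  have op: "open {s::complex. 1 < Re s}"
    by (rule open_halfspace_Re_gt)
  have FG: "F s = G s" if "1 < Re s" for s
    using F G that by (auto simp: is_Dirichlet_L_def intro: sums_unique2)
  have H0: "H s = 0" if s: "1 < Re s" for s
  proof -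
    have "eventually (\<lambda>w. w \<in> {s. 1 < Re s}) (at s)"
      using op s by (intro eventually_at_in_open') auto
    hence "eventually (\<lambda>w. F w - G w = 0) (at s)"
      by eventually_elim (auto simp: FG)
    thus ?thesis
      unfolding H_def by (intro remove_sings_eqI tendsto_eventually)
  qed
  have "H constant_on UNIV"
  proof (rule constant_on_extend_nicely_meromorphic_on[OF H _ op])
    show "H constant_on {s. 1 < Re s}"
      using H0 by (auto simp: constant_on_def)
    have "(2::complex) \<in> {s. 1 < Re s}" by simp
    thus "{s::complex. 1 < Re s} \<noteq> {}" by blast
  qed auto
  hence H_all: "H s = 0" for s
    using H0[of 2] by (auto simp: constant_on_def)
  have "eventually (\<lambda>s. remove_sings (\<lambda>s. F s - G s) s = F s - G s) (cosparse UNIV)"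
    by (rule eventually_remove_sings_eq[OF diff])
  hence "eventually (\<lambda>s. remove_sings (\<lambda>s. F s - G s) s = F s - G s) (at z)"
    by (auto simp: eventually_cosparse_open_eq)
  hence ev: "eventually (\<lambda>s. F s = G s) (at z)"
    by eventually_elim (use H_all in \<open>auto simp: H_def\<close>)
  have pole: "is_pole F z \<longleftrightarrow> is_pole G z"
    by (intro is_pole_cong ev refl)
  have lim: "F \<midarrow>z\<rightarrow> c \<longleftrightarrow> G \<midarrow>z\<rightarrow> c" for c
    by (intro tendsto_cong ev)
  have "(is_pole F z \<and> F z = 0) \<or> F \<midarrow>z\<rightarrow> F z" "(is_pole G z \<and> G z = 0) \<or> G \<midarrow>z\<rightarrow> G z"
    using F G by (auto simp: is_Dirichlet_L_def nicely_meromorphic_on_def)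
  thus "F z = G z"
    using pole lim not_tendsto_and_filterlim_at_infinity[OF at_neq_bot] LIM_unique
    unfolding is_pole_def by metis
qed

lemma Dirichlet_L_eqI:
  assumes "is_Dirichlet_L chi F"
  shows "Dirichlet_L chi = F"
  unfolding Dirichlet_L_def using assms is_Dirichlet_L_unique by blast

end

theory Submission
  imports Defs "HOL-Number_Theory.Number_Theory" "HOL-Real_Asymp.Real_Asymp"
begin

text \<open>
  Let \<Lambda> (called \<open>Lam\<close> below) be the completed \<open>L\<close>-function of \<open>chi\<close>. The functional equation makes \<Lambda> entire with
  \<open>|\<Lambda> (1 - cnj s)| = |\<Lambda> s|\<close>. It is obtained by taking the Mellin transform of the partial fraction
  expansion of \<open>\<Sum>chi n exp (-n x)\<close>, whose coefficients are values of \<open>cnj chi\<close> because \<open>chi\<close>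
  is primitive. For \<open>a > 1\<close> the quotient of \<open>\<Lambda> (s - (2 a - 1))\<close> and \<open>\<Lambda> s\<close> has modulus 1 on the
  line \<open>Re s = a\<close> and at most 1 far to the right, so by Phragmen-Lindeloef it is bounded by 1 in
  between. Hence \<open>|\<Lambda>|\<close> decreases in \<open>Re s\<close> on the half-plane \<open>Re s \<le> 0\<close>; this yields
  \<open>Re (\<Lambda>'/\<Lambda>) \<le> 0\<close> there, without the Hadamard product. Consequently \<open>Re (L'/L)\<close> is at most
  \<open>- ln (q / pi) / 2 - Re \<psi>((s + k) / 2) / 2\<close>, where \<open>k\<close> is the parity of \<open>chi\<close> and \<psi> the digamma
  function. The constants 7 and 23 enter through \<open>\<gamma> < ln (7 / pi)\<close> and
  \<open>-\<psi>(1/2) = \<gamma> + 2 ln 2 < ln (23 / pi)\<close>. For odd \<open>chi\<close> the simple zero of \<open>L\<close> at -1 produces exactly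
  one zero of \<open>L'\<close>, by Rouche's theorem on a tall rectangle.
\<close>

subsection \<open>The digamma and gamma functions\<close>

text \<open>With z = (s + k) / 2, the even strip -1 \<le> Re s \<le> 0 and the left half -2 \<le> Re
  s \<le> -1 of the odd strip both become -1/2 \<le> Re z \<le> 0, where Re \<psi> \<ge> -\<gamma>
  away from the pole; one estimate settles both. For odd \<open>chi\<close> there remains -1 < Re s
  \<le> 0, whose right edge is Re z = 1/2; this is where \<psi>(1/2) comes from. The logarithmic
  derivative says nothing at two kinds of points. At s = -k the gamma factor has a pole and
  \<open>L\<close> a simple zero, so L' is a nonzero multiple of \<Lambda>(-k). For even
  \<open>chi\<close> this value is \<Lambda>(0), and L(1) \<noteq> 0 is proved for this one point.
  Excluding zeros of \<Lambda> on Re s = 0 would take nonvanishing of \<open>L\<close> on the whole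
  line Re s = 1; it is enough that they are simple, since L' is then nonzero there.
  Phragmen-Lindeloef needs a lower bound for the denominator \<Lambda>(s); it comes from the
  reflection formula for Gamma and the Euler product. The condition q \<ge> 4 enters as q >
  pi.\<close>

lemma Re_Digamma_ge:
  assumes "Re z > 0"
  shows "Digamma (Re z) \<le> Re (Digamma z)"
proof (rule LIMSEQ_le)
  have "z \<noteq> 0" "Re z \<noteq> 0" using assms by auto
  from tendsto_Re[OF Digamma_LIMSEQ[OF this(1)]] Digamma_LIMSEQ[OF this(2)]
  show "(\<lambda>m. of_real (ln (real m)) - (\<Sum>n<m. inverse (Re z + of_nat n))) \<longlonglongrightarrow> Digamma (Re z)"
    "(\<lambda>m. Re (of_real (ln (real m)) - (\<Sum>n<m. inverse (z + of_nat n)))) \<longlonglongrightarrow> Re (Digamma z)"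
    by simp_all
  have "Re (inverse (z + of_nat n)) \<le> inverse (Re z + of_nat n)" for n
  proof -
    define x where "x = Re z + n"
    have x: "x > 0" using assms by (simp add: x_def)
    have "Re (inverse (z + of_nat n)) = x / (x^2 + (Im z)^2)"
      by (simp add: x_def)
    also have "\<dots> \<le> x / x^2" using x by (intro divide_left_mono) (auto simp: add_nonneg_pos add_pos_nonneg)
    also have "\<dots> = inverse x" using x by (simp add: power2_eq_square field_simps)
    finally show ?thesis by (simp add: x_def)
  qed
  hence "(\<Sum>n<m. Re (inverse (z + of_nat n))) \<le> (\<Sum>n<m. inverse (Re z + of_nat n))" for m
    by (intro sum_mono)
  thus "\<exists>N. \<forall>m\<ge>N. of_real (ln (real m)) - (\<Sum>n<m. inverse (Re z + of_nat n))
      \<le> Re (of_real (ln (real m)) - (\<Sum>n<m. inverse (z + of_nat n)))"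
    by (intro exI[of _ 0]) simp
qed

text \<open>Every term of the series of \<open>Digamma\<close> is concave, so on [1, 2] the function
  lies above the chord through the values -\<gamma> at 1 and 1 - \<gamma> at 2.\<close>

lemma Digamma_real_ge_chord:
  fixes x :: real
  assumes "1 \<le> x" "x \<le> 2"
  shows "x - 1 - euler_mascheroni \<le> Digamma x"
proof -
  define u where "u = x - 1"
  have u: "0 \<le> u" "u \<le> 1" using assms by (auto simp: u_def)
  let ?D = "\<lambda>z m. of_real (ln (real m)) - (\<Sum>n<m. inverse (z + of_nat n)) :: real"
  have le: "(1 - u) * Digamma 1 + u * Digamma 2 \<le> Digamma x"
  proof (rule LIMSEQ_le)
    show "?D x \<longlonglongrightarrow> Digamma x" using assms by (intro Digamma_LIMSEQ) auto
    show "(\<lambda>m. (1 - u) * ?D 1 m + u * ?D 2 m) \<longlonglongrightarrow> (1 - u) * Digamma 1 + u * Digamma 2"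
      by (intro tendsto_intros Digamma_LIMSEQ) auto
    have "inverse (x + real n) \<le> (1 - u) * inverse (1 + real n) + u * inverse (2 + real n)" for n
    proof -
      define y where "y = 1 + real n"
      have y: "y > 0" by (simp add: y_def)
      \<comment> \<open>Convexity of the reciprocal with denominators cleared: the right side is
        \<open>y * (y + 1) + u * (1 - u)\<close>.\<close>
      have "1 * (y * (y+1)) \<le> (y + 1 - u) * (y + u)"
        using u by (simp add: algebra_simps mult_left_le power2_eq_square)
      hence "1 / (y + u) \<le> (y + 1 - u) / (y * (y+1))"
        using y u by (subst frac_le_eq) (auto simp: divide_le_0_iff algebra_simps mult_pos_pos add_pos_pos less_imp_neq[symmetric])
      hence "inverse (y + u) \<le> (y + 1 - u) / (y * (y+1))"
        by (simp add: divide_inverse)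
      also have "\<dots> = (1 - u) * inverse y + u * inverse (y + 1)"
        using y by (simp add: field_simps)
      finally show ?thesis by (simp add: y_def u_def add_ac)
    qed
    hence "(\<Sum>n<m. inverse (x + real n)) \<le> (1 - u) * (\<Sum>n<m. inverse (1 + real n)) + u * (\<Sum>n<m. inverse (2 + real n))" for m
      unfolding sum_distrib_left sum.distrib[symmetric] by (intro sum_mono)
    thus "\<exists>N. \<forall>m\<ge>N. (1 - u) * ?D 1 m + u * ?D 2 m \<le> ?D x m"
      by (intro exI[of _ 0]) (simp add: algebra_simps)
  qed
  have "Digamma (2::real) = 1 - euler_mascheroni"
    using Digamma_plus1[of "1::real"] by simp
  with le show ?thesis by (simp add: u_def algebra_simps)
qed

text \<open>Two applications of the recursion move the argument to real part \<open>b + 1\<close> in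
  [3/2, 2], where the chord bound gives \<open>b - \<gamma>\<close>; the terms 1/z and 1/(z + 1)
  together cost at most \<open>b\<close>.\<close>

lemma Re_Digamma_ge_left:
  assumes "-1/2 \<le> Re z" "Re z \<le> 0" "z \<noteq> 0"
  shows "- euler_mascheroni \<le> Re (Digamma z)"
proof -
  define a where "a = - Re z"
  define b where "b = 1 - a"
  define u where "u = (Im z)^2"
  have a: "0 \<le> a" "a \<le> 1/2" "b \<ge> 1/2" "b \<le> 1" using assms by (auto simp: a_def b_def)
  have u: "u \<ge> 0" by (simp add: u_def)
  have nz: "z + 1 \<noteq> 0" using assms by (auto simp: complex_eq_iff)
  have D: "Digamma z = Digamma (z + 2) - 1/z - 1/(z+1)"
    using Digamma_plus1[OF assms(3)] Digamma_plus1[OF nz] by (simp add: algebra_simps)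
  have "b - euler_mascheroni \<le> Digamma (b + 1)"
    using Digamma_real_ge_chord[of "b+1"] a by simp
  also have "\<dots> \<le> Re (Digamma (z + 2))"
    using Re_Digamma_ge[of "z+2"] a by (simp add: a_def b_def add_ac)
  finally have 1: "b - euler_mascheroni \<le> Re (Digamma (z + 2))" .
  have "a^2 + u > 0" 
  proof (cases "a = 0")
    case True thus ?thesis using assms(3) by (auto simp: a_def u_def complex_eq_iff)
  next
    case False thus ?thesis using a u by (intro add_pos_nonneg) auto
  qed
  moreover have "b^2 + u > 0" using a u by (intro add_pos_nonneg) auto
  \<comment> \<open>The claim with denominators cleared. Since \<open>a + b = 1\<close>, the product
    of the denominators is \<open>(u - a*b)^2 + u\<close>, and \<open>0 \<le> b - a \<le> b\<close>
    bounds the left side by \<open>b * u\<close>.\<close>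
  moreover have "b * (a\<^sup>2 + u) - a * (b\<^sup>2 + u) \<le> b * ((a\<^sup>2 + u) * (b^2 + u))"
  proof -
    have "(a\<^sup>2 + u) * (b^2 + u) = (u - a*b)^2 + u"
      unfolding b_def by (simp add: algebra_simps power2_eq_square)
    moreover have "b * (a\<^sup>2 + u) - a * (b\<^sup>2 + u) = (b - a) * (u - a * b)"
      by (simp add: algebra_simps power2_eq_square)
    moreover have "(b - a) * (u - a * b) \<le> b * u"
    proof (cases "u \<le> a * b")
      case True thus ?thesis using a u
        by (smt (verit) mult_nonneg_nonneg mult_nonneg_nonpos)
    next
      case False thus ?thesis using a u by (intro mult_mono) auto
    qed
    moreover have "b * u \<le> b * ((u - a*b)^2 + u)" using a by (intro mult_left_mono) auto
    ultimately show ?thesis by simp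
  qed
  moreover have "b / B - a / A \<le> b" if "A > 0" "B > 0" "b * A - a * B \<le> b * (A * B)" for A B :: real
    using that by (simp add: diff_frac_eq pos_divide_le_eq mult_ac)
  ultimately have "b / (b^2 + u) - a / (a^2 + u) \<le> b"
    by blast
  moreover have "Re (1/z) = - a / (a^2 + u)" "Re (1/(z+1)) = b / (b^2 + u)"
    by (simp_all add: a_def b_def u_def Re_divide add.commute)
  ultimately have "Re (1/z) + Re (1/(z+1)) \<le> b" by simp
  with 1 show ?thesis unfolding D by simp
qed

text \<open>The horizontal derivative of ln |Gamma| is Re \<psi>, so a lower bound \<open>k\<close>
  for it with primitive \<open>h\<close> integrates to a growth bound. It is applied with the real
  digamma function and with a constant as \<open>k\<close>.\<close>

lemma norm_Gamma_ratio_ge: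
  assumes "0 < x1" "x1 \<le> x2" and K: "\<And>x. x1 \<le> x \<Longrightarrow> x \<le> x2 \<Longrightarrow> k x \<le> Re (Digamma (Complex x y))"
    and H: "\<And>x. x1 \<le> x \<Longrightarrow> x \<le> x2 \<Longrightarrow> (h has_real_derivative k x) (at x)"
  shows "exp (h x2 - h x1) * norm (Gamma (Complex x1 y)) \<le> norm (Gamma (Complex x2 y))"
proof -
  let ?g = "\<lambda>x. Re (ln_Gamma (Complex x y)) - h x"
  have "?g x1 \<le> ?g x2"
  proof (rule DERIV_nonneg_imp_nondecreasing[OF assms(2)])
    fix x assume x: "x1 \<le> x" "x \<le> x2"
    have np: "Complex x y \<notin> \<real>\<^sub>\<le>\<^sub>0" using x assms(1) by (auto simp: complex_nonpos_Reals_iff)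
    have "((\<lambda>x. Complex x y) has_vector_derivative 1) (at x)"
    proof -
      have "((\<lambda>x. of_real x + \<i> * of_real y) has_vector_derivative (1::complex)) (at x)"
        by (auto intro!: derivative_eq_intros)
      thus ?thesis by (simp add: Complex_eq)
    qed
    hence "((\<lambda>x. ln_Gamma (Complex x y)) has_vector_derivative 1 * Digamma (Complex x y)) (at x)"
      using field_vector_diff_chain_at[of "\<lambda>x. Complex x y" 1 x ln_Gamma "Digamma (Complex x y)"]
        has_field_derivative_ln_Gamma_complex[OF np] by (simp add: o_def)
    hence "((\<lambda>x. Re (ln_Gamma (Complex x y))) has_vector_derivative Re (Digamma (Complex x y))) (at x)"
      using bounded_linear.has_vector_derivative[OF bounded_linear_Re] by fastforce
    hence "(?g has_real_derivative (Re (Digamma (Complex x y)) - k x)) (at x)"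
      using H[OF x] by (auto intro!: derivative_eq_intros simp: has_real_derivative_iff_has_vector_derivative)
    thus "\<exists>y. (?g has_real_derivative y) (at x) \<and> 0 \<le> y" using K[OF x] by auto
  qed
  hence "exp (h x2 - h x1 + Re (ln_Gamma (Complex x1 y))) \<le> exp (Re (ln_Gamma (Complex x2 y)))"
    by simp
  moreover have "norm (Gamma (Complex x y)) = exp (Re (ln_Gamma (Complex x y)))" if "x > 0" for x
  proof -
    have np: "Complex x y \<notin> \<int>\<^sub>\<le>\<^sub>0" using that by (auto elim!: nonpos_Ints_cases simp: complex_eq_iff)
    show ?thesis by (subst Gamma_complex_altdef) (use np in auto)
  qed
  ultimately show ?thesis using assms(1,2) by (simp add: exp_add)
qed

text \<open>Since \<open>cnj z = 1 - z\<close> on this line, the reflection formula computes the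
  modulus exactly; only the sine is estimated.\<close>

lemma norm_Gamma_half_plus_imaginary:
  "pi * exp (- pi * \<bar>y\<bar>) \<le> (norm (Gamma (Complex (1/2) y)))^2"
proof -
  define z where "z = Complex (1/2) y"
  have "cnj z = 1 - z" by (simp add: z_def complex_eq_iff)
  hence "of_real ((norm (Gamma z))^2) = Gamma z * Gamma (1 - z)"
    by (simp only: complex_norm_square cnj_Gamma)
  also have "\<dots> = of_real pi / sin (of_real pi * z)" by (rule Gamma_reflection_complex)
  finally have "norm (of_real ((norm (Gamma z))^2) :: complex) = pi / norm (sin (of_real pi * z))"
    by (simp add: norm_divide)
  hence eq: "(norm (Gamma z))^2 = pi / norm (sin (of_real pi * z))"
    by (simp only: norm_of_real abs_power2)
  have "norm (sin (of_real pi * z)) \<le> exp (pi * \<bar>y\<bar>)"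
  proof -
    have "norm (sin (of_real pi * z)) = norm (exp (\<i> * (of_real pi * z)) - exp (- (\<i> * (of_real pi * z)))) / 2"
      by (simp add: sin_exp_eq norm_divide norm_mult)
    also have "\<dots> \<le> (exp (-pi * y) + exp (pi * y)) / 2"
      by (intro divide_right_mono order_trans[OF norm_triangle_ineq4])
         (simp_all add: norm_exp_eq_Re z_def)
    also have "\<dots> \<le> (exp (pi * \<bar>y\<bar>) + exp (pi * \<bar>y\<bar>)) / 2"
      using mult_left_mono[of "-y" "\<bar>y\<bar>" pi] mult_left_mono[of y "\<bar>y\<bar>" pi]
      by (intro divide_right_mono add_mono) auto
    finally show ?thesis by simp
  qed
  moreover have "norm (sin (of_real pi * z)) > 0"
  proof (rule ccontr)
    assume "\<not> ?thesis"
    hence "Gamma z = 0" using eq by simp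
    moreover have "z \<notin> \<int>\<^sub>\<le>\<^sub>0" by (auto elim!: nonpos_Ints_cases simp: complex_eq_iff z_def)
    ultimately show False by (simp add: Gamma_eq_zero_iff)
  qed
  ultimately have "pi / exp (pi * \<bar>y\<bar>) \<le> (norm (Gamma z))^2"
    unfolding eq by (intro divide_left_mono) (auto intro: mult_pos_pos)
  thus ?thesis by (simp add: z_def exp_minus field_simps)
qed

text \<open>The bound on Re z = 1/2 is carried to the right by \<open>norm_Gamma_ratio_ge\<close>.
  The true decay rate pi/2 is given up, since any exponential rate serves
  Phragmen-Lindeloef.\<close>

lemma norm_Gamma_ge:
  assumes "1/2 \<le> Re z"
  shows "Gamma (Re z) * exp (- pi * \<bar>Im z\<bar>) \<le> norm (Gamma z)"
proof -
  have z: "Complex (Re z) (Im z) = z" by simp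
  have "exp (ln_Gamma (Re z) - ln_Gamma (1/2)) * norm (Gamma (Complex (1/2) (Im z))) \<le>
      norm (Gamma (Complex (Re z) (Im z)))"
  proof (rule norm_Gamma_ratio_ge[where k = Digamma])
    fix x :: real assume "1/2 \<le> x"
    thus "(ln_Gamma has_real_derivative Digamma x) (at x)"
      by (auto intro!: derivative_eq_intros)
    show "Digamma x \<le> Re (Digamma (Complex x (Im z)))"
      using Re_Digamma_ge[of "Complex x (Im z)"] \<open>1/2 \<le> x\<close> by simp
  qed (use assms in auto)
  moreover have "exp (ln_Gamma (Re z) - ln_Gamma (1/2)) = Gamma (Re z) / sqrt pi"
    using assms by (simp add: exp_diff Gamma_real_pos_exp[symmetric] Gamma_one_half_real)
  moreover have "sqrt pi * exp (- pi * \<bar>Im z\<bar>) \<le> norm (Gamma (Complex (1/2) (Im z)))"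
  proof (rule power2_le_imp_le)
    have "(sqrt pi * exp (- pi * \<bar>Im z\<bar>))^2 = pi * (exp (- pi * \<bar>Im z\<bar>) * exp (- pi * \<bar>Im z\<bar>))"
      by (simp add: power_mult_distrib power2_eq_square)
    also have "\<dots> \<le> pi * (exp (- pi * \<bar>Im z\<bar>) * 1)"
      by (intro mult_left_mono) auto
    finally show "(sqrt pi * exp (- pi * \<bar>Im z\<bar>))^2 \<le> (norm (Gamma (Complex (1/2) (Im z))))^2"
      using norm_Gamma_half_plus_imaginary[of "Im z"] by (simp only: mult_1_right)
  qed auto
  moreover have "Gamma (Re z) / sqrt pi \<ge> 0"
    using assms by (intro divide_nonneg_nonneg less_imp_le[OF Gamma_real_pos]) auto
  ultimately have "Gamma (Re z) / sqrt pi * (sqrt pi * exp (- pi * \<bar>Im z\<bar>)) \<le> norm (Gamma z)"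
    unfolding z by (metis mult_left_mono order_trans)
  thus ?thesis by simp
qed

lemma norm_Gamma_le:
  assumes "Re z > 0"
  shows "norm (Gamma z) \<le> Gamma (Re z)"
proof -
  have "norm (integral {0..} (\<lambda>t. of_real t powr (z - 1) / of_real (exp t) :: complex))
        \<le> integral {0..} (\<lambda>t. t powr (Re z - 1) / exp t)"
    using Gamma_integral_complex[OF assms] Gamma_integral_real[OF assms]
    by (intro integral_norm_bound_integral)
       (auto simp: has_integral_iff norm_divide norm_powr_real_powr)
  thus ?thesis
    using Gamma_integral_complex[OF assms] Gamma_integral_real[OF assms]
    by (simp add: has_integral_iff)
qed

text \<open>\<open>Gamma z * Gamma (1 - z) * sin (pi * z)\<close> is constant, so its logarithmic
  derivative is zero.\<close>

lemma Digamma_reflection: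
  assumes "z \<notin> \<int>"
  shows "Digamma (1 - z) - Digamma z = of_real pi * cot (of_real pi * z :: complex)"
proof -
  have nz: "z \<notin> \<int>\<^sub>\<le>\<^sub>0" "1 - z \<notin> \<int>\<^sub>\<le>\<^sub>0"
    using assms nonpos_Ints_subset_Ints
     apply blast
    by (metis Ints_1 Ints_diff assms diff_diff_eq2 add_diff_cancel_left' nonpos_Ints_Int)
  define S where "S = sin (of_real pi * z)"
  have S: "S \<noteq> 0" using assms by (auto simp: S_def sin_eq_0)
  have GG: "Gamma z * Gamma (1 - z) * sin (of_real pi * z) = of_real pi" if "z \<notin> \<int>" for z :: complex
  proof -
    have "sin (of_real pi * z) \<noteq> 0" using that by (auto simp: sin_eq_0)
    thus ?thesis by (simp add: Gamma_reflection_complex)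
  qed
  have "((\<lambda>z. Gamma z * Gamma (1 - z) * sin (of_real pi * z)) has_field_derivative
      (Gamma z * Gamma (1 - z)) * ((Digamma z - Digamma (1 - z)) * S + of_real pi * cos (of_real pi * z))) (at z)"
    using nz by (auto intro!: derivative_eq_intros simp: S_def algebra_simps)
  moreover have "((\<lambda>z. Gamma z * Gamma (1 - z) * sin (of_real pi * z)) has_field_derivative 0) (at z)"
  proof (rule has_field_derivative_transform_within_open)
    show "((\<lambda>z. of_real pi) has_field_derivative 0) (at z)" by simp
    show "open (- \<int> :: complex set)" using closed_Ints by (simp add: open_closed)
  qed (use assms GG in auto)
  ultimately have "(Gamma z * Gamma (1 - z)) * ((Digamma z - Digamma (1 - z)) * S + of_real pi * cos (of_real pi * z)) = 0"
    by (rule DERIV_unique)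
  hence "(Digamma z - Digamma (1 - z)) * S + of_real pi * cos (of_real pi * z) = 0"
    using nz by (auto simp: Gamma_eq_zero_iff)
  hence "(Digamma (1 - z) - Digamma z) * S = of_real pi * cos (of_real pi * z)"
    by (simp add: algebra_simps)
  thus ?thesis using S by (simp add: cot_def S_def field_simps)
qed

text \<open>The symmetric partial sums of the cotangent series are the difference of the sequences
  defining \<open>Digamma (1 - z)\<close> and \<open>Digamma z\<close>. The half-open range contains
  exactly \<open>M\<close> terms of each: k \<le> 0 belongs to \<open>z\<close>, k > 0 to
  \<open>1 - z\<close>.\<close>

lemma inverse_one_minus_exp_partial_fractions:
  assumes "exp w \<noteq> 1"
  shows "(\<lambda>M. \<Sum>k\<in>{-int M<..int M}. 1 / (w - of_real (2 * pi) * \<i> * of_int k))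
           \<longlonglongrightarrow> 1 / (1 - exp (- w)) - 1/2"
proof -
  define z where "z = w / (of_real (2 * pi) * \<i>)"
  have w: "w = of_real (2 * pi) * \<i> * z" by (simp add: z_def)
  have z: "z \<notin> \<int>"
  proof
    assume "z \<in> \<int>"
    then obtain n where "z = of_int n" by (elim Ints_cases)
    hence "exp w = 1" using exp_integer_2pi[of "of_int n"] by (simp add: w mult_ac)
    thus False using assms by simp
  qed
  have nz: "z \<noteq> 0" "1 - z \<noteq> 0" using z by auto
  have lim: "(\<lambda>m. (of_real (ln (real m)) - (\<Sum>n<m. inverse (1 - z + of_nat n)))
     - (of_real (ln (real m)) - (\<Sum>n<m. inverse (z + of_nat n)))) \<longlonglongrightarrow> Digamma (1 - z) - Digamma z"
    by (intro tendsto_diff Digamma_LIMSEQ nz)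
  have sums: "(\<Sum>k\<in>{-int m<..int m}. 1 / (z - of_int k)) = (\<Sum>n<m. inverse (z + of_nat n)) - (\<Sum>n<m. inverse (1 - z + of_nat n))" for m
  proof (induction m)
    case (Suc m)
    have set: "{-int (Suc m)<..int (Suc m)} = insert (int m + 1) (insert (- int m) {-int m<..int m})"
      by auto
    have "1 / (z - of_int (int m + 1)) = - inverse (1 - z + of_nat m)"
    proof -
      have "z - of_int (int m + 1) = - (1 - z + of_nat m)" by simp
      thus ?thesis by (simp only: divide_inverse inverse_minus_eq) simp
    qed
    moreover have "int m + 1 \<notin> insert (- int m) {-int m<..int m}" "- int m \<notin> {-int m<..int m}" by auto
    ultimately have "(\<Sum>k\<in>{-int (Suc m)<..int (Suc m)}. 1 / (z - of_int k)) = - inverse (1 - z + of_nat m) + (inverse (z + of_nat m)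
        + (\<Sum>k\<in>{-int m<..int m}. 1 / (z - of_int k)))"
      unfolding set by (simp add: divide_inverse)
    thus ?case using Suc.IH by simp
  qed simp
  have "(\<lambda>m. \<Sum>k\<in>{-int m<..int m}. 1 / (z - of_int k)) \<longlonglongrightarrow> of_real pi * cot (of_real pi * z)"
    using lim Digamma_reflection[OF z] by (simp add: sums)
  hence "(\<lambda>m. (1 / (of_real (2 * pi) * \<i>)) * (\<Sum>k\<in>{-int m<..int m}. 1 / (z - of_int k)))
     \<longlonglongrightarrow> (1 / (of_real (2 * pi) * \<i>)) * (of_real pi * cot (of_real pi * z))"
    by (rule tendsto_mult_left)
  moreover have "(1 / (of_real (2 * pi) * \<i>)) * (\<Sum>k\<in>{-int m<..int m}. 1 / (z - of_int k))
     = (\<Sum>k\<in>{-int m<..int m}. 1 / (w - of_real (2 * pi) * \<i> * of_int k))" for m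
    unfolding sum_distrib_left w by (intro sum.cong) (auto simp: algebra_simps divide_simps)
  moreover have "(1 / (of_real (2 * pi) * \<i>)) * (of_real pi * cot (of_real pi * z)) = 1 / (1 - exp (- w)) - 1/2"
  proof -
    \<comment> \<open>In terms of \<open>E\<close> the cotangent and \<open>exp (-w)\<close>, the
      inverse of \<open>E * E\<close>, become rational.\<close>
    define E where "E = exp (\<i> * (of_real pi * z))"
    have E: "E \<noteq> 0" by (simp add: E_def)
    have "exp (-w) = inverse E * inverse E"
      by (simp add: E_def w exp_minus[symmetric] exp_add[symmetric] mult_ac)
    moreover have "cos (of_real pi * z) = (E + inverse E) / 2" "sin (of_real pi * z) = (E - inverse E) / (2 * \<i>)"
      by (simp_all add: E_def cos_exp_eq sin_exp_eq exp_minus)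
    moreover have "exp (-w) \<noteq> 1" using assms by (simp add: exp_minus)
    moreover have "A / 2 / (B / (2 * \<i>)) = \<i> * A / B" for A B :: complex
      by (simp add: divide_simps)
    ultimately have e: "exp (-w) = inverse E * inverse E" "inverse E * inverse E \<noteq> 1" 
      "cot (of_real pi * z) = \<i> * (E + inverse E) / (E - inverse E)"
      unfolding cot_def by simp_all
    have "E * E \<noteq> 1" using e(2) E by (auto simp: field_simps)
    have "(E + inverse E) / (E - inverse E) = (E * (E + inverse E)) / (E * (E - inverse E))"
      using E by (subst mult_divide_mult_cancel_left) auto
    also have "\<dots> = (E * E + 1) / (E * E - 1)" using E by (simp add: algebra_simps)
    finally have "\<i> * (E + inverse E) / (E - inverse E) = \<i> * ((E * E + 1) / (E * E - 1))"
      by (simp only: times_divide_eq_right[symmetric])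
    moreover have "1 / (1 - inverse E * inverse E) = (E * E * 1) / (E * E * (1 - inverse E * inverse E))"
      using E by (subst mult_divide_mult_cancel_left) auto
    moreover have "E * E * (1 - inverse E * inverse E) = E * E - 1" using E by (simp add: algebra_simps)
    moreover have "(1 / (of_real (2 * pi) * \<i>)) * (of_real pi * (\<i> * X)) = X / 2" for X
      by simp
    moreover have "A / (A - 1) - 1/2 = (A + 1) / (A - 1) / 2" if "A \<noteq> 1" for A :: complex
    proof -
      have "A / (A - 1) - 1/2 = (2 * A - (A - 1)) / ((A - 1) * 2)"
        using that by (subst diff_frac_eq) auto
      thus ?thesis by (simp add: algebra_simps)
    qed
    ultimately show ?thesis unfolding e using \<open>E * E \<noteq> 1\<close> by (simp only: mult_1_right not_False_eq_True)
  qed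
  ultimately show ?thesis by simp
qed

subsection \<open>Holomorphic functions on strips\<close>

text \<open>The factor \<open>exp (d * (z\<^sup>2 - m\<^sup>2))\<close> is at most 1 in modulus on
  the strip, since \<open>m\<close> bounds |Re z|, and it beats the exponential growth as |Im z|
  increases. The maximum principle on a tall rectangle bounds the product by 1; then
  \<open>d\<close> tends to 0.\<close>

lemma Phragmen_Lindelof_strip:
  fixes f :: "complex \<Rightarrow> complex"
  assumes hol: "f holomorphic_on U" and U: "open U" "{s. a \<le> Re s \<and> Re s \<le> b} \<subseteq> U"
    and growth: "\<And>s. a \<le> Re s \<Longrightarrow> Re s \<le> b \<Longrightarrow> norm (f s) \<le> C * exp (D * \<bar>Im s\<bar>)"
    and edge: "\<And>s. Re s = a \<or> Re s = b \<Longrightarrow> norm (f s) \<le> 1"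
    and s: "a \<le> Re s" "Re s \<le> b"
  shows "norm (f s) \<le> 1"
proof (rule field_le_epsilon)
  fix e :: real assume e: "e > 0"
  define m where "m = max \<bar>a\<bar> \<bar>b\<bar>"
  have m: "(Re z)^2 \<le> m^2" if "a \<le> Re z" "Re z \<le> b" for z
    using that by (intro power2_le_iff_abs_le[THEN iffD2]) (auto simp: m_def)
  have bound: "norm (f s) \<le> exp (d * (m^2 + (Im s)^2))" if d: "d > 0" for d
  proof -
    define g where "g = (\<lambda>z. f z * exp (of_real d * (z^2 - of_real (m^2))))"
    have g: "norm (g z) \<le> norm (f z) * exp (- d * (Im z)^2)" if "a \<le> Re z" "Re z \<le> b" for z
    proof -
      have "d * ((Re z)^2 - (Im z)^2 - m^2) \<le> - d * (Im z)^2"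
        using m[OF that] d by (simp add: algebra_simps)
      thus ?thesis by (auto simp: g_def norm_mult norm_exp_eq_Re Re_power2 intro!: mult_left_mono)
    qed
    have "((\<lambda>T. C * exp (D * T) * exp (- d * T^2)) \<longlongrightarrow> 0) at_top"
    proof (cases "C = 0")
      case False
      consider "D > 0" | "D = 0" | "D < 0" by linarith
      thus ?thesis using d by cases (real_asymp, simp, real_asymp, real_asymp)
    qed simp
    hence "eventually (\<lambda>T. C * exp (D * T) * exp (- d * T^2) < 1) at_top"
      by (rule order_tendstoD) auto
    hence "eventually (\<lambda>T. C * exp (D * T) * exp (- d * T^2) < 1 \<and> T > \<bar>Im s\<bar>) at_top"
      using eventually_gt_at_top by (rule eventually_conj)
    then obtain T where T: "C * exp (D * T) * exp (- d * T^2) < 1" "T > \<bar>Im s\<bar>"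
      by (auto dest: eventually_happens)
    define S where "S = cbox (Complex a (-T)) (Complex b T)"
    have S: "z \<in> S \<longleftrightarrow> a \<le> Re z \<and> Re z \<le> b \<and> \<bar>Im z\<bar> \<le> T" for z
      by (auto simp: S_def in_cbox_complex_iff)
    have "S \<subseteq> U" using U S by auto
    hence gS: "g holomorphic_on S"
      unfolding g_def by (intro holomorphic_intros holomorphic_on_subset[OF hol])
    have "norm (g s) \<le> 1"
    proof (rule maximum_modulus_frontier[of g S])
      show "g holomorphic_on interior S" using gS interior_subset by (rule holomorphic_on_subset)
      show "continuous_on (closure S) g" using gS by (simp add: S_def holomorphic_on_imp_continuous_on)
      show "bounded S" by (simp add: S_def)
      show "s \<in> S" using s T by (auto simp: S)
      fix z assume "z \<in> frontier S"
      hence z: "z \<in> S" "z \<notin> box (Complex a (-T)) (Complex b T)"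
        by (auto simp: S_def frontier_cbox)
      hence "Re z = a \<or> Re z = b \<or> \<bar>Im z\<bar> = T"
        by (auto simp: S in_box_complex_iff)
      thus "norm (g z) \<le> 1"
      proof (elim disjE)
        assume "\<bar>Im z\<bar> = T"
        hence "norm (f z) \<le> C * exp (D * T)" "(Im z)^2 = T^2" using growth[of z] z by (auto simp: S)
        hence "norm (g z) \<le> C * exp (D * T) * exp (- d * T^2)"
          using g[of z] z by (simp add: S) (meson exp_ge_zero mult_right_mono order_trans)
        thus ?thesis using T by simp
      next
        assume *: "Re z = a"
        have "norm (g z) \<le> 1 * 1"
          using z d by (intro order_trans[OF g] mult_mono edge disjI1 *) (auto simp: S)
        thus ?thesis by simp
      next
        assume *: "Re z = b"
        have "norm (g z) \<le> 1 * 1"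
          using z d by (intro order_trans[OF g] mult_mono edge disjI2 *) (auto simp: S)
        thus ?thesis by simp
      qed
    qed
    hence "norm (f s) * exp (d * ((Re s)^2 - (Im s)^2 - m^2)) \<le> 1"
      by (simp add: g_def norm_mult norm_exp_eq_Re Re_power2)
    hence "norm (f s) \<le> exp (- (d * ((Re s)^2 - (Im s)^2 - m^2)))"
      unfolding exp_minus by (simp add: inverse_eq_divide pos_le_divide_eq)
    also have "\<dots> \<le> exp (d * (m^2 + (Im s)^2))"
      using d by (simp add: algebra_simps)
    finally show ?thesis .
  qed
  have "((\<lambda>d. exp (d * (m^2 + (Im s)^2))) \<longlongrightarrow> exp (0 * (m^2 + (Im s)^2))) (at_right 0)"
    by (intro tendsto_intros)
  moreover have "eventually (\<lambda>d. norm (f s) \<le> exp (d * (m^2 + (Im s)^2))) (at_right 0)"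
    using eventually_at_right_less[of "0::real"] by eventually_elim (rule bound)
  ultimately have "norm (f s) \<le> exp (0 * (m^2 + (Im s)^2))"
    by (intro tendsto_lowerbound) auto
  thus "norm (f s) \<le> 1 + e" using e by simp
qed

subsection \<open>Dirichlet characters and Gauss sums\<close>

lemma sum_periodic_mult:
  fixes f :: "int \<Rightarrow> 'a::comm_monoid_add"
  assumes q: "q > 0" and per: "\<And>m n. [m = n] (mod q) \<Longrightarrow> f m = f n" and cop: "coprime a q"
  shows "(\<Sum>j\<in>{0..<q}. f (a * j)) = (\<Sum>j\<in>{0..<q}. f j)"
proof -
  have inj: "inj_on (\<lambda>j. (a * j) mod q) {0..<q}"
  proof (rule inj_onI)
    fix x y assume xy: "x \<in> {0..<q}" "y \<in> {0..<q}" "(a * x) mod q = (a * y) mod q"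
    hence "[a * x = a * y] (mod q)" by (simp add: cong_def)
    hence "[x = y] (mod q)" using cop by (simp add: cong_mult_lcancel)
    thus "x = y" using xy by (simp add: cong_def)
  qed
  have "(\<lambda>j. (a * j) mod q) ` {0..<q} = {0..<q}"
    using q by (intro endo_inj_surj inj) auto
  hence "(\<Sum>j\<in>{0..<q}. f j) = (\<Sum>j\<in>(\<lambda>j. (a * j) mod q) ` {0..<q}. f j)" by simp
  also have "\<dots> = (\<Sum>j\<in>{0..<q}. f ((a * j) mod q))"
    by (subst sum.reindex[OF inj]) simp
  also have "\<dots> = (\<Sum>j\<in>{0..<q}. f (a * j))"
    by (intro sum.cong per) (auto simp: cong_def)
  finally show ?thesis ..
qed

text \<open>For \<open>d\<close> dividing \<open>q\<close> this lifts units modulo \<open>d\<close>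
  to units modulo \<open>q\<close>. With \<open>k\<close> the product of the primes of
  \<open>q\<close> that do not divide \<open>n\<close>, every prime of \<open>q\<close> divides
  exactly one of \<open>n\<close> and \<open>k * d\<close>.\<close>

lemma exists_coprime_shift:
  fixes n d q :: int
  assumes "q > 0" "coprime n d"
  obtains k where "coprime (n + k * d) q"
proof -
  define k where "k = \<Prod>{p \<in> prime_factors q. \<not> p dvd n}"
  have "coprime (n + k * d) q"
  proof (rule ccontr)
    assume "\<not> ?thesis"
    hence "\<not> is_unit (gcd (n + k * d) q)" by (simp add: coprime_iff_gcd_eq_1)
    moreover have "gcd (n + k * d) q \<noteq> 0" using assms by simp
    ultimately obtain p where p: "prime p" "p dvd n + k * d" "p dvd q"
      using prime_divisor_exists by (metis gcd_greatest_iff)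
    hence pf: "p \<in> prime_factors q" using assms by (auto simp: prime_factors_dvd)
    show False
    proof (cases "p dvd n")
      case True
      hence "p dvd k * d" using p(2) by (simp add: dvd_add_right_iff)
      moreover have "\<not> p dvd d" using True assms(2) p(1) by (meson coprime_common_divisor not_prime_unit)
      ultimately have "p dvd k" using p(1) by (auto simp: prime_dvd_mult_iff)
      then obtain p' where "p' \<in> prime_factors q" "\<not> p' dvd n" "p dvd p'"
        using p(1) by (auto simp: k_def prime_dvd_prod_iff)
      hence "p' = p" using p(1) by (metis in_prime_factors_iff primes_dvd_imp_eq)
      thus False using True \<open>\<not> p' dvd n\<close> by simp
    next
      case False
      hence "p dvd k" using pf by (auto simp: k_def intro!: dvd_prodI)
      hence "p dvd n" using p(2) by (meson dvd_add_left_iff dvd_mult2)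
      thus False using False by simp
    qed
  qed
  thus ?thesis by (rule that)
qed

locale dirichlet_char =
  fixes q :: nat and chi :: "int \<Rightarrow> complex"
  assumes char: "dirichlet_character q chi"
begin

lemma q_pos: "q > 0" and chi_mult: "chi (m * n) = chi m * chi n"
  and chi_add_q: "chi (n + int q) = chi n" and chi_nz_iff: "chi n \<noteq> 0 \<longleftrightarrow> coprime n (int q)"
  using char unfolding dirichlet_character_def by blast+

lemma chi_zero_iff: "chi n = 0 \<longleftrightarrow> \<not> coprime n (int q)"
  using chi_nz_iff by blast

lemma chi_cong:
  assumes "[m = n] (mod int q)"
  shows "chi m = chi n"
proof -
  have add: "chi (n + int q * int k) = chi n" for n k
  proof (induction k)
    case (Suc k)
    have "n + int q * int (Suc k) = (n + int q * int k) + int q" by (simp add: algebra_simps)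
    thus ?case using Suc.IH chi_add_q by (simp only:)
  qed simp
  have "[n = m] (mod int q)" using assms by (simp add: cong_sym_eq)
  then obtain k where k: "m = n + int q * k" unfolding cong_iff_lin by blast
  show ?thesis
  proof (cases "k \<ge> 0")
    case True
    hence "m = n + int q * int (nat k)" using k by simp
    thus ?thesis using add[of n "nat k"] by (simp only:)
  next
    case False
    hence "n = m + int q * int (nat (-k))" using k by simp
    thus ?thesis using add[of m "nat (-k)"] by (simp only:)
  qed
qed

lemma chi_1: "chi 1 = 1"
  using chi_mult[of 1 1] chi_nz_iff[of 1] by simp

lemma chi_power: "chi (n ^ k) = chi n ^ k"
  by (induction k) (simp_all add: chi_1 chi_mult)

text \<open>By Euler's theorem a nonzero value is a root of unity.\<close>

lemma norm_chi: "norm (chi n) = (if coprime n (int q) then 1 else 0)"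
proof (cases "coprime n (int q)")
  case True
  define m where "m = nat (n mod int q)"
  have m: "int m = n mod int q" using q_pos by (simp add: m_def)
  have "coprime (int m) (int q)" unfolding m using True q_pos by simp
  hence "coprime m q" by simp
  hence "[m ^ totient q = 1] (mod q)" by (rule euler_theorem)
  hence "[int m ^ totient q = 1] (mod int q)" using cong_int_iff[of "m ^ totient q" 1 q] by simp
  hence "chi (int m) ^ totient q = 1" using chi_cong[of "int m ^ totient q" 1] chi_1 by (simp add: chi_power)
  hence "norm (chi (int m)) ^ totient q = 1" using norm_power[of "chi (int m)" "totient q"] by simp
  moreover have "totient q > 0" using q_pos by simp
  ultimately have "norm (chi (int m)) = 1"
    using power_eq_iff_eq_base[of "totient q" "norm (chi (int m))" 1] by simp
  moreover have "chi (int m) = chi n" using m by (intro chi_cong) (simp add: cong_def)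
  ultimately show ?thesis using True by simp
qed (use chi_zero_iff in auto)

lemma norm_chi_le_1: "norm (chi n) \<le> 1"
  by (simp add: norm_chi)

lemma chi_cnj: "chi n * cnj (chi n) = (if coprime n (int q) then 1 else 0)"
  by (simp add: complex_norm_square[symmetric] norm_chi)

lemma dirichlet_char_cnj: "dirichlet_character q (\<lambda>n. cnj (chi n))"
  using char unfolding dirichlet_character_def by (metis complex_cnj_mult complex_cnj_zero_iff)

lemma chi_minus: "chi (- n) = chi (-1) * chi n"
  using chi_mult[of "-1" n] by simp

lemma chi_minus_parity: 
  assumes "chi (-1) = (-1) ^ k"
  shows "chi (- n) = (-1) ^ k * chi n"
  using assms chi_minus[of n] by simp

end

locale nonprincipal_char = dirichlet_char +
  assumes nonprincipal: "\<exists>a. coprime a (int q) \<and> chi a \<noteq> 1"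
begin

lemma sum_chi_zero: "(\<Sum>j\<in>{0..<int q}. chi j) = 0"
proof -
  obtain a where a: "coprime a (int q)" "chi a \<noteq> 1" using nonprincipal by blast
  have "(\<Sum>j\<in>{0..<int q}. chi (a * j)) = (\<Sum>j\<in>{0..<int q}. chi j)"
    using q_pos a by (intro sum_periodic_mult chi_cong) auto
  hence "chi a * (\<Sum>j\<in>{0..<int q}. chi j) = (\<Sum>j\<in>{0..<int q}. chi j)"
    by (simp add: chi_mult sum_distrib_left)
  thus ?thesis using a(2) by simp
qed

lemma q_gt_1: "q > 1"
proof (rule ccontr)
  assume "\<not> q > 1"
  hence "q = 1" using q_pos by simp
  moreover have "{0..<1::int} = {0}" by auto
  ultimately show False using sum_chi_zero chi_cong[of 0 1] chi_1 by (simp add: cong_def)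
qed

lemma chi_0: "chi 0 = 0"
  using q_gt_1 by (simp add: chi_zero_iff)

lemma chi_mult_q: "chi (int q * k) = 0"
  using chi_cong[of "int q * k" 0] chi_0 by (simp add: cong_def)

lemma nonprincipal_cnj: "nonprincipal_char q (\<lambda>n. cnj (chi n))"
proof unfold_locales
  show "dirichlet_character q (\<lambda>n. cnj (chi n))" by (rule dirichlet_char_cnj)
  show "\<exists>a. coprime a (int q) \<and> cnj (chi a) \<noteq> 1"
    using nonprincipal by (metis complex_cnj_cancel_iff complex_cnj_one)
qed

end

section \<open>Additive characters modulo q\<close>

definition additive_char :: "nat \<Rightarrow> int \<Rightarrow> complex" where
  "additive_char q n = cis (2 * pi * of_int n / of_nat q)"

lemma additive_char_add: "additive_char q (m + n) = additive_char q m * additive_char q n"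
  by (simp add: additive_char_def cis_mult add_divide_distrib ring_distribs)

lemma additive_char_cong:
  assumes "[m = n] (mod int q)" "q > 0"
  shows "additive_char q m = additive_char q n"
proof -
  have "[n = m] (mod int q)" using assms by (simp add: cong_sym_eq)
  then obtain k where k: "m = n + int q * k" unfolding cong_iff_lin by blast
  have "additive_char q (int q * k) = 1"
    using assms cis_multiple_2pi[of "of_int k"] by (simp add: additive_char_def mult_ac)
  thus ?thesis by (simp add: k additive_char_add)
qed

lemma additive_char_uminus: "additive_char q (- n) = cnj (additive_char q n)"
  by (simp add: additive_char_def cis_cnj)

lemma additive_char_mult_nat: "additive_char q (k * int n) = additive_char q k ^ n"
  by (simp add: additive_char_def Complex.DeMoivre mult_ac)

lemma additive_char_eq_1_iff:
  assumes "q > 0"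
  shows "additive_char q n = 1 \<longleftrightarrow> int q dvd n"
proof
  assume "additive_char q n = 1"
  hence "cos (2 * pi * of_int n / of_nat q) = 1" by (simp add: additive_char_def complex_eq_iff)
  then obtain k :: int where "2 * pi * of_int n / of_nat q = of_int k * 2 * pi"
    unfolding cos_one_2pi_int by blast
  hence "of_int n = (of_int (k * int q) :: real)" using assms by (simp add: field_simps)
  hence "n = k * int q" by (simp only: of_int_eq_iff)
  thus "int q dvd n" by simp
next
  assume "int q dvd n"
  hence "[n = 0] (mod int q)" by (simp add: cong_0_iff)
  from additive_char_cong[OF this assms] show "additive_char q n = 1"
    by (simp add: additive_char_def)
qed

lemma sum_additive_char:
  assumes q: "q > 0"
  shows "(\<Sum>n\<in>{0..<int q}. additive_char q (k * n)) = (if int q dvd k then of_nat q else 0)"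
proof -
  have "(\<Sum>n\<in>{0..<int q}. additive_char q (k * n)) = (\<Sum>n<q. additive_char q (k * int n))"
    by (rule sum.reindex_bij_witness[of _ int nat]) auto
  also have "\<dots> = (\<Sum>n<q. additive_char q k ^ n)" by (simp add: additive_char_mult_nat)
  also have "\<dots> = (if int q dvd k then of_nat q else 0)"
  proof (cases "int q dvd k")
    case True
    hence "additive_char q k = 1" using additive_char_eq_1_iff[OF q] by simp
    thus ?thesis using True by simp
  next
    case False
    have "additive_char q k ^ q = additive_char q (k * int q)" by (simp add: additive_char_mult_nat)
    also have "\<dots> = 1" using q by (simp add: additive_char_eq_1_iff)
    finally have "additive_char q k ^ q = 1" .
    moreover have "additive_char q k \<noteq> 1" using False q by (simp add: additive_char_eq_1_iff)
    ultimately show ?thesis using False by (simp add: geometric_sum)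
  qed
  finally show ?thesis .
qed

section \<open>Primitive characters and their Gauss sums\<close>

locale primitive_char =
  fixes q :: nat and chi :: "int \<Rightarrow> complex"
  assumes prim: "primitive_dirichlet_character q chi" and q_gt: "q > 1"
begin

sublocale dirichlet_char q chi
  using prim by unfold_locales (simp add: primitive_dirichlet_character_def)

text \<open>The form in which primitivity is used: if \<open>chi\<close> is trivial on all units
  congruent to 1 modulo \<open>d\<close>, then its value at a unit depends only on the class modulo
  \<open>d\<close>, and the resulting character \<open>\<psi>\<close> modulo \<open>d\<close>
  induces it.\<close>

lemma exists_nontrivial_mod:
  assumes d: "d dvd q" "d < q"
  shows "\<exists>a. coprime a (int q) \<and> [a = 1] (mod int d) \<and> chi a \<noteq> 1"
proof (rule ccontr)
  assume "\<not> ?thesis"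
  hence triv: "chi a = 1" if "coprime a (int q)" "[a = 1] (mod int d)" for a
    using that by blast
  have d0: "d > 0" using d q_pos by (auto intro: Nat.gr0I)
  have eq: "chi m = chi n" if mn: "coprime m (int q)" "coprime n (int q)" "[m = n] (mod int d)" for m n
  proof -
    obtain n' where n': "[n * n' = 1] (mod int q)" using mn(2) cong_solve_coprime_int by blast
    have "coprime (n * n') (int q)" by (rule cong_imp_coprime[OF cong_sym[OF n']]) simp
    hence cop: "coprime n' (int q)" by simp
    have "[m * n' = n * n'] (mod int d)" using mn(3) by (intro cong_mult cong_refl)
    moreover have "[n * n' = 1] (mod int d)" by (rule cong_dvd_modulus[OF n']) (use d in simp)
    ultimately have "[m * n' = 1] (mod int d)" by (rule cong_trans)
    hence "chi (m * n') = 1" using mn cop by (intro triv) simp_all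
    moreover have "chi (n * n') = 1" using chi_cong[OF n'] chi_1 by simp
    ultimately have "chi m * chi n' = chi n * chi n'" by (simp add: chi_mult)
    thus ?thesis using cop chi_zero_iff[of n'] by simp
  qed
  \<comment> \<open>A representative prime to \<open>q\<close>; by \<open>eq\<close> the value of
    \<open>chi\<close> does not depend on the choice.\<close>
  define lift where "lift n = (SOME m. coprime m (int q) \<and> [m = n] (mod int d))" for n
  have lift: "coprime (lift n) (int q) \<and> [lift n = n] (mod int d)" if n: "coprime n (int d)" for n
  proof -
    have "int q > 0" using q_pos by simp
    from this n obtain k where "coprime (n + k * int d) (int q)"
      by (rule exists_coprime_shift)
    moreover have "[n + k * int d = n] (mod int d)" by (simp add: cong_def)
    ultimately show ?thesis unfolding lift_def by (intro someI) auto
  qed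
  define \<psi> where "\<psi> n = (if coprime n (int d) then chi (lift n) else 0)" for n
  have \<psi>: "\<psi> n = chi m" if "coprime m (int q)" "[m = n] (mod int d)" for m n
  proof -
    have "coprime m (int d)" using that(1) d by (meson coprime_divisors dvd_refl int_dvd_int_iff)
    hence c: "coprime n (int d)" using that(2) by (metis cong_imp_coprime)
    have "chi (lift n) = chi m"
      using lift[OF c] that by (intro eq) (auto intro: cong_trans cong_sym)
    thus ?thesis using c by (simp add: \<psi>_def)
  qed
  have "dirichlet_character d \<psi>"
    unfolding dirichlet_character_def
  proof (intro conjI allI)
    show "d > 0" by fact
    fix m n :: int
    show "\<psi> (m * n) = \<psi> m * \<psi> n"
    proof (cases "coprime m (int d) \<and> coprime n (int d)")
      case True
      have "\<psi> (m * n) = chi (lift m * lift n)"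
        using lift True by (intro \<psi>) (auto intro: cong_mult)
      thus ?thesis using True by (simp add: \<psi>_def chi_mult)
    next
      case False thus ?thesis by (auto simp: \<psi>_def)
    qed
    show "\<psi> (n + int d) = \<psi> n"
    proof (cases "coprime n (int d)")
      case True
      have "\<psi> (n + int d) = chi (lift n)" using lift[OF True] by (intro \<psi>) (auto simp: cong_def)
      thus ?thesis using True by (simp add: \<psi>_def)
    next
      case False
      hence "\<not> coprime (n + int d) (int d)" by (simp only: coprime_iff_gcd_eq_1 gcd_add1 not_False_eq_True)
      thus ?thesis using False by (simp add: \<psi>_def)
    qed
    show "\<psi> n \<noteq> 0 \<longleftrightarrow> coprime n (int d)"
      unfolding \<psi>_def using lift[of n] chi_nz_iff[of "lift n"] by presburger
  qed
  moreover have "chi n = \<psi> n" if "coprime n (int q)" for n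
    using \<psi>[OF that, of n] by simp
  ultimately have "induced_by q chi d \<psi>" using d by (simp add: induced_by_def)
  thus False using prim d unfolding primitive_dirichlet_character_def by blast
qed

sublocale nonprincipal_char q chi
proof unfold_locales
  show "\<exists>a. coprime a (int q) \<and> chi a \<noteq> 1"
    using exists_nontrivial_mod[of 1] q_gt by auto
qed

text \<open>The Gauss sum of the conjugate character, so that its twists produce \<open>chi\<close>
  itself.\<close>

definition gauss_sum :: "complex" where
  "gauss_sum = (\<Sum>j\<in>{0..<int q}. cnj (chi j) * additive_char q j)"

text \<open>Substituting a unit moves it from the exponential to the character, which settles
  coprime \<open>n\<close>. For the others both sides vanish: primitivity yields a unit
  \<open>a\<close> congruent to 1 modulo \<open>q / gcd n q\<close> with
  \<open>chi a \<noteq> 1\<close>, and \<open>a * n\<close> is congruent to \<open>n\<close> modulo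
  \<open>q\<close>, so the sum equals \<open>cnj (chi a)\<close> times itself.\<close>

lemma gauss_sum_twist:
  "(\<Sum>j\<in>{0..<int q}. cnj (chi j) * additive_char q (j * n)) = chi n * gauss_sum" (is "?S n = _")
proof -
  have per: "cnj (chi j) * additive_char q (j * n) = cnj (chi k) * additive_char q (k * n)"
    if "[j = k] (mod int q)" for j k n
    using that q_pos by (intro arg_cong2[of _ _ _ _ "(*)"] arg_cong[of _ _ cnj] chi_cong additive_char_cong)
      (auto intro: cong_mult)
  have twist: "cnj (chi a) * ?S (a * n) = ?S n" if "coprime a (int q)" for a n
  proof -
    have "?S n = (\<Sum>j\<in>{0..<int q}. cnj (chi (a * j)) * additive_char q ((a * j) * n))"
      using q_pos that by (intro sum_periodic_mult[symmetric] per) auto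
    thus ?thesis by (simp add: chi_mult sum_distrib_left mult_ac)
  qed
  show ?thesis
  proof (cases "coprime n (int q)")
    case True
    have "chi n * ?S 1 = (chi n * cnj (chi n)) * ?S n" using twist[OF True, of 1] by (simp add: mult_ac)
    thus ?thesis using True by (simp add: chi_cnj gauss_sum_def)
  next
    case False
    define g where "g = gcd n (int q)"
    have g: "g > 1" "g dvd int q" "g dvd n"
    proof -
      have "g > 0" using q_pos by (simp add: g_def)
      moreover have "g \<noteq> 1" using False by (simp add: g_def coprime_iff_gcd_eq_1)
      ultimately show "g > 1" by simp
    qed (auto simp: g_def)
    define d where "d = nat (int q div g)"
    have dg: "int d * g = int q" using g q_pos by (simp add: d_def pos_imp_zdiv_nonneg_iff)
    have "d dvd q" "d < q"
    proof -
      show "d dvd q" using dg by (metis dvd_triv_left int_dvd_int_iff)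
      have "d > 0" using dg q_pos by (auto intro: Nat.gr0I)
      hence "int d * 1 < int d * g" using g by (intro mult_strict_left_mono) auto
      thus "d < q" using dg by simp
    qed
    then obtain a where a: "coprime a (int q)" "[a = 1] (mod int d)" "chi a \<noteq> 1"
      using exists_nontrivial_mod by blast
    have "[a * n = n] (mod int q)"
    proof -
      have "int d dvd a - 1" using a(2) by (simp add: cong_iff_dvd_diff)
      hence "int d * g dvd (a - 1) * n" using g(3) by (rule mult_dvd_mono)
      thus ?thesis unfolding dg by (simp add: cong_iff_dvd_diff algebra_simps)
    qed
    hence "?S (a * n) = ?S n"
      using q_pos by (intro sum.cong refl arg_cong2[of _ _ _ _ "(*)"] additive_char_cong cong_mult) auto
    with twist[OF a(1), of n] have "(cnj (chi a) - 1) * ?S n = 0" by (simp add: algebra_simps)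
    moreover have "cnj (chi a) \<noteq> 1" using a(3) by (metis complex_cnj_cancel_iff complex_cnj_one)
    ultimately show ?thesis using False by (simp add: chi_zero_iff[symmetric])
  qed
qed

text \<open>Fourier inversion of \<open>cnj chi\<close> at the residue 1: after
  \<open>gauss_sum_twist\<close> the double sum is the squared modulus.\<close>

lemma norm_gauss_sum: "norm gauss_sum = sqrt q"
proof -
  have "of_nat q * cnj (chi 1) = (\<Sum>j\<in>{0..<int q}. cnj (chi j) * (if j = 1 then of_nat q else 0))"
    using q_gt by (subst sum.mono_neutral_right[of "{0..<int q}" "{1}"]) auto
  also have "\<dots> = (\<Sum>j\<in>{0..<int q}. cnj (chi j) * (\<Sum>n\<in>{0..<int q}. additive_char q ((j - 1) * n)))"
  proof (intro sum.cong refl)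
    fix j assume j: "j \<in> {0..<int q}"
    have "int q dvd j - 1 \<longleftrightarrow> j = 1"
      using j q_gt zdvd_not_zless[of "j-1" "int q"] zdvd_not_zless[of "1-j" "int q"] dvd_diff_commute[of "int q" j 1]
      by (cases "j = 0") (auto dest: zdvd_imp_le)
    thus "cnj (chi j) * (if j = 1 then of_nat q else 0) = cnj (chi j) * (\<Sum>n\<in>{0..<int q}. additive_char q ((j - 1) * n))"
      using sum_additive_char[OF q_pos, of "j - 1"] by simp
  qed
  also have "\<dots> = (\<Sum>n\<in>{0..<int q}. (\<Sum>j\<in>{0..<int q}. cnj (chi j) * additive_char q (j * n)) * cnj (additive_char q n))"
  proof -
    have "additive_char q ((j - 1) * n) = additive_char q (j * n) * cnj (additive_char q n)" for j n
      by (simp add: additive_char_uminus[symmetric] additive_char_add[symmetric] algebra_simps)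
    thus ?thesis unfolding sum_distrib_left sum_distrib_right
      by (subst sum.swap) (simp only: mult.assoc)
  qed
  also have "\<dots> = gauss_sum * cnj gauss_sum"
  proof -
    have "cnj gauss_sum = (\<Sum>n\<in>{0..<int q}. chi n * cnj (additive_char q n))"
      by (simp add: gauss_sum_def)
    thus ?thesis unfolding gauss_sum_twist by (simp add: sum_distrib_left mult_ac)
  qed
  finally have "(of_nat q :: complex) = of_real ((norm gauss_sum)^2)"
    by (simp only: chi_1 complex_norm_square complex_cnj_one mult_1_right)
  hence "real q = (norm gauss_sum)^2" by (metis of_real_eq_iff of_real_of_nat_eq)
  thus ?thesis by (simp add: real_sqrt_unique)
qed

end

subsection \<open>Dirichlet series and Euler products\<close>

text \<open>This trades a conditionally convergent series for one built from differences of
  \<open>u\<close>. In every application the latter converges absolutely, so it can be estimated and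
  integrated termwise.\<close>

lemma Abel_sums:
  fixes f u :: "nat \<Rightarrow> 'a::real_normed_field"
  assumes bdd: "\<And>n. norm (\<Sum>j<n. f j) \<le> B" and u: "u \<longlonglongrightarrow> 0"
    and sums: "(\<lambda>n. (\<Sum>j<Suc n. f j) * (u n - u (Suc n))) sums T"
  shows "(\<lambda>n. f n * u n) sums T"
proof -
  have eq: "(\<Sum>n<N. f n * u n) = (\<Sum>n<N. (\<Sum>j<Suc n. f j) * (u n - u (Suc n))) + (\<Sum>j<N. f j) * u N" for N
    by (induction N) (simp_all add: algebra_simps)
  have "(\<lambda>N. (\<Sum>j<N. f j) * u N) \<longlonglongrightarrow> 0"
  proof (rule tendsto_0_le[OF u])
    show "\<forall>\<^sub>F N in sequentially. norm ((\<Sum>j<N. f j) * u N) \<le> norm (u N) * B"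
      using bdd by (intro always_eventually allI) (simp add: norm_mult mult.commute[of "norm (u _)"] mult_right_mono)
  qed
  hence "(\<lambda>N. (\<Sum>n<N. (\<Sum>j<Suc n. f j) * (u n - u (Suc n))) + (\<Sum>j<N. f j) * u N) \<longlonglongrightarrow> T + 0"
    using sums unfolding sums_def by (intro tendsto_add)
  thus ?thesis unfolding sums_def eq by simp
qed

lemma norm_of_nat_powr_diff_le:
  assumes "n > 0" "Re s > 0"
  shows "norm (of_nat n powr (-s) - of_nat (Suc n) powr (-s)) \<le> norm s * real n powr (- Re s - 1)"
proof -
  have "norm (of_nat n powr (-s) - of_nat (Suc n) powr (-s)) \<le> 
     (norm s * real n powr (- Re s - 1)) * norm (of_nat n - of_nat (Suc n) :: complex)"
  proof (rule field_differentiable_bound[where S = "closed_segment (of_nat n) (of_nat (Suc n))"])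
    fix z :: complex assume "z \<in> closed_segment (of_nat n) (of_nat (Suc n))"
    then obtain t where t: "0 \<le> t" "t \<le> 1" "z = (1 - t) *\<^sub>R of_nat n + t *\<^sub>R of_nat (Suc n)"
      by (auto simp: in_segment)
    have z: "z = of_real (n + t)" by (simp add: t(3) scaleR_conv_of_real algebra_simps)
    have pos: "real n + t > 0" using assms t by simp
    hence "z \<notin> \<real>\<^sub>\<le>\<^sub>0" by (auto simp: z complex_nonpos_Reals_iff)
    thus "((\<lambda>z. z powr (-s)) has_field_derivative (-s * z powr (-s - 1))) (at z within closed_segment (of_nat n) (of_nat (Suc n)))"
      by (auto intro!: derivative_eq_intros)
    have "norm (z powr (-s - 1)) = (n + t) powr (- Re s - 1)"
      using pos by (simp add: z norm_powr_real_powr)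
    also have "\<dots> \<le> real n powr (- Re s - 1)"
      using assms t by (intro powr_mono2') auto
    finally show "norm (-s * z powr (-s - 1)) \<le> norm s * real n powr (- Re s - 1)"
      by (simp add: norm_mult mult_left_mono)
  qed auto
  also have "norm (of_nat n - of_nat (Suc n) :: complex) = 1"
    by simp
  finally show ?thesis by simp
qed

text \<open>The term \<open>n = 0\<close> vanishes because \<open>0 powr y = 0\<close>; the same convention is used for \<open>L\<close> below.\<close>

definition zeta_sum :: "real \<Rightarrow> real" where
  "zeta_sum x = (\<Sum>n. real n powr (-x))"

lemma zeta_sum_sums: "x > 1 \<Longrightarrow> (\<lambda>n. real n powr (-x)) sums zeta_sum x"
  unfolding zeta_sum_def by (intro summable_sums) (simp add: summable_real_powr_iff)

lemma zeta_sum_nonneg: "x > 1 \<Longrightarrow> 0 \<le> zeta_sum x"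
  unfolding zeta_sum_def using zeta_sum_sums[of x] by (intro suminf_nonneg) (auto simp: sums_iff)

text \<open>Comparison with the integral of \<open>t powr (-x)\<close>, in the form of a telescoping
  sum and the mean value theorem.\<close>

lemma zeta_sum_le:
  assumes "x > 1"
  shows "zeta_sum x \<le> x / (x - 1)"
proof -
  have 1: "(\<lambda>n. real (Suc (Suc n)) powr (-x)) sums (zeta_sum x - 1)"
    using zeta_sum_sums[OF assms] sums_split_initial_segment[of "\<lambda>n. real n powr (-x)" "zeta_sum x" 2]
    by (simp add: numeral_2_eq_2)
  have 2: "(\<lambda>n. real (Suc n) powr (1 - x) / (x - 1) - real (Suc (Suc n)) powr (1 - x) / (x - 1)) sums
       (real (Suc 0) powr (1 - x) / (x - 1) - 0)"
  proof (rule telescope_sums')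
    show "(\<lambda>n. real (Suc n) powr (1 - x) / (x - 1)) \<longlonglongrightarrow> 0"
      using assms by real_asymp
  qed
  have 3: "real (Suc (Suc n)) powr (-x) \<le>
      real (Suc n) powr (1 - x) / (x - 1) - real (Suc (Suc n)) powr (1 - x) / (x - 1)" for n
  proof -
    define a where "a = real (Suc n)"
    have a: "a > 0" by (simp add: a_def)
    have "\<exists>z>a. z < a + 1 \<and> (a+1) powr (1 - x) - a powr (1 - x) = (a + 1 - a) * ((1 - x) * z powr (-x))"
      using a by (intro MVT2) (auto intro!: derivative_eq_intros)
    then obtain z where z: "z > a" "z < a + 1" "(a+1) powr (1 - x) - a powr (1 - x) = (1 - x) * z powr (-x)"
      by auto
    have "(a+1) powr (-x) \<le> z powr (-x)" using z a assms by (intro powr_mono2') auto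
    also have "\<dots> = (a powr (1 - x) - (a+1) powr (1 - x)) / (x - 1)"
      using z(3) assms by (simp add: field_simps)
    finally show ?thesis by (simp add: a_def diff_divide_distrib add_ac)
  qed
  have "zeta_sum x - 1 \<le> real (Suc 0) powr (1 - x) / (x - 1) - 0"
    by (rule sums_le[OF 3 1 2])
  hence "zeta_sum x - 1 \<le> 1 / (x - 1)" by simp
  thus ?thesis using assms by (simp add: field_simps)
qed

text \<open>Multiplying by \<open>1 - g p\<close> deletes the multiples of \<open>p\<close>, so
  after the primes up to \<open>N\<close> only the index 1 and indices beyond \<open>N\<close> are
  left. As a limit of finite products the statement avoids infinite products and shows at once that
  \<open>S\<close> is nonzero.\<close>

lemma Euler_product_sieve:
  fixes g :: "nat \<Rightarrow> complex"
  assumes g0: "g 0 = 0" and g1: "g 1 = 1" and mult: "\<And>m n. g (m * n) = g m * g n"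
    and sums: "g sums S" and abs: "summable (\<lambda>n. norm (g n))"
  shows "(\<lambda>N. S * (\<Prod>p | prime p \<and> p \<le> N. 1 - g p)) \<longlonglongrightarrow> 1"
proof -
  define D where "D P = {n::nat. \<forall>p\<in>P. \<not> p dvd n}" for P :: "nat set"
  have hs: "(g has_sum S) UNIV" using norm_summable_imp_has_sum[OF abs sums] .
  have summ: "g summable_on A" for A
    by (rule summable_on_subset_banach[OF has_sum_imp_summable[OF hs]]) auto
  have step: "infsum g (D (insert p P)) = (1 - g p) * infsum g (D P)"
    if p: "prime p" "p \<notin> P" and P: "\<And>r. r \<in> P \<Longrightarrow> prime r" for p P
  proof -
    have part: "D P = D (insert p P) \<union> (\<lambda>m. p * m) ` D P"
    proof (intro equalityI subsetI)
      fix n assume n: "n \<in> D P"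
      show "n \<in> D (insert p P) \<union> (\<lambda>m. p * m) ` D P"
      proof (cases "p dvd n")
        case True
        then obtain m where "n = p * m" by blast
        moreover have "m \<in> D P" using n \<open>n = p * m\<close> unfolding D_def by (auto intro: dvd_mult)
        ultimately show ?thesis by blast
      qed (use n in \<open>auto simp: D_def\<close>)
    next
      fix n assume "n \<in> D (insert p P) \<union> (\<lambda>m. p * m) ` D P"
      thus "n \<in> D P"
      proof
        assume "n \<in> (\<lambda>m. p * m) ` D P"
        then obtain m where m: "n = p * m" "m \<in> D P" by blast
        have "\<not> r dvd n" if "r \<in> P" for r
        proof
          assume "r dvd n"
          hence "r dvd p \<or> r dvd m" using m P[OF that] by (simp add: prime_dvd_mult_iff)
          moreover have "r \<noteq> p" using that p by blast
          ultimately show False using m(2) that primes_dvd_imp_eq[OF P[OF that] p(1)] unfolding D_def by blast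
        qed
        thus ?thesis by (auto simp: D_def)
      qed (auto simp: D_def)
    qed
    have "p > 0" using p by (simp add: prime_gt_0_nat)
    hence "infsum g ((\<lambda>m. p * m) ` D P) = infsum (g \<circ> (\<lambda>m. p * m)) (D P)"
      by (intro infsum_reindex) (auto simp: inj_on_def)
    also have "\<dots> = g p * infsum g (D P)"
      by (simp add: o_def mult infsum_cmult_right')
    finally have "infsum g (D P) = infsum g (D (insert p P)) + g p * infsum g (D P)"
      by (subst part, subst infsum_Un_disjoint[OF summ summ]) (auto simp: D_def)
    thus ?thesis by (simp add: algebra_simps)
  qed
  have prod: "infsum g (D P) = S * (\<Prod>p\<in>P. 1 - g p)" if "finite P" "\<And>r. r \<in> P \<Longrightarrow> prime r" for P
    using that
  proof (induction P rule: finite_induct)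
    case empty
    have "D {} = UNIV" by (simp add: D_def)
    thus ?case using hs by (simp add: infsumI)
  next
    case (insert p P)
    thus ?case using step[of p P] by (simp add: mult_ac)
  qed
  define P where "P N = {p. prime p \<and> p \<le> N}" for N :: nat
  have finP: "finite (P N)" for N unfolding P_def by (rule finite_subset[of _ "{..N}"]) auto
  have "(\<lambda>N. infsum g (D (P N))) \<longlonglongrightarrow> 1"
  proof (rule Lim_null[THEN iffD2], rule tendsto_0_le)
    have "(\<lambda>N. \<Sum>n. norm (g (n + Suc N))) \<longlonglongrightarrow> 0"
      using suminf_exist_split2[OF abs, THEN LIMSEQ_Suc] .
    thus "(\<lambda>N. \<Sum>n. norm (g (n + Suc N))) \<longlonglongrightarrow> 0" .
    show "\<forall>\<^sub>F N in sequentially. norm (infsum g (D (P N)) - 1) \<le> norm (\<Sum>n. norm (g (n + Suc N))) * 1"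
      using eventually_ge_at_top[of 2]
    proof eventually_elim
      case (elim N)
      have sub: "D (P N) \<subseteq> insert 1 {Suc N..}"
      proof
        fix n assume n: "n \<in> D (P N)"
        show "n \<in> insert 1 {Suc N..}"
        proof (rule ccontr)
          assume *: "n \<notin> insert 1 {Suc N..}"
          then obtain p where p: "prime p" "p dvd n" using prime_factor_nat[of n] by auto
          show False
          proof (cases "n = 0")
            \<comment> \<open>The index 0 is sieved out by the prime 2, whence
              \<open>N \<ge> 2\<close>.\<close>
            case True
            thus False using n elim by (auto simp: D_def P_def dest: bspec[of _ _ 2])
          next
            case False
            hence "p \<le> N" using p * by (auto dest: dvd_imp_le)
            thus False using n p by (auto simp: D_def P_def)
          qed
        qed
      qed
      have one: "1 \<in> D (P N)" by (auto simp: D_def P_def)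
      have "infsum g (D (P N)) = infsum g {1} + infsum g (D (P N) - {1})"
        using one by (subst infsum_Un_disjoint[symmetric]) (auto intro: summ simp: insert_absorb)
      hence "infsum g (D (P N)) - 1 = infsum g (D (P N) - {1})" using g1 by simp
      also have "norm \<dots> \<le> infsum (\<lambda>n. norm (g n)) {Suc N..}"
      proof -
        have ns: "(\<lambda>n. norm (g n)) summable_on A" for A
          by (rule summable_on_subset_banach[OF summable_nonneg_imp_summable_on[OF abs]]) auto
        have "norm (infsum g (D (P N) - {1})) \<le> infsum (\<lambda>n. norm (g n)) (D (P N) - {1})"
          by (rule norm_infsum_bound[OF ns])
        also have "\<dots> \<le> infsum (\<lambda>n. norm (g n)) {Suc N..}"
          by (rule infsum_mono2[OF ns ns]) (use sub in auto)
        finally show ?thesis .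
      qed
      also have "infsum (\<lambda>n. norm (g n)) {Suc N..} = (\<Sum>n. norm (g (n + Suc N)))"
      proof (rule infsumI)
        have "(\<lambda>n. norm (g (n + Suc N))) sums (\<Sum>n. norm (g (n + Suc N)))"
          using summable_ignore_initial_segment[OF abs] by (rule summable_sums)
        hence "((\<lambda>n. norm (g (n + Suc N))) has_sum (\<Sum>n. norm (g (n + Suc N)))) UNIV"
          by (rule sums_nonneg_imp_has_sum) simp
        moreover have "bij_betw (\<lambda>n. n + Suc N) UNIV {Suc N..}"
          by (rule bij_betwI[of _ _ _ "\<lambda>n. n - Suc N"]) auto
        ultimately show "((\<lambda>n. norm (g n)) has_sum (\<Sum>n. norm (g (n + Suc N)))) {Suc N..}"
          using has_sum_reindex_bij_betw[of "\<lambda>n. n + Suc N" UNIV "{Suc N..}" "\<lambda>n. norm (g n)"] by blast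
      qed
      finally show ?case by (simp add: abs_le_iff)
    qed
  qed
  thus ?thesis using prod[OF finP] by (simp add: P_def)
qed

text \<open>The square of one Euler factor of the 3-4-1 product. Bounding each of the three factors by
  \<open>t \<le> exp (t - 1)\<close> avoids logarithms, at the price of the convergent factor \<open>exp (8 r\<^sup>2)\<close>.\<close>

lemma exp_square_sum_bound:
  fixes r :: real and w :: complex
  assumes w: "norm w = 1 \<or> w = 0" and r: "0 \<le> r" "r \<le> 1"
  shows "(1 - r)^6 * norm (1 - of_real r * w)^8 * norm (1 - of_real r * w^2)^2 \<le> exp (8 * r^2)"
proof -
  define u where "u = norm (1 - of_real r * w)^2"
  define v where "v = norm (1 - of_real r * w^2)^2"
  have le: "t \<le> exp (t - 1)" for t :: real using exp_ge_add_one_self[of "t - 1"] by simp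
  have uv: "u \<ge> 0" "v \<ge> 0" by (auto simp: u_def v_def)
  have "3 * (1 - r)^2 + 4 * u + v - 8 \<le> 8 * r^2"
  proof (cases "w = 0")
    case True
    thus ?thesis using r by (simp add: u_def v_def power2_eq_square algebra_simps)
  next
    case False
    define x where "x = Re w"
    define y where "y = Im w"
    have xy: "x^2 + y^2 = 1" using w False cmod_power2[of w] by (simp add: x_def y_def)
    have u: "u = 1 - 2 * r * x + r^2"
    proof -
      have "u = (1 - r * x)^2 + (r * y)^2" by (simp add: u_def cmod_power2 x_def y_def)
      also have "\<dots> = 1 - 2 * r * x + r^2 * (x^2 + y^2)" by (simp add: power2_eq_square algebra_simps)
      finally show ?thesis using xy by simp
    qed
    have v: "v = 1 - 2 * r * (2 * x^2 - 1) + r^2"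
    proof -
      have "v = (1 - r * (x^2 - y^2))^2 + (r * (2 * x * y))^2"
        by (simp add: v_def cmod_power2 x_def y_def Re_power2 Im_power2)
      also have "\<dots> = 1 - 2 * r * (x^2 - y^2) + r^2 * (x^2 + y^2)^2" by (simp add: power2_eq_square algebra_simps)
      also have "x^2 - y^2 = 2 * x^2 - 1" using xy by simp
      finally show ?thesis using xy by simp
    qed
    have "3 * (1 - r)^2 + 4 * u + v - 8 = 8 * r^2 - 4 * (r * (x + 1)^2)"
      unfolding u v by (simp add: power2_eq_square algebra_simps)
    thus ?thesis using r by simp
  qed
  moreover have "((1 - r)^2)^3 * u^4 * v \<le> exp ((1-r)^2 - 1)^3 * exp (u - 1)^4 * exp (v - 1)"
    by (intro mult_mono power_mono le) (auto simp: uv)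
  moreover have "exp ((1-r)^2 - 1)^3 * exp (u - 1)^4 * exp (v - 1) = exp (3 * (1 - r)^2 + 4 * u + v - 8)"
    by (simp add: exp_of_nat_mult[symmetric] exp_add[symmetric] algebra_simps)
  ultimately have "((1 - r)^2)^3 * u^4 * v \<le> exp (8 * r^2)" 
    by (smt (verit) exp_le_cancel_iff)
  thus ?thesis by (simp add: u_def v_def power_mult[symmetric])
qed

lemma norm_of_nat_powr: "norm (of_nat n powr z :: complex) = real n powr Re z"
  by (cases "n = 0") (simp_all add: norm_powr_real_powr)

lemma of_nat_powr_tendsto_0:
  assumes "Re s > 0"
  shows "(\<lambda>n. of_nat n powr (-s) :: complex) \<longlonglongrightarrow> 0"
proof (rule tendsto_norm_zero_cancel)
  have "(\<lambda>n. real n powr (- Re s)) \<longlonglongrightarrow> 0" using assms by real_asymp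
  thus "(\<lambda>n. norm (of_nat n powr (-s) :: complex)) \<longlonglongrightarrow> 0" by (simp add: norm_of_nat_powr)
qed

section \<open>Dirichlet series in the half-plane of absolute convergence\<close>

context dirichlet_char
begin

text \<open>Meaningful only for \<open>Re s > 0\<close>, where the series converges for nonprincipal \<open>chi\<close>.\<close>

definition L :: "complex \<Rightarrow> complex" where
  "L s = (\<Sum>n. chi (int n) * of_nat n powr (-s))"

lemma norm_L_term_le: "norm (chi (int n) * of_nat n powr (-s)) \<le> real n powr (- Re s)"
proof -
  have "norm (chi (int n) * of_nat n powr (-s)) = norm (chi (int n)) * real n powr (- Re s)"
    by (simp only: norm_mult norm_of_nat_powr uminus_complex.sel)
  also have "\<dots> \<le> 1 * real n powr (- Re s)"
    by (rule mult_right_mono[OF norm_chi_le_1]) simp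
  finally show ?thesis by simp
qed

lemma summable_norm_L:
  assumes "Re s > 1"
  shows "summable (\<lambda>n. norm (chi (int n) * of_nat n powr (-s)))"
proof (rule summable_comparison_test)
  show "\<exists>N. \<forall>n\<ge>N. norm (norm (chi (int n) * of_nat n powr (-s))) \<le> real n powr (- Re s)"
    using norm_L_term_le by auto
  show "summable (\<lambda>n. real n powr (- Re s))" using zeta_sum_sums[OF assms] by (rule sums_summable)
qed

lemma L_sums_right:
  assumes "Re s > 1"
  shows "(\<lambda>n. chi (int n) * of_nat n powr (-s)) sums L s"
  unfolding L_def by (rule summable_sums[OF summable_norm_cancel[OF summable_norm_L[OF assms]]])

lemma norm_L_le_zeta_sum:
  assumes "Re s > 1"
  shows "norm (L s) \<le> zeta_sum (Re s)"
proof -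
  have "norm (L s) \<le> (\<Sum>n. norm (chi (int n) * of_nat n powr (-s)))"
    unfolding L_def by (rule summable_norm[OF summable_norm_L[OF assms]])
  also have "\<dots> \<le> zeta_sum (Re s)"
    unfolding zeta_sum_def using zeta_sum_sums[OF assms]
    by (intro suminf_le norm_L_term_le summable_norm_L assms) (rule sums_summable)
  finally show ?thesis .
qed

lemma L_Euler_product:
  assumes "Re s > 1"
  shows "(\<lambda>N. L s * (\<Prod>p | prime p \<and> p \<le> N. 1 - chi (int p) * of_nat p powr (-s))) \<longlonglongrightarrow> 1"
proof (rule Euler_product_sieve)
  fix m n :: nat
  show "chi (int (m * n)) * of_nat (m * n) powr (-s) =
      chi (int m) * of_nat m powr (-s) * (chi (int n) * of_nat n powr (-s))"
    using powr_times_real[of "of_nat m" "of_nat n" "-s"] by (simp add: chi_mult)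
qed (use assms L_sums_right summable_norm_L in \<open>simp_all add: chi_1\<close>)

end

lemma zeta_Euler_product:
  assumes "x > 1"
  shows "(\<lambda>N. zeta_sum x * (\<Prod>p | prime p \<and> p \<le> N. 1 - real p powr (-x))) \<longlonglongrightarrow> 1"
proof -
  have "(\<lambda>N. of_real (zeta_sum x) * (\<Prod>p | prime p \<and> p \<le> N. 1 - of_real (real p powr (-x)))) \<longlonglongrightarrow> (1::complex)"
  proof (rule Euler_product_sieve)
    show "(\<lambda>n. complex_of_real (real n powr (-x))) sums of_real (zeta_sum x)"
      using zeta_sum_sums[OF assms] by (rule sums_of_real)
    show "summable (\<lambda>n. norm (complex_of_real (real n powr (-x))))"
      using zeta_sum_sums[OF assms] by (simp add: sums_iff)
  qed (auto simp: powr_mult)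
  hence "(\<lambda>N. complex_of_real (zeta_sum x * (\<Prod>p | prime p \<and> p \<le> N. 1 - real p powr (-x)))) \<longlonglongrightarrow> of_real 1"
    by simp
  thus ?thesis by (simp only: tendsto_of_real_iff)
qed

context dirichlet_char
begin

text \<open>With \<open>r = p powr (- Re s)\<close>, an inverse Euler factor of \<open>L\<close>
  times one of zeta has modulus at most \<open>(1 + r) * (1 - r) \<le> 1\<close>. The quantitative
  bound, not only nonvanishing, is used later near the line Re s = 1.\<close>

lemma L_norm_ge:
  assumes "Re s > 1"
  shows "1 \<le> norm (L s) * zeta_sum (Re s)"
proof -
  let ?P = "\<lambda>N. {p. prime p \<and> p \<le> (N::nat)}"
  have "(\<lambda>N. norm (L s * (\<Prod>p\<in>?P N. 1 - chi (int p) * of_nat p powr (-s))) * (zeta_sum (Re s) * (\<Prod>p\<in>?P N. 1 - real p powr (-Re s))))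
     \<longlonglongrightarrow> norm (1::complex) * 1"
    by (intro tendsto_intros L_Euler_product zeta_Euler_product assms)
  hence lim: "(\<lambda>N. norm (L s) * zeta_sum (Re s) * (\<Prod>p\<in>?P N. norm (1 - chi (int p) * of_nat p powr (-s)) * (1 - real p powr (-Re s)))) \<longlonglongrightarrow> 1"
    by (simp add: norm_mult prod_norm[symmetric] prod.distrib mult_ac)
  have zpos: "zeta_sum (Re s) \<ge> 0"
    by (rule zeta_sum_nonneg[OF assms])
  have fac: "0 \<le> norm (1 - chi (int p) * of_nat p powr (-s)) * (1 - real p powr (-Re s)) \<and>
     norm (1 - chi (int p) * of_nat p powr (-s)) * (1 - real p powr (-Re s)) \<le> 1" if "prime p" for p
  proof -
    define r where "r = real p powr (-Re s)"
    have "r \<le> real p powr 0"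
      unfolding r_def using that assms prime_ge_1_nat[OF that] by (intro powr_mono) auto
    hence r: "0 \<le> r" "r \<le> 1" using prime_gt_0_nat[OF that] by (auto simp: r_def)
    have "norm (1 - chi (int p) * of_nat p powr (-s)) \<le> 1 + r"
      using norm_L_term_le[of p s] norm_triangle_ineq4[of 1 "chi (int p) * of_nat p powr (-s)"]
      by (simp add: r_def)
    hence "norm (1 - chi (int p) * of_nat p powr (-s)) * (1 - r) \<le> (1 + r) * (1 - r)"
      using r by (intro mult_right_mono) auto
    also have "\<dots> \<le> 1" by (simp add: algebra_simps)
    finally show ?thesis using r by (simp add: r_def)
  qed
  have "norm (L s) * zeta_sum (Re s) * (\<Prod>p\<in>?P N. norm (1 - chi (int p) * of_nat p powr (-s)) * (1 - real p powr (-Re s)))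
      \<le> norm (L s) * zeta_sum (Re s) * 1" for N
    using zpos fac by (intro mult_left_mono prod_le_1) auto
  thus ?thesis using LIMSEQ_le_const2[OF lim] by auto
qed

lemma L_nonzero_right: "Re s > 1 \<Longrightarrow> L s \<noteq> 0"
  using L_norm_ge[of s] by auto

lemma dirichlet_char_square: "dirichlet_char q (\<lambda>n. chi n ^ 2)"
proof
  show "dirichlet_character q (\<lambda>n. (chi n)\<^sup>2)"
    unfolding dirichlet_character_def
  proof (intro conjI allI)
    show "chi (m * n) ^ 2 = chi m ^ 2 * chi n ^ 2" for m n by (simp add: chi_mult power_mult_distrib)
    show "chi (n + int q) ^ 2 = chi n ^ 2" for n by (simp only: chi_add_q)
    show "chi n ^ 2 \<noteq> 0 \<longleftrightarrow> coprime n (int q)" for n by (simp add: chi_zero_iff)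
  qed (rule q_pos)
qed

text \<open>The product zeta^3 |L(chi)|^4 |L(chi^2)| at a real point, squared. The square of
  \<open>chi\<close> is taken modulo \<open>q\<close>, so that prime by prime the Euler factors form
  the expression of \<open>exp_square_sum_bound\<close>.\<close>

lemma L_three_four_one:
  assumes x: "x > 1"
  shows "exp (-16) \<le> zeta_sum x ^ 6 * norm (L (of_real x)) ^ 8 * norm (dirichlet_char.L (\<lambda>n. chi n ^ 2) (of_real x)) ^ 2"
proof -
  interpret S: dirichlet_char q "\<lambda>n. chi n ^ 2" by (rule dirichlet_char_square)
  let ?P = "\<lambda>N. {p. prime p \<and> p \<le> (N::nat)}"
  define r where "r p = real p powr (-x)" for p :: nat
  have pr: "of_nat p powr (- complex_of_real x) = of_real (r p)" for p
    using powr_of_real[of "real p" "-x"] by (simp add: r_def)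
  have fin: "finite (?P N)" for N by (rule finite_subset[of _ "{..N}"]) auto
  have x': "Re (of_real x) > 1" using x by simp
  define T where "T = zeta_sum x ^ 6 * norm (L (of_real x)) ^ 8 * norm (S.L (of_real x)) ^ 2"
  define F where "F p = (1 - r p)^6 * norm (1 - of_real (r p) * chi (int p))^8 * norm (1 - of_real (r p) * chi (int p)^2)^2" for p
  have "(\<lambda>N. (zeta_sum x * (\<Prod>p\<in>?P N. 1 - real p powr (-x)))^6 *
      norm (L (of_real x) * (\<Prod>p\<in>?P N. 1 - chi (int p) * of_nat p powr (- of_real x)))^8 *
      norm (S.L (of_real x) * (\<Prod>p\<in>?P N. 1 - chi (int p)^2 * of_nat p powr (- of_real x)))^2) \<longlonglongrightarrow> 1^6 * norm (1::complex)^8 * norm (1::complex)^2"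
    by (intro tendsto_intros L_Euler_product[OF x'] S.L_Euler_product[OF x'] zeta_Euler_product x)
  also have "(\<lambda>N. (zeta_sum x * (\<Prod>p\<in>?P N. 1 - real p powr (-x)))^6 *
      norm (L (of_real x) * (\<Prod>p\<in>?P N. 1 - chi (int p) * of_nat p powr (- of_real x)))^8 *
      norm (S.L (of_real x) * (\<Prod>p\<in>?P N. 1 - chi (int p)^2 * of_nat p powr (- of_real x)))^2) = (\<lambda>N. T * (\<Prod>p\<in>?P N. F p))"
    by (simp add: T_def F_def pr norm_mult prod_norm[symmetric] prod.distrib power_mult_distrib prod_power_distrib[symmetric] mult_ac r_def)
  finally have lim: "(\<lambda>N. T * (\<Prod>p\<in>?P N. F p)) \<longlonglongrightarrow> 1" by simp
  have T0: "T \<ge> 0"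
    using zeta_sum_nonneg[OF x] by (simp add: T_def)
  \<comment> \<open>Each prime costs at most \<open>exp (8 * p powr (-2))\<close>, and
    \<open>zeta_sum 2 \<le> 2\<close>; hence the 16.\<close>
  have "(\<Prod>p\<in>?P N. F p) \<le> exp 16" for N
  proof -
    have r: "0 \<le> r p" "r p \<le> 1" "r p ^ 2 \<le> real p powr (-2)" if "p \<in> ?P N" for p
    proof -
      have p: "real p \<ge> 1" using that prime_ge_1_nat[of p] by simp
      show "0 \<le> r p" by (simp add: r_def)
      have "r p \<le> real p powr 0" unfolding r_def using p x by (intro powr_mono) auto
      thus "r p \<le> 1" using p by simp
      have "r p ^ 2 = real p powr (-2 * x)"
        using p by (simp add: r_def power2_eq_square powr_add[symmetric])
      also have "\<dots> \<le> real p powr (-2)" using p x by (intro powr_mono) auto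
      finally show "r p ^ 2 \<le> real p powr (-2)" .
    qed
    have "(\<Prod>p\<in>?P N. F p) \<le> (\<Prod>p\<in>?P N. exp (8 * real p powr (-2)))"
    proof (intro prod_mono conjI)
      fix p assume p: "p \<in> ?P N"
      show "F p \<ge> 0" using r[OF p] by (simp add: F_def)
      have "F p \<le> exp (8 * r p ^ 2)"
        unfolding F_def using r[OF p] norm_chi[of "int p"] chi_zero_iff[of "int p"] by (intro exp_square_sum_bound) auto
      also have "\<dots> \<le> exp (8 * real p powr (-2))" using r[OF p] by simp
      finally show "F p \<le> exp (8 * real p powr (-2))" .
    qed
    also have "\<dots> = exp (8 * (\<Sum>p\<in>?P N. real p powr (-2)))"
      by (simp add: exp_sum[OF fin] sum_distrib_left)
    also have "(\<Sum>p\<in>?P N. real p powr (-2)) \<le> (\<Sum>p<Suc N. real p powr (-2))"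
      by (intro sum_mono2) auto
    also have "\<dots> \<le> zeta_sum 2"
      unfolding zeta_sum_def using zeta_sum_sums[of 2] by (intro sum_le_suminf) (auto simp: sums_iff)
    also have "\<dots> \<le> 2" using zeta_sum_le[of 2] by simp
    finally show ?thesis by simp
  qed
  hence "T * (\<Prod>p\<in>?P N. F p) \<le> T * exp 16" for N
    using T0 by (intro mult_left_mono)
  hence "1 \<le> T * exp 16" using LIMSEQ_le_const2[OF lim] by blast
  hence "exp (-16) \<le> T" by (simp add: exp_minus field_simps)
  thus ?thesis by (simp add: T_def)
qed

end

section \<open>Conditional convergence for nonprincipal characters\<close>

context nonprincipal_char
begin

lemma norm_psum_le: "norm (\<Sum>j<n. chi (int j)) \<le> q"
proof -
  have per: "(\<Sum>j<q * k + r. chi (int j)) = (\<Sum>j<r. chi (int j))" for k r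
  proof (induction k)
    case (Suc k)
    have z: "(\<Sum>j<q. chi (int j)) = 0"
      using sum_chi_zero by (subst (asm) sum.reindex_bij_witness[of _ int nat "{..<q}" "\<lambda>j. chi (int j)"]) auto
    have "(\<Sum>j<q * Suc k + r. chi (int j)) = (\<Sum>j<q + (q * k + r). chi (int j))" by (simp add: add_ac)
    also have "\<dots> = (\<Sum>j<q. chi (int j)) + (\<Sum>j<q * k + r. chi (int (q + j)))"
    proof -
      have "(\<Sum>j<m + n. f j) = (\<Sum>j<m. f j) + (\<Sum>j<n. f (m + j))" for m n and f :: "nat \<Rightarrow> complex"
        by (induction n) (simp_all add: add_ac)
      thus ?thesis .
    qed
    also have "(\<Sum>j<q * k + r. chi (int (q + j))) = (\<Sum>j<q * k + r. chi (int j))"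
      by (intro sum.cong refl chi_cong) (simp add: cong_def)
    finally show ?case using Suc.IH z by simp
  qed simp
  have "norm (\<Sum>j<q * (n div q) + n mod q. chi (int j)) \<le> (\<Sum>j<n mod q. 1)"
    unfolding per by (intro sum_norm_le norm_chi_le_1)
  also have "\<dots> \<le> real q" using mod_less_divisor[OF q_pos, of n] by simp
  finally show ?thesis by simp
qed

definition L_Abel_term :: "nat \<Rightarrow> complex \<Rightarrow> complex" where
  "L_Abel_term n s = (\<Sum>j<Suc n. chi (int j)) * (of_nat n powr (-s) - of_nat (Suc n) powr (-s))"

lemma norm_L_Abel_term_le:
  assumes "Re s > 0"
  shows "norm (L_Abel_term n s) \<le> q * norm s * real n powr (- Re s - 1)"
proof (cases "n = 0")
  case False
  have "norm (L_Abel_term n s) \<le> q * (norm s * real n powr (- Re s - 1))"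
    unfolding L_Abel_term_def norm_mult
    using False assms norm_of_nat_powr_diff_le[of n s] norm_psum_le[of "Suc n"] by (intro mult_mono) auto
  thus ?thesis by simp
qed (simp add: L_Abel_term_def chi_0)

lemma L_Abel_sums:
  assumes "Re s > 0"
  shows "(\<lambda>n. L_Abel_term n s) sums L s"
proof -
  have "summable (\<lambda>n. L_Abel_term n s)"
  proof (rule summable_comparison_test)
    show "\<exists>N. \<forall>n\<ge>N. norm (L_Abel_term n s) \<le> q * norm s * real n powr (- Re s - 1)"
      using norm_L_Abel_term_le[OF assms] by blast
    show "summable (\<lambda>n. q * norm s * real n powr (- Re s - 1))"
      using assms by (intro summable_mult) (simp add: summable_real_powr_iff)
  qed
  hence 1: "(\<lambda>n. L_Abel_term n s) sums (\<Sum>n. L_Abel_term n s)" by (rule summable_sums)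
  from Abel_sums[OF norm_psum_le of_nat_powr_tendsto_0[OF assms] 1[unfolded L_Abel_term_def]]
  have "L s = (\<Sum>n. L_Abel_term n s)" unfolding L_def L_Abel_term_def by (rule sums_unique[symmetric])
  with 1 show ?thesis by simp
qed

lemma L_sums:
  assumes "Re s > 0"
  shows "(\<lambda>n. chi (int n) * of_nat n powr (-s)) sums L s"
proof -
  from Abel_sums[OF norm_psum_le of_nat_powr_tendsto_0[OF assms] L_Abel_sums[OF assms, unfolded L_Abel_term_def]]
  show ?thesis .
qed

text \<open>Partial summation costs one factor \<open>norm s\<close>; linear growth is far below
  what Phragmen-Lindeloef allows.\<close>

lemma norm_L_growth:
  assumes "1/2 \<le> Re s"
  shows "norm (L s) \<le> q * norm s * zeta_sum (3/2)"
proof -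
  have le: "norm (L_Abel_term n s) \<le> q * norm s * real n powr (- (3/2))" for n
  proof -
    have "norm (L_Abel_term n s) \<le> q * norm s * real n powr (- Re s - 1)"
      using assms by (intro norm_L_Abel_term_le) auto
    also have "\<dots> \<le> q * norm s * real n powr (- (3/2))"
      using assms by (cases "n = 0") (auto intro!: mult_left_mono powr_mono)
    finally show ?thesis .
  qed
  have sm: "(\<lambda>n. q * norm s * real n powr (- (3/2))) sums (q * norm s * zeta_sum (3/2))"
    by (intro sums_mult zeta_sum_sums) auto
  have ns: "summable (\<lambda>n. norm (L_Abel_term n s))"
    by (rule summable_comparison_test[OF _ sums_summable[OF sm]]) (use le in auto)
  have "norm (L s) \<le> (\<Sum>n. norm (L_Abel_term n s))"
    using summable_norm[OF ns] L_Abel_sums[of s] assms by (simp add: sums_iff)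
  also have "\<dots> \<le> q * norm s * zeta_sum (3/2)"
    using suminf_le[OF le ns sums_summable[OF sm]] sums_unique[OF sm] by simp
  finally show ?thesis .
qed

lemma L_holomorphic: "L holomorphic_on {s. Re s > 0}"
proof (rule holomorphic_uniform_sequence)
  show "open {s. Re s > 0}" by (rule open_halfspace_Re_gt)
  show "(\<lambda>s. \<Sum>n<N. L_Abel_term n s) holomorphic_on {s. Re s > 0}" for N
    unfolding L_Abel_term_def
    by (intro holomorphic_on_sum holomorphic_on_mult holomorphic_on_const holomorphic_on_diff
          holomorphic_on_powr_right holomorphic_on_minus holomorphic_on_ident)
  fix x assume x: "x \<in> {s. Re s > 0}"
  define d where "d = Re x / 2"
  have d: "d > 0" using x by (simp add: d_def)
  have re: "d \<le> Re s" "norm s \<le> norm x + d" if "s \<in> cball x d" for s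
  proof -
    have n: "norm (x - s) \<le> d" using that by (simp add: dist_norm)
    show "d \<le> Re s" using abs_Re_le_cmod[of "x - s"] n by (simp add: d_def)
    show "norm s \<le> norm x + d" using norm_triangle_ineq3[of s x] n by (simp add: norm_minus_commute)
  qed
  show "\<exists>d>0. cball x d \<subseteq> {s. Re s > 0} \<and> uniform_limit (cball x d) (\<lambda>N s. \<Sum>n<N. L_Abel_term n s) L sequentially"
  proof (intro exI conjI)
    show "cball x d \<subseteq> {s. Re s > 0}" using re(1) d by (auto intro: less_le_trans)
    have "uniform_limit (cball x d) (\<lambda>N s. \<Sum>n<N. L_Abel_term n s) (\<lambda>s. \<Sum>n. L_Abel_term n s) sequentially"
    proof (rule Weierstrass_m_test)
      fix n s assume s: "s \<in> cball x d"
      have "norm (L_Abel_term n s) \<le> q * norm s * real n powr (- Re s - 1)"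
        using re[OF s] d by (intro norm_L_Abel_term_le) auto
      also have "\<dots> \<le> q * (norm x + d) * real n powr (- d - 1)"
        using re[OF s] d by (cases "n = 0") (auto intro!: mult_mono powr_mono)
      finally show "norm (L_Abel_term n s) \<le> q * (norm x + d) * real n powr (- d - 1)" .
    next
      show "summable (\<lambda>n. q * (norm x + d) * real n powr (- d - 1))"
        using d by (intro summable_mult) (simp add: summable_real_powr_iff)
    qed
    also have "?this \<longleftrightarrow> uniform_limit (cball x d) (\<lambda>N s. \<Sum>n<N. L_Abel_term n s) L sequentially"
    proof (rule uniform_limit_cong')
      fix s assume "s \<in> cball x d"
      thus "(\<Sum>n. L_Abel_term n s) = L s"
        using L_Abel_sums[of s] re[of s] d by (intro sums_unique[symmetric]) simp
    qed (rule refl)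
    finally show "uniform_limit (cball x d) (\<lambda>N s. \<Sum>n<N. L_Abel_term n s) L sequentially" .
  qed (rule d)
qed

end

subsection \<open>Non-vanishing at 1\<close>

lemma sum_divisors_prime_power_mult:
  fixes c :: "nat \<Rightarrow> real"
  assumes mult: "\<And>m n. c (m * n) = c m * c n" and c1: "c 1 = 1"
    and p: "prime p" "\<not> p dvd m" and m: "m > 0"
  shows "(\<Sum>d | d dvd p ^ k * m. c d) = (\<Sum>i\<le>k. c p ^ i) * (\<Sum>d | d dvd m. c d)"
proof -
  have cpow: "c (p ^ i) = c p ^ i" for i by (induction i) (use mult c1 in simp_all)
  have cop: "coprime (p ^ i) e" if "e dvd m" for i e
  proof -
    have "\<not> p dvd e" using that p(2) dvd_trans by blast
    thus ?thesis using p(1) by (simp add: prime_imp_coprime)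
  qed
  have set: "{d. d dvd p ^ k * m} = (\<lambda>(i, e). p ^ i * e) ` ({..k} \<times> {e. e dvd m})"
  proof (intro equalityI subsetI)
    fix d assume "d \<in> {d. d dvd p ^ k * m}"
    then obtain a b where ab: "d = a * b" "a dvd p ^ k" "b dvd m" using division_decomp by blast
    then obtain i where "i \<le> k" "a = p ^ i" using divides_primepow_nat[OF p(1)] by blast
    thus "d \<in> (\<lambda>(i, e). p ^ i * e) ` ({..k} \<times> {e. e dvd m})" using ab by auto
  next
    fix d assume "d \<in> (\<lambda>(i, e). p ^ i * e) ` ({..k} \<times> {e. e dvd m})"
    then obtain i e where "i \<le> k" "e dvd m" "d = p ^ i * e" by auto
    thus "d \<in> {d. d dvd p ^ k * m}" by (simp add: mult_dvd_mono le_imp_power_dvd)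
  qed
  have inj: "inj_on (\<lambda>(i, e). p ^ i * e) ({..k} \<times> {e. e dvd m})"
  proof (rule inj_onI, clarify)
    fix i e j e' assume e: "e dvd m" "e' dvd m" and eq: "p ^ i * e = p ^ j * e'"
    have "p ^ i dvd p ^ j * e'" "p ^ j dvd p ^ i * e" using eq by (metis dvd_triv_left)+
    hence "p ^ i dvd p ^ j" "p ^ j dvd p ^ i" using cop e by (auto simp: coprime_dvd_mult_left_iff)
    hence "p ^ i = p ^ j" by (rule dvd_antisym)
    moreover have "p > 1" using p(1) by (rule prime_gt_1_nat)
    ultimately have "i = j" by simp
    thus "i = j \<and> e = e'" using eq \<open>p > 1\<close> by simp
  qed
  have "(\<Sum>d | d dvd p ^ k * m. c d) = (\<Sum>(i, e)\<in>{..k} \<times> {e. e dvd m}. c p ^ i * c e)"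
    unfolding set by (subst sum.reindex[OF inj]) (simp add: case_prod_unfold o_def mult cpow)
  also have "\<dots> = (\<Sum>i\<le>k. c p ^ i) * (\<Sum>d | d dvd m. c d)"
    by (simp add: sum_product sum.cartesian_product)
  finally show ?thesis .
qed

text \<open>By multiplicativity the sum is a product, over prime powers, of geometric sums of -1, 0
  or 1; these are nonnegative, and at least 1 when the exponent is even.\<close>

lemma sum_divisors_real_char:
  fixes c :: "nat \<Rightarrow> real"
  assumes mult: "\<And>m n. c (m * n) = c m * c n" and c1: "c 1 = 1" and c: "\<And>n. c n \<in> {-1, 0, 1}" and n: "n > 0"
  shows "(\<Sum>d | d dvd n. c d) \<ge> 0" and "(\<Sum>d | d dvd n ^ 2. c d) \<ge> 1"
proof -
  have geom: "(\<Sum>i\<le>k. t ^ i) \<ge> 0 \<and> (even k \<longrightarrow> (\<Sum>i\<le>k. t ^ i) \<ge> 1)" if "t \<in> {-1, 0, 1}" for t :: real and k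
  proof -
    have "(\<Sum>i\<le>k. (-1::real) ^ i) = (if even k then 1 else 0)" by (induction k) auto
    moreover have "(\<Sum>i\<le>k. (0::real) ^ i) = 1" by (induction k) auto
    ultimately show ?thesis using that by auto
  qed
  have "(\<Sum>d | d dvd n. c d) \<ge> 0 \<and> (\<Sum>d | d dvd n ^ 2. c d) \<ge> 1" using n
  proof (induction n rule: less_induct)
    case (less n)
    show ?case
    proof (cases "n = 1")
      case True
      have "{d::nat. d dvd 1} = {1}" by auto
      thus ?thesis using True c1 by simp
    next
      case False
      then obtain p where p: "prime p" "p dvd n" using prime_factor_nat by blast
      define k where "k = multiplicity p n"
      obtain m where m: "n = p ^ k * m" "\<not> p dvd m" 
        unfolding k_def by (rule multiplicity_decompose'[of n p]) (use p less.prems in auto)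
      have m0: "m > 0" using m less.prems by (auto intro: Nat.gr0I)
      have "k > 0" using p less.prems m by (cases k) auto
      hence "p ^ k > 1" by (intro one_less_power prime_gt_1_nat p(1))
      hence "m < n" using m m0 by simp
      note IH = less.IH[OF this m0]
      have n2: "n ^ 2 = p ^ (2 * k) * m ^ 2" using m by (simp add: power_mult_distrib power_mult mult.commute)
      have np: "\<not> p dvd m ^ 2" using m(2) p(1) prime_dvd_power by blast
      have "(\<Sum>d | d dvd n. c d) = (\<Sum>i\<le>k. c p ^ i) * (\<Sum>d | d dvd m. c d)"
        unfolding m(1) by (rule sum_divisors_prime_power_mult[OF mult c1 p(1) m(2) m0])
      moreover have "(\<Sum>d | d dvd n^2. c d) = (\<Sum>i\<le>2*k. c p ^ i) * (\<Sum>d | d dvd m^2. c d)"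
        unfolding n2 using m0 by (intro sum_divisors_prime_power_mult[OF mult c1 p(1) np]) simp
      moreover have "(\<Sum>i\<le>k. c p ^ i) \<ge> 0" "(\<Sum>i\<le>2*k. c p ^ i) \<ge> 1" using geom[OF c] by auto
      moreover have "1 * 1 \<le> a * b" if "1 \<le> a" "1 \<le> b" for a b :: real using that by (intro mult_mono) auto
      ultimately show ?thesis using IH by simp
    qed
  qed
  thus "(\<Sum>d | d dvd n. c d) \<ge> 0" "(\<Sum>d | d dvd n ^ 2. c d) \<ge> 1" by auto
qed

lemma has_sum_Suc_iff: "((\<lambda>n. f (Suc n)) has_sum S) UNIV \<longleftrightarrow> (f has_sum S) {1::nat..}"
proof (rule has_sum_reindex_bij_betw)
  show "bij_betw Suc UNIV {1..}" by (rule bij_betwI[of _ _ _ "\<lambda>n. n - 1"]) auto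
qed

text \<open>The double series of \<open>c d * x ^ (d * k)\<close>, summed by rows \<open>d\<close>
  and by the values \<open>n = d * k\<close>.\<close>

lemma Lambert_series_has_sum:
  fixes c :: "nat \<Rightarrow> real" and x :: real
  assumes c: "\<And>n. \<bar>c n\<bar> \<le> 1" and x: "0 < x" "x < 1"
  obtains T where "((\<lambda>d. c d * (x ^ d / (1 - x ^ d))) has_sum T) {1..}"
    "((\<lambda>n. (\<Sum>d | d dvd n. c d) * x ^ n) has_sum T) {1..}"
proof -
  have inner: "((\<lambda>k. x ^ (d * k)) has_sum (x ^ d / (1 - x ^ d))) {1..}" if "d \<in> {1..}" for d
  proof -
    have "x ^ d < 1" using x that by (simp add: power_Suc_less_one power_less_one_iff)
    hence "(\<lambda>k. x ^ d * (x ^ d) ^ k) sums (x ^ d * (1 / (1 - x ^ d)))"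
      using x by (intro sums_mult geometric_sums) simp
    hence "(\<lambda>k. x ^ (d * Suc k)) sums (x ^ d / (1 - x ^ d))" by (simp add: power_add power_mult)
    hence "((\<lambda>k. x ^ (d * Suc k)) has_sum (x ^ d / (1 - x ^ d))) UNIV"
      using x by (intro sums_nonneg_imp_has_sum) auto
    thus ?thesis by (subst (asm) has_sum_Suc_iff[of "\<lambda>k. x ^ (d * k)"])
  qed
  have "(\<lambda>d. x ^ d / (1 - x ^ d)) summable_on {1..}"
  proof -
    have geo: "(\<lambda>n. x * x ^ n / (1 - x)) sums (x * (1 / (1 - x)) / (1 - x))"
      using x by (intro sums_divide sums_mult geometric_sums) auto
    have "summable (\<lambda>n. x ^ Suc n / (1 - x ^ Suc n))"
    proof (rule summable_comparison_test)
      show "summable (\<lambda>n. x * x ^ n / (1 - x))" using geo by (rule sums_summable)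
      show "\<exists>N. \<forall>n\<ge>N. norm (x ^ Suc n / (1 - x ^ Suc n)) \<le> x * x ^ n / (1 - x)"
      proof (intro exI allI impI)
        fix n :: nat
        have le: "x ^ Suc n \<le> x ^ 1" using x by (intro power_decreasing) auto
        hence pos: "1 - x ^ Suc n > 0" using x by (simp del: power_Suc)
        hence "norm (x ^ Suc n / (1 - x ^ Suc n)) = x ^ Suc n / (1 - x ^ Suc n)"
          using x unfolding real_norm_def by (intro abs_of_nonneg divide_nonneg_pos zero_le_power) auto
        also have "\<dots> \<le> x ^ Suc n / (1 - x)" using x le pos by (intro divide_left_mono mult_pos_pos) (auto simp del: power_Suc)
        finally show "norm (x ^ Suc n / (1 - x ^ Suc n)) \<le> x * x ^ n / (1 - x)" by simp
      qed
    qed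
    moreover have "x ^ Suc n \<le> 1" for n using x by (intro power_le_one) auto
    ultimately have "(\<lambda>n. x ^ Suc n / (1 - x ^ Suc n)) summable_on UNIV"
      using x by (intro summable_nonneg_imp_summable_on) (auto intro!: divide_nonneg_nonneg)
    thus ?thesis unfolding summable_on_def has_sum_Suc_iff[of "\<lambda>d. x ^ d / (1 - x ^ d)"] .
  qed
  hence "(\<lambda>(d, k). x ^ (d * k)) summable_on Sigma {1..} (\<lambda>_. {1..})"
    using inner x by (intro summable_on_SigmaI[where g = "\<lambda>d. x ^ d / (1 - x ^ d)"]) auto
  hence "(\<lambda>y. norm (case y of (d, k) \<Rightarrow> c d * x ^ (d * k))) summable_on Sigma {1..} (\<lambda>_. {1..})"
  proof (rule Infinite_Sum.abs_summable_on_comparison_test')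
    fix y assume "y \<in> Sigma {1::nat..} (\<lambda>_. {1::nat..})"
    have "\<bar>c d\<bar> * x ^ k \<le> 1 * x ^ k" for d k using c x by (intro mult_right_mono) auto
    thus "norm (case y of (d, k) \<Rightarrow> c d * x ^ (d * k)) \<le> (case y of (d, k) \<Rightarrow> x ^ (d * k))"
      using x by (auto simp: abs_mult split: prod.splits)
  qed
  hence "(\<lambda>(d, k). c d * x ^ (d * k)) summable_on Sigma {1..} (\<lambda>_. {1..})"
    by (rule abs_summable_summable)
  then obtain T where T: "((\<lambda>(d, k). c d * x ^ (d * k)) has_sum T) (Sigma {1..} (\<lambda>_. {1..}))"
    unfolding summable_on_def by blast
  have "((\<lambda>d. c d * (x ^ d / (1 - x ^ d))) has_sum T) {1..}"
    by (rule has_sum_SigmaD[OF T]) (use has_sum_cmult_right[OF inner] in simp)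
  moreover have "((\<lambda>(d, k). c d * x ^ (d * k)) has_sum T) (Sigma {1..} (\<lambda>_. {1..})) \<longleftrightarrow>
      ((\<lambda>(n, d). c d * x ^ n) has_sum T) (Sigma {1..} (\<lambda>n. {d. d dvd n}))"
    by (rule has_sum_reindex_bij_witness[of _ "\<lambda>(n, d). (d, n div d)" "\<lambda>(d, k). (d * k, d)"])
       (auto simp: Suc_le_eq dvd_imp_le div_greater_zero_iff dest: dvd_pos_nat intro: Nat.gr0I)
  with T have T': "((\<lambda>(n, d). c d * x ^ n) has_sum T) (Sigma {1..} (\<lambda>n. {d. d dvd n}))" by blast
  have "((\<lambda>n. (\<Sum>d | d dvd n. c d) * x ^ n) has_sum T) {1..}"
  proof (rule has_sum_SigmaD[OF T'])
    fix n :: nat assume "n \<in> {1..}"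
    hence "finite {d. d dvd n}" by simp
    thus "((\<lambda>d. case (n, d) of (n, d) \<Rightarrow> c d * x ^ n) has_sum (\<Sum>d | d dvd n. c d) * x ^ n) {d. d dvd n}"
      using has_sum_finite[of "{d. d dvd n}" "\<lambda>d. c d * x ^ n"] by (simp add: sum_distrib_right)
  qed
  ultimately show ?thesis by (rule that)
qed

text \<open>The inequality behind \<open>Monsky_weight_antimono\<close>. The arithmetic-geometric
  mean inequality gives it even with exponent n - 1/2; the induction avoids fractional
  powers.\<close>

lemma geometric_sum_product_ge:
  fixes x :: real
  assumes x: "0 \<le> x" "x \<le> 1"
  shows "real (n * (n + 1)) * x ^ n \<le> (\<Sum>i<n. x ^ i) * (\<Sum>i<Suc n. x ^ i)"
proof -
  define s where "s n = (\<Sum>i<n. x ^ i)" for n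
  have s1: "s (Suc n) = 1 + x * s n" for n
    unfolding s_def by (subst sum.lessThan_Suc_shift) (simp add: sum_distrib_left)
  have s2: "s (Suc n) = s n + x ^ n" for n by (simp add: s_def)
  have s0: "s n \<ge> 0" for n using x by (auto simp: s_def intro!: sum_nonneg)
  \<comment> \<open>Terms symmetric about the middle sum to at least \<open>2 * x ^ m\<close>; the
    induction adds the outermost pair.\<close>
  have even: "2 * real m * x ^ m \<le> s (2 * m)" for m
  proof (induction m)
    case (Suc m)
    have sq: "2 * y \<le> 1 + y^2" for y :: real
      using zero_le_power2[of "1 - y"] by (simp add: power2_eq_square algebra_simps)
    have "2 * x ^ Suc m \<le> 1 + x ^ (2 * Suc m)"
      using sq[of "x ^ Suc m"] by (simp only: power_mult[symmetric] mult.commute[of "Suc m"])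
    also have "x ^ (2 * Suc m) \<le> x ^ (2 * m + 1)" using x by (intro power_decreasing) auto
    finally have 1: "2 * x ^ Suc m \<le> 1 + x ^ (2 * m + 1)" by simp
    have "s (2 * Suc m) = 1 + x * s (2 * m) + x ^ (2 * m + 1)"
      using s1[of "2*m"] s2[of "2*m+1"] by simp
    moreover have "x * (2 * real m * x ^ m) \<le> x * s (2 * m)" using Suc.IH x by (intro mult_left_mono) auto
    ultimately show ?case using 1 by (simp add: algebra_simps)
  qed (simp add: s_def)
  have double: "s (2 * m) = s m * (1 + x ^ m)" for m
  proof -
    have "s (m + k) = s m + x ^ m * s k" for k
      by (induction k) (simp_all add: s_def power_add algebra_simps)
    from this[of m] show ?thesis by (simp add: mult_2[symmetric] algebra_simps)
  qed
  have "real (n * (n + 1)) * x ^ n \<le> s n * s (Suc n)"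
  proof (induction n)
    case (Suc n)
    have "s (Suc n) * s (Suc (Suc n)) = x * (s n * s (Suc n)) + s (Suc n) * (1 + x ^ Suc n)"
      unfolding s1[of "Suc n"] using s2[of n] by (simp add: algebra_simps)
    also have "s (Suc n) * (1 + x ^ Suc n) = s (2 * Suc n)" by (simp only: double)
    finally have "s (Suc n) * s (Suc (Suc n)) \<ge> x * (real (n * (n + 1)) * x ^ n) + 2 * real (Suc n) * x ^ Suc n"
      using even[of "Suc n"] mult_left_mono[OF Suc.IH x(1)] by simp
    thus ?case by (simp add: algebra_simps)
  qed (simp add: s_def)
  thus ?thesis by (simp add: s_def)
qed

text \<open>The weights in Monsky's proof that \<open>L 1 \<noteq> 0\<close> for real \<open>chi\<close>: if \<open>L 1 = 0\<close>, summing \<open>chi\<close> against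
  them gives minus the Lambert series, which is unbounded as \<open>x\<close> tends to 1, while Abel summation
  bounds the sum.\<close>

lemma Monsky_weight_antimono:
  fixes x :: real
  assumes x: "0 < x" "x < 1" and n: "n > 0"
  shows "1 / (real (Suc n) * (1 - x)) - x ^ Suc n / (1 - x ^ Suc n) \<le> 1 / (real n * (1 - x)) - x ^ n / (1 - x ^ n)"
proof -
  define s where "s n = (\<Sum>i<n. x ^ i)" for n
  have pos: "s m > 0" if "m > 0" for m using x that by (auto simp: s_def intro!: sum_pos)
  have geo: "1 - x ^ m = (1 - x) * s m" for m using one_diff_power_eq'[of x m] x
    by (simp add: s_def one_diff_power_eq)
  have "s (Suc n) - x * s n = 1"
    unfolding s_def by (subst sum.lessThan_Suc_shift) (simp add: sum_distrib_left)
  hence "x ^ n / s n - x ^ Suc n / s (Suc n) = x ^ n / (s n * s (Suc n))"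
    using pos[of n] pos[of "Suc n"] n by (simp add: field_simps)
  also have "\<dots> \<le> 1 / (real n * real (Suc n))"
  proof -
    have "x ^ n * (real n * real (Suc n)) \<le> s n * s (Suc n)"
      using geometric_sum_product_ge[of x n] x by (simp add: s_def algebra_simps)
    thus ?thesis using pos[of n] pos[of "Suc n"] n by (simp add: divide_simps)
  qed
  also have "\<dots> = 1 / real n - 1 / real (Suc n)" using n by (simp add: field_simps)
  finally have "(1 / real (Suc n) - x ^ Suc n / s (Suc n)) / (1 - x) \<le> (1 / real n - x ^ n / s n) / (1 - x)"
    using x by (intro divide_right_mono) auto
  thus ?thesis unfolding geo by (simp add: diff_divide_distrib mult_ac)
qed

lemma Abel_bound:
  fixes a b :: "nat \<Rightarrow> real"
  assumes A: "\<And>n. \<bar>\<Sum>j<n. a j\<bar> \<le> B" and b: "\<And>n. b (Suc n) \<le> b n" "\<And>n. 0 \<le> b n"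
  shows "\<bar>\<Sum>n<N. a n * b n\<bar> \<le> B * b 0"
proof -
  have "(\<Sum>n<N. a n * b n) = (\<Sum>n<N. (\<Sum>j<Suc n. a j) * (b n - b (Suc n))) + (\<Sum>j<N. a j) * b N"
    by (induction N) (simp_all add: algebra_simps)
  also have "\<bar>\<dots>\<bar> \<le> (\<Sum>n<N. B * (b n - b (Suc n))) + B * b N"
  proof (intro order_trans[OF abs_triangle_ineq] add_mono order_trans[OF sum_abs] sum_mono)
    show "\<bar>(\<Sum>j<Suc n. a j) * (b n - b (Suc n))\<bar> \<le> B * (b n - b (Suc n))" for n
      using A[of "Suc n"] b(1)[of n] unfolding abs_mult by (intro mult_mono) auto
    show "\<bar>(\<Sum>j<N. a j) * b N\<bar> \<le> B * b N"
      using A[of N] b(2)[of N] unfolding abs_mult by (intro mult_mono) auto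
  qed
  also have "\<dots> = B * b 0"
    unfolding sum_distrib_left[symmetric] sum_lessThan_telescope' by (simp add: algebra_simps)
  finally show ?thesis .
qed

section \<open>Real and complex characters at the point 1\<close>

context nonprincipal_char
begin

lemma L_1_nonzero_real:
  assumes real: "\<And>n. chi n ^ 2 = (if coprime n (int q) then 1 else 0)"
  shows "L 1 \<noteq> 0"
proof
  assume L0: "L 1 = 0"
  define c where "c n = Re (chi (int n))" for n
  have c: "c n \<in> {-1, 0, 1} \<and> chi (int n) = of_real (c n)" for n
  proof (cases "coprime (int n) (int q)")
    case True
    hence "chi (int n) = 1 \<or> chi (int n) = -1" using real[of "int n"] by (simp add: power2_eq_1_iff)
    thus ?thesis by (auto simp: c_def)
  next
    case False
    hence "chi (int n) = 0" by (simp add: chi_zero_iff)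
    thus ?thesis by (simp add: c_def)
  qed
  have mult: "c (m * n) = c m * c n" for m n
  proof -
    have "complex_of_real (c (m * n)) = of_real (c m * c n)"
      using c chi_mult[of "int m" "int n"] by (metis of_nat_mult of_real_mult)
    thus ?thesis by (simp only: of_real_eq_iff)
  qed
  have c1: "c 1 = 1" "c 0 = 0" using chi_1 chi_0 by (simp_all add: c_def)
  have cle: "\<bar>c n\<bar> \<le> 1" for n using c[of n] by auto
  have csum: "\<bar>\<Sum>j<n. c (Suc j)\<bar> \<le> q" for n
  proof -
    have "(\<Sum>j<Suc n. c j) = (\<Sum>j<n. c (Suc j))" by (subst sum.lessThan_Suc_shift) (simp add: c1)
    moreover have "complex_of_real (\<Sum>j<Suc n. c j) = (\<Sum>j<Suc n. chi (int j))" using c by simp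
    ultimately show ?thesis using norm_psum_le[of "Suc n"] by (metis norm_of_real)
  qed
  have "(\<lambda>n. chi (int n) * of_nat n powr (-1)) sums 0" using L_sums[of 1] L0 by simp
  hence "(\<lambda>n. Re (chi (int n) * of_nat n powr (-1))) sums Re 0" by (rule sums_Re)
  moreover have "Re (chi (int n) * of_nat n powr (-1)) = c n / n" for n
    using c[of n] by (cases "n = 0") (simp_all add: powr_minus_divide c_def)
  ultimately have "(\<lambda>n. c n / n) sums 0" by simp
  hence csums: "(\<lambda>n. c (Suc n) / Suc n) sums 0"
    using sums_Suc_iff[of "\<lambda>n. c n / n" 0] by (simp add: c1)
  \<comment> \<open>As \<open>x\<close> tends to 1 the sum over squares tends to \<open>M\<close>,
    one more than the bound \<open>q\<close>.\<close>
  define M where "M = Suc q"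
  have bound: "(\<Sum>m\<in>{1..M}. x ^ (m^2)) \<le> q" if x: "0 < x" "x < 1" for x :: real
  proof -
    obtain T where T: "((\<lambda>d. c d * (x ^ d / (1 - x ^ d))) has_sum T) {1..}"
      "((\<lambda>n. (\<Sum>d | d dvd n. c d) * x ^ n) has_sum T) {1..}"
      using Lambert_series_has_sum[of c x] cle x by blast
    have nonneg: "(\<Sum>d | d dvd n. c d) * x ^ n \<ge> 0" if "n \<in> {1..}" for n
      using sum_divisors_real_char(1)[of c n, OF mult c1(1)] c that x by auto
    have inj: "inj_on (\<lambda>m::nat. m ^ 2) {1..M}" by (auto simp: inj_on_def)
    \<comment> \<open>The divisor sums are nonnegative and at least 1 at squares, so finitely many
      squares bound the Lambert series from below.\<close>
    have "(\<Sum>m\<in>{1..M}. x ^ (m^2)) \<le> (\<Sum>m\<in>{1..M}. (\<Sum>d | d dvd m ^ 2. c d) * x ^ (m ^ 2))"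
    proof (rule sum_mono)
      fix m assume "m \<in> {1..M}"
      hence "(\<Sum>d | d dvd m ^ 2. c d) \<ge> 1" using sum_divisors_real_char(2)[of c m, OF mult c1(1)] c by auto
      thus "x ^ (m^2) \<le> (\<Sum>d | d dvd m ^ 2. c d) * x ^ (m ^ 2)" using x by (simp add: mult_le_cancel_right1)
    qed
    also have "\<dots> = (\<Sum>n\<in>(\<lambda>m. m ^ 2) ` {1..M}. (\<Sum>d | d dvd n. c d) * x ^ n)"
      by (subst sum.reindex[OF inj]) simp
    also have "\<dots> \<le> T"
      using nonneg by (intro finite_sum_le_has_sum[OF T(2)]) (auto simp: Suc_le_eq)
    also have "T \<le> q"
    proof -
      define b where "b n = 1 / (real (Suc n) * (1 - x)) - x ^ Suc n / (1 - x ^ Suc n)" for n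
      have "((\<lambda>d. c (Suc d) * (x ^ Suc d / (1 - x ^ Suc d))) has_sum T) UNIV"
        using T(1) by (subst has_sum_Suc_iff[of "\<lambda>d. c d * (x ^ d / (1 - x ^ d))"])
      hence "(\<lambda>d. c (Suc d) * (x ^ Suc d / (1 - x ^ Suc d))) sums T" by (rule has_sum_imp_sums)
      from sums_diff[OF sums_divide[OF csums, of "1 - x"] this]
      have "(\<lambda>n. c (Suc n) * b n) sums (- T)" by (simp add: b_def algebra_simps)
      hence lim: "(\<lambda>N. \<bar>\<Sum>n<N. c (Suc n) * b n\<bar>) \<longlonglongrightarrow> \<bar>- T\<bar>" unfolding sums_def by (rule tendsto_rabs)
      have dec: "b (Suc n) \<le> b n" for n
        unfolding b_def by (rule Monsky_weight_antimono) (use x in auto)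
      have "b \<longlonglongrightarrow> 0" unfolding b_def using x by real_asymp
      moreover have "decseq b" by (rule decseq_SucI) (rule dec)
      ultimately have "0 \<le> b n" for n using decseq_ge by blast
      hence "\<bar>\<Sum>n<N. c (Suc n) * b n\<bar> \<le> q * b 0" for N by (intro Abel_bound csum dec)
      \<comment> \<open>This makes the Abel bound \<open>q * b 0\<close> uniform in
        \<open>x\<close>.\<close>
      moreover have "b 0 = 1" using x by (simp add: b_def diff_divide_distrib[symmetric])
      ultimately have "\<bar>- T\<bar> \<le> q" using LIMSEQ_le_const2[OF lim] by auto
      thus ?thesis by simp
    qed
    finally show ?thesis .
  qed
  have "((\<lambda>x::real. \<Sum>m\<in>{1..M}. x ^ (m^2)) \<longlongrightarrow> (\<Sum>m\<in>{1..M}. 1 ^ (m^2))) (at_left 1)"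
    by (intro tendsto_intros)
  moreover have "eventually (\<lambda>x::real. x \<in> {0<..<1}) (at_left 1)"
    by (rule eventually_at_left_real) simp
  hence "eventually (\<lambda>x::real. (\<Sum>m\<in>{1..M}. x ^ (m^2)) \<le> q) (at_left 1)"
    by eventually_elim (use bound in auto)
  ultimately have "(\<Sum>m\<in>{1..M}. 1 ^ (m^2)) \<le> real q"
    by (rule tendsto_upperbound) simp
  thus False by (simp add: M_def)
qed

text \<open>If \<open>L 1 = 0\<close>, then \<open>L\<close> is O(x) at 1 + x, and its eighth power
  outweighs the sixth power of zeta, which is O(1/x); the product in \<open>L_three_four_one\<close>
  would tend to 0. The factor of the squared character stays bounded because that character is
  nonprincipal.\<close>

lemma L_1_nonzero_complex:
  assumes "nonprincipal_char q (\<lambda>n. chi n ^ 2)"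
  shows "L 1 \<noteq> 0"
proof
  interpret S: nonprincipal_char q "\<lambda>n. chi n ^ 2" by fact
  assume L0: "L 1 = 0"
  have op: "open {s. Re s > 0}" by (rule open_halfspace_Re_gt)
  have lim0: "filterlim (complex_of_real) (at 0) (at_right 0)"
    by (intro filterlim_atI) (auto intro!: tendsto_eq_intros simp: eventually_at_filter)
  have "(L has_field_derivative deriv L 1) (at 1)"
    using L_holomorphic op by (intro holomorphic_derivI) auto
  hence "((\<lambda>h. L (1 + h) / h) \<longlongrightarrow> deriv L 1) (at 0)"
    by (simp add: DERIV_def L0)
  from filterlim_compose[OF this lim0]
  have 1: "((\<lambda>x::real. L (of_real (1 + x)) / of_real x) \<longlongrightarrow> deriv L 1) (at_right 0)" by simp
  have cont: "((\<lambda>x::real. f (of_real (1 + x))) \<longlongrightarrow> f 1) (at_right 0)" if "f holomorphic_on {s. Re s > 0}" for f :: "complex \<Rightarrow> complex"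
  proof -
    have "isCont f 1" using holomorphic_on_imp_continuous_on[OF that] op by (auto simp: continuous_on_eq_continuous_at)
    moreover have "((\<lambda>x::real. complex_of_real (1 + x)) \<longlongrightarrow> of_real (1 + 0)) (at_right 0)" by (intro tendsto_intros)
    ultimately show ?thesis using isCont_tendsto_compose by fastforce
  qed
  have "((\<lambda>x::real. (1 + x)^6 * norm (L (of_real (1 + x)) / of_real x)^6 * norm (L (of_real (1 + x)))^2 * norm (S.L (of_real (1 + x)))^2)
      \<longlongrightarrow> (1 + 0)^6 * norm (deriv L 1)^6 * norm (L 1)^2 * norm (S.L 1)^2) (at_right 0)"
    by (intro tendsto_intros 1 cont L_holomorphic S.L_holomorphic)
  hence lim: "((\<lambda>x::real. (1 + x)^6 * norm (L (of_real (1 + x)) / of_real x)^6 * norm (L (of_real (1 + x)))^2 * norm (S.L (of_real (1 + x)))^2)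
      \<longlongrightarrow> 0) (at_right 0)" by (simp add: L0)
  have "eventually (\<lambda>x::real. exp (-16) \<le> (1 + x)^6 * norm (L (of_real (1 + x)) / of_real x)^6 * norm (L (of_real (1 + x)))^2 * norm (S.L (of_real (1 + x)))^2) (at_right 0)"
    using eventually_at_right_less[of "0::real"]
  proof eventually_elim
    case (elim x)
    define A where "A = norm (L (of_real (1 + x)))"
    define B where "B = norm (S.L (of_real (1 + x)))"
    have z0: "0 \<le> zeta_sum (1 + x)" using elim by (intro zeta_sum_nonneg) simp
    have "exp (-16) \<le> zeta_sum (1 + x) ^ 6 * A ^ 8 * B ^ 2"
      unfolding A_def B_def using elim by (intro L_three_four_one) simp
    also have "zeta_sum (1 + x) ^ 6 * A ^ 8 * B ^ 2 \<le> ((1 + x) / x) ^ 6 * A ^ 8 * B ^ 2"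
      using zeta_sum_le[of "1 + x"] elim z0 by (intro mult_right_mono power_mono) (auto simp: A_def)
    also have "\<dots> = (1 + x)^6 * (A / x)^6 * A^2 * B^2"
      by (simp add: power_divide power_add[symmetric])
    finally show ?case using elim by (simp add: A_def B_def norm_divide)
  qed
  hence "exp (-16) \<le> (0::real)" by (rule tendsto_lowerbound[OF lim]) simp
  thus False by simp
qed

lemma L_1_nonzero: "L 1 \<noteq> 0"
proof (cases "\<exists>a. coprime a (int q) \<and> chi a ^ 2 \<noteq> 1")
  case True
  interpret S: dirichlet_char q "\<lambda>n. chi n ^ 2" by (rule dirichlet_char_square)
  have "nonprincipal_char q (\<lambda>n. chi n ^ 2)" by unfold_locales (rule True)
  thus ?thesis by (rule L_1_nonzero_complex)
next
  case False
  thus ?thesis by (intro L_1_nonzero_real) (auto simp: chi_zero_iff)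
qed

end

subsection \<open>The functional equation\<close>

lemma absolutely_integrable_Ioi_nn_integral:
  fixes f :: "real \<Rightarrow> real"
  assumes [measurable]: "f \<in> borel_measurable borel" and nonneg: "\<And>x. x > 0 \<Longrightarrow> 0 \<le> f x"
    and I: "(\<integral>\<^sup>+x. ennreal (indicator {0<..} x * f x) \<partial>lborel) = ennreal I" "0 \<le> I"
  shows "f absolutely_integrable_on {0<..}" "integral {0<..} f = I"
proof -
  have "has_bochner_integral lborel (\<lambda>x. indicator {0<..} x * f x) I"
    using I nonneg by (intro has_bochner_integral_nn_integral AE_I2) (auto simp: indicator_def)
  hence b: "set_integrable lborel {0<..} f" "(LINT x:{0<..}|lborel. f x) = I"
    by (auto simp: set_integrable_def set_lebesgue_integral_def has_bochner_integral_iff)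
  note h = set_borel_integral_eq_integral[OF b(1)]
  show "f absolutely_integrable_on {0<..}"
    using nonneg by (intro nonnegative_absolutely_integrable_1 h(1)) auto
  show "integral {0<..} f = I" using h(2) b(2) by simp
qed

lemma nn_integral_exp_powr:
  fixes a s :: real
  assumes a: "a > 0" and s: "s > 0"
  shows "(\<integral>\<^sup>+x. ennreal (indicator {0<..} x * (x powr (s - 1) * exp (- a * x))) \<partial>lborel) = ennreal (Gamma s * a powr (-s))"
proof -
  let ?g = "\<lambda>x. ennreal (indicator {0<..} x * (x powr (s - 1) * exp (- a * x)))"
  have "ennreal (Gamma s) = (\<integral>\<^sup>+t. ennreal (indicator {0..} t * t powr (s - 1) / exp t) \<partial>lborel)"
    by (rule Gamma_conv_nn_integral_real[OF s])
  also have "\<dots> = ennreal \<bar>a\<bar> * (\<integral>\<^sup>+t. ennreal (indicator {0..} (0 + a * t) * (0 + a * t) powr (s - 1) / exp (0 + a * t)) \<partial>lborel)"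
    using a by (intro nn_integral_real_affine) auto
  also have "(\<lambda>t. ennreal (indicator {0..} (0 + a * t) * (0 + a * t) powr (s - 1) / exp (0 + a * t))) = (\<lambda>t. ennreal (a powr (s - 1)) * ?g t)"
  proof
    fix t :: real
    consider "t > 0" | "t = 0" | "t < 0" by linarith
    hence "indicator {0..} (0 + a * t) * (0 + a * t) powr (s - 1) / exp (0 + a * t) = a powr (s - 1) * (indicator {0<..} t * (t powr (s - 1) * exp (- a * t)))"
      using a by cases (auto simp: indicator_def powr_mult exp_minus field_simps zero_le_mult_iff)
    thus "ennreal (indicator {0..} (0 + a * t) * (0 + a * t) powr (s - 1) / exp (0 + a * t)) = ennreal (a powr (s - 1)) * ?g t"
      by (simp add: ennreal_mult'[symmetric] del: ennreal_mult_le_mult_iff)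
  qed
  also have "(\<integral>\<^sup>+t. ennreal (a powr (s - 1)) * ?g t \<partial>lborel) = ennreal (a powr (s - 1)) * (\<integral>\<^sup>+t. ?g t \<partial>lborel)"
    by (intro nn_integral_cmult) auto
  also have "ennreal \<bar>a\<bar> * (ennreal (a powr (s - 1)) * (\<integral>\<^sup>+t. ?g t \<partial>lborel)) = ennreal (a powr s) * (\<integral>\<^sup>+t. ?g t \<partial>lborel)"
  proof -
    have "a * a powr (s - 1) = a powr s" using a by (simp add: powr_diff)
    thus ?thesis using a by (simp add: mult.assoc[symmetric] ennreal_mult'[symmetric])
  qed
  finally have eq: "ennreal (Gamma s) = ennreal (a powr s) * (\<integral>\<^sup>+t. ?g t \<partial>lborel)" .
  have "ennreal (Gamma s * a powr (-s)) = ennreal (a powr (-s)) * ennreal (Gamma s)"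
    by (simp add: ennreal_mult'' mult.commute)
  also have "\<dots> = ennreal (a powr (-s)) * ennreal (a powr s) * (\<integral>\<^sup>+t. ?g t \<partial>lborel)"
    unfolding eq by (simp only: mult.assoc)
  also have "ennreal (a powr (-s)) * ennreal (a powr s) = 1"
    using a by (simp add: ennreal_mult'[symmetric] powr_add[symmetric])
  finally show ?thesis by simp
qed

lemma exp_powr_integral:
  fixes a s :: real
  assumes a: "a > 0" and s: "s > 0"
  shows "(\<lambda>x. x powr (s - 1) * exp (- a * x)) absolutely_integrable_on {0<..}"
    "integral {0<..} (\<lambda>x. x powr (s - 1) * exp (- a * x)) = Gamma s * a powr (-s)"
proof -
  have "0 \<le> Gamma s * a powr (-s)"
    using s by (intro mult_nonneg_nonneg less_imp_le[OF Gamma_real_pos]) auto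
  note * = absolutely_integrable_Ioi_nn_integral[OF _ _ nn_integral_exp_powr[OF assms] this]
  show "(\<lambda>x. x powr (s - 1) * exp (- a * x)) absolutely_integrable_on {0<..}"
    by (rule *(1)) auto
  show "integral {0<..} (\<lambda>x. x powr (s - 1) * exp (- a * x)) = Gamma s * a powr (-s)"
    by (rule *(2)) auto
qed

text \<open>Writing \<open>1 / (1 + x)\<close> as the integral of \<open>exp (- (1 + x) * v)\<close>
  over \<open>v\<close> and exchanging the integrals gives a product of two Gamma integrals. With
  nonnegative integrals, Tonelli yields integrability along with the value.\<close>

lemma powr_over_one_plus_integral:
  fixes a :: real
  assumes a: "0 < a" "a < 1"
  shows "(\<lambda>x. x powr (a - 1) / (1 + x)) absolutely_integrable_on {0<..}"
    "integral {0<..} (\<lambda>x. x powr (a - 1) / (1 + x)) = Gamma a * Gamma (1 - a)"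
proof -
  let ?i = "indicator {0<..} :: real \<Rightarrow> real"
  have "(\<integral>\<^sup>+x. ennreal (?i x * (x powr (a - 1) / (1 + x))) \<partial>lborel) =
        (\<integral>\<^sup>+x. (\<integral>\<^sup>+v. ennreal (?i x * x powr (a - 1) * (?i v * exp (- (1 + x) * v))) \<partial>lborel) \<partial>lborel)"
  proof (intro nn_integral_cong)
    fix x :: real
    show "ennreal (?i x * (x powr (a - 1) / (1 + x))) = (\<integral>\<^sup>+v. ennreal (?i x * x powr (a - 1) * (?i v * exp (- (1 + x) * v))) \<partial>lborel)"
    proof (cases "x > 0")
      case True
      have "(\<integral>\<^sup>+v. ennreal (?i x * x powr (a - 1) * (?i v * exp (- (1 + x) * v))) \<partial>lborel)
        = (\<integral>\<^sup>+v. ennreal (x powr (a - 1)) * ennreal (?i v * (v powr (1 - 1) * exp (- (1 + x) * v))) \<partial>lborel)"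
        using True by (intro nn_integral_cong) (auto simp: indicator_def ennreal_mult'[symmetric])
      also have "\<dots> = ennreal (x powr (a - 1)) * (\<integral>\<^sup>+v. ennreal (?i v * (v powr (1 - 1) * exp (- (1 + x) * v))) \<partial>lborel)"
        by (intro nn_integral_cmult) auto
      also have "\<dots> = ennreal (x powr (a - 1)) * ennreal (Gamma 1 * (1 + x) powr (-1))"
        using True by (subst nn_integral_exp_powr) auto
      also have "\<dots> = ennreal (?i x * (x powr (a - 1) / (1 + x)))"
        using True by (simp add: ennreal_mult'[symmetric] powr_minus_divide)
      finally show ?thesis ..
    qed simp
  qed
  also have "\<dots> = (\<integral>\<^sup>+v. (\<integral>\<^sup>+x. ennreal (?i x * x powr (a - 1) * (?i v * exp (- (1 + x) * v))) \<partial>lborel) \<partial>lborel)"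
    by (rule lborel_pair.Fubini'[symmetric]) simp
  also have "\<dots> = (\<integral>\<^sup>+v. ennreal (Gamma a) * ennreal (?i v * (v powr ((1 - a) - 1) * exp (- 1 * v))) \<partial>lborel)"
  proof (intro nn_integral_cong)
    fix v :: real
    show "(\<integral>\<^sup>+x. ennreal (?i x * x powr (a - 1) * (?i v * exp (- (1 + x) * v))) \<partial>lborel) = ennreal (Gamma a) * ennreal (?i v * (v powr ((1 - a) - 1) * exp (- 1 * v)))"
    proof (cases "v > 0")
      case True
      have "(\<integral>\<^sup>+x. ennreal (?i x * x powr (a - 1) * (?i v * exp (- (1 + x) * v))) \<partial>lborel)
        = (\<integral>\<^sup>+x. ennreal (exp (-v)) * ennreal (?i x * (x powr (a - 1) * exp (- v * x))) \<partial>lborel)"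
        using True by (intro nn_integral_cong) (auto simp: indicator_def ennreal_mult'[symmetric] exp_add[symmetric] algebra_simps)
      also have "\<dots> = ennreal (exp (-v)) * (\<integral>\<^sup>+x. ennreal (?i x * (x powr (a - 1) * exp (- v * x))) \<partial>lborel)"
        by (intro nn_integral_cmult) auto
      also have "\<dots> = ennreal (exp (-v)) * ennreal (Gamma a * v powr (-a))"
        using True a by (subst nn_integral_exp_powr) auto
      also have "\<dots> = ennreal (Gamma a) * ennreal (?i v * (v powr ((1 - a) - 1) * exp (- 1 * v)))"
        using True a by (simp add: ennreal_mult'[symmetric] Gamma_real_pos less_imp_le mult_ac)
      finally show ?thesis .
    qed simp
  qed
  also have "\<dots> = ennreal (Gamma a) * (\<integral>\<^sup>+v. ennreal (?i v * (v powr ((1 - a) - 1) * exp (- 1 * v))) \<partial>lborel)"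
    by (intro nn_integral_cmult) auto
  also have "\<dots> = ennreal (Gamma a) * ennreal (Gamma (1 - a) * 1 powr (- (1 - a)))"
    using a by (subst nn_integral_exp_powr) auto
  also have "\<dots> = ennreal (Gamma a * Gamma (1 - a))"
    using a by (simp add: ennreal_mult'[symmetric] Gamma_real_pos less_imp_le)
  finally have nn: "(\<integral>\<^sup>+x. ennreal (?i x * (x powr (a - 1) / (1 + x))) \<partial>lborel) = ennreal (Gamma a * Gamma (1 - a))" .
  have "0 \<le> Gamma a * Gamma (1 - a)" using a by (simp add: Gamma_real_pos less_imp_le)
  with nn show "(\<lambda>x. x powr (a - 1) / (1 + x)) absolutely_integrable_on {0<..}"
    "integral {0<..} (\<lambda>x. x powr (a - 1) / (1 + x)) = Gamma a * Gamma (1 - a)"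
    by (intro absolutely_integrable_Ioi_nn_integral; simp)+
qed

text \<open>The substitution y = (x / b)^2 reduces this to the preceding integral at exponent
  \<open>u / 2\<close>.\<close>

lemma powr_over_square_plus_integral:
  fixes u b :: real
  assumes u: "0 < u" "u < 2" and b: "b > 0"
  shows "(\<lambda>x. 2 * x powr (u - 1) / (x^2 + b^2)) absolutely_integrable_on {0<..}"
    "integral {0<..} (\<lambda>x. 2 * x powr (u - 1) / (x^2 + b^2)) = b powr (u - 2) * (Gamma (u/2) * Gamma (1 - u/2))"
proof -
  let ?f = "\<lambda>y. y powr (u/2 - 1) / (1 + y)"
  let ?h = "\<lambda>x. \<bar>2 * x / b^2\<bar> * ?f ((x / b)^2)"
  have img: "(\<lambda>x. (x / b)^2) ` {0<..} = {0<..}"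
  proof (intro equalityI subsetI)
    fix y :: real assume "y \<in> {0<..}"
    hence "y = ((b * sqrt y) / b)^2" "b * sqrt y \<in> {0<..}" using b by auto
    thus "y \<in> (\<lambda>x. (x / b)^2) ` {0<..}" by blast
  qed (use b in auto)
  have "?h absolutely_integrable_on {0<..} \<and> integral {0<..} ?h = Gamma (u/2) * Gamma (1 - u/2)
     \<longleftrightarrow> ?f absolutely_integrable_on (\<lambda>x. (x / b)^2) ` {0<..} \<and> integral ((\<lambda>x. (x / b)^2) ` {0<..}) ?f = Gamma (u/2) * Gamma (1 - u/2)"
  proof (rule has_absolute_integral_change_of_variables_1')
    show "((\<lambda>x. (x / b)^2) has_field_derivative (2 * x / b^2)) (at x within {0<..})" for x
      using b by (auto intro!: derivative_eq_intros simp: power2_eq_square)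
    show "inj_on (\<lambda>x. (x / b)^2) {0<..}"
      using b by (auto simp: inj_on_def power2_eq_iff_nonneg)
  qed simp
  hence h: "?h absolutely_integrable_on {0<..}" "integral {0<..} ?h = Gamma (u/2) * Gamma (1 - u/2)"
    unfolding img using powr_over_one_plus_integral[of "u/2"] u by auto
  have eq: "2 * x powr (u - 1) / (x^2 + b^2) = b powr (u - 2) * ?h x" if "x \<in> {0<..}" for x
  proof -
    have x: "x > 0" using that by simp
    have "((x / b)^2) powr (u/2 - 1) = (x / b) powr (u - 2)"
      using x b powr_powr[of "x / b" 2 "u/2 - 1"] by (simp add: algebra_simps)
    also have "\<dots> = x powr (u - 2) / b powr (u - 2)" using x b by (simp add: powr_divide)
    finally have e: "((x / b)^2) powr (u/2 - 1) = x powr (u - 2) / b powr (u - 2)" .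
    have d: "1 + (x / b)^2 = (x^2 + b^2) / b^2" using b by (simp add: field_simps)
    have "b powr (u - 2) * ?h x = (2 * x / b^2) * x powr (u - 2) / ((x^2 + b^2) / b^2)"
    proof -
      have gen: "P * (A * (Q / P / D)) = A * Q / D" if "P \<noteq> 0" for A P Q D :: real
        using that by simp
      have "\<bar>2 * x / b^2\<bar> = 2 * x / b^2" using x by simp
      thus ?thesis unfolding e d using b by (subst gen) auto
    qed
    also have "(2 * x / b^2) * x powr (u - 2) / ((x^2 + b^2) / b^2) = 2 * (x * x powr (u - 2)) / (x^2 + b^2)"
      using b by simp
    also have "x * x powr (u - 2) = x powr (u - 1)" using x by (simp add: powr_diff power2_eq_square field_simps)
    finally show ?thesis ..
  qed
  have "(\<lambda>x. b powr (u - 2) * ?h x) absolutely_integrable_on {0<..}"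
    by (intro set_integrable_mult_right h)
  moreover have "(\<lambda>x. 2 * x powr (u - 1) / (x^2 + b^2)) absolutely_integrable_on {0<..} \<longleftrightarrow> (\<lambda>x. b powr (u - 2) * ?h x) absolutely_integrable_on {0<..}"
    by (intro set_integrable_cong refl eq)
  ultimately show "(\<lambda>x. 2 * x powr (u - 1) / (x^2 + b^2)) absolutely_integrable_on {0<..}" by blast
  have "integral {0<..} (\<lambda>x. 2 * x powr (u - 1) / (x^2 + b^2)) = integral {0<..} (\<lambda>x. b powr (u - 2) * ?h x)"
    by (intro integral_cong eq)
  also have "\<dots> = b powr (u - 2) * integral {0<..} ?h" by (rule integral_mult_right)
  finally show "integral {0<..} (\<lambda>x. 2 * x powr (u - 1) / (x^2 + b^2)) = b powr (u - 2) * (Gamma (u/2) * Gamma (1 - u/2))"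
    unfolding h(2) .
qed

text \<open>In the applications \<open>a\<close> consists of bounded partial sums of a character and
  \<open>h n\<close> of differences of consecutive kernels.\<close>

lemma sums_integral_Ioi:
  fixes a :: "nat \<Rightarrow> complex" and h :: "nat \<Rightarrow> real \<Rightarrow> real"
  assumes h: "\<And>n. h n absolutely_integrable_on {0<..}"
    and a: "\<And>n. norm (a n) \<le> B"
    and M: "\<And>n. integral {0<..} (\<lambda>x. \<bar>h n x\<bar>) \<le> M n" "summable M"
    and pt: "\<And>x. x > 0 \<Longrightarrow> summable (\<lambda>n. \<bar>h n x\<bar>)"
    and F: "\<And>x. x > 0 \<Longrightarrow> (\<lambda>n. a n * of_real (h n x)) sums F x"
  shows "(\<lambda>n. a n * of_real (integral {0<..} (h n))) sums integral {0<..} F"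
proof -
  let ?M = "lebesgue_on {0::real<..}"
  have B: "B \<ge> 0" using a[of 0] norm_ge_zero order_trans by blast
  have S: "{0::real<..} \<in> sets lebesgue" by simp
  have int: "integrable ?M (h n)" for n
    using h[of n] unfolding set_integrable_def by (subst integrable_restrict_space) auto
  have eq: "integral\<^sup>L ?M g = integral {0<..} g" if "integrable ?M g" for g :: "real \<Rightarrow> 'b::euclidean_space"
    by (rule lebesgue_integral_eq_integral[OF that S])
  have intc: "integrable ?M (\<lambda>x. a n * of_real (h n x))" for n
    using int[of n] by (intro integrable_mult_right integrable_of_real)
  have sp: "AE x in ?M. summable (\<lambda>n. norm (a n * of_real (h n x)))"
  proof (rule AE_I2)
    fix x assume "x \<in> space ?M"
    hence x: "x > 0" by simp
    show "summable (\<lambda>n. norm (a n * of_real (h n x)))"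
    proof (rule summable_comparison_test)
      show "summable (\<lambda>n. B * \<bar>h n x\<bar>)" by (intro summable_mult pt x)
      show "\<exists>N. \<forall>n\<ge>N. norm (norm (a n * of_real (h n x))) \<le> B * \<bar>h n x\<bar>"
        using a by (auto simp: norm_mult intro!: mult_right_mono)
    qed
  qed
  have sn: "summable (\<lambda>n. \<integral>x. norm (a n * of_real (h n x)) \<partial>?M)"
  proof (rule summable_comparison_test)
    show "summable (\<lambda>n. B * M n)" by (intro summable_mult M)
    show "\<exists>N. \<forall>n\<ge>N. norm (\<integral>x. norm (a n * of_real (h n x)) \<partial>?M) \<le> B * M n"
    proof (intro exI allI impI)
      fix n :: nat
      have "(\<integral>x. norm (a n * of_real (h n x)) \<partial>?M) = norm (a n) * (\<integral>x. \<bar>h n x\<bar> \<partial>?M)"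
        by (simp add: norm_mult)
      also have "(\<integral>x. \<bar>h n x\<bar> \<partial>?M) = integral {0<..} (\<lambda>x. \<bar>h n x\<bar>)"
        using int[of n] by (intro eq integrable_abs)
      also have "norm (a n) * \<dots> \<le> B * M n"
        using a B M(1)[of n] h[of n] by (intro mult_mono integral_nonneg) (auto simp: absolutely_integrable_on_def)
      finally show "norm (\<integral>x. norm (a n * of_real (h n x)) \<partial>?M) \<le> B * M n"
        by simp
    qed
  qed
  have "(\<lambda>n. \<integral>x. a n * of_real (h n x) \<partial>?M) sums (\<integral>x. (\<Sum>n. a n * of_real (h n x)) \<partial>?M)"
    by (rule sums_integral[OF intc sp sn])
  moreover have "(\<integral>x. a n * of_real (h n x) \<partial>?M) = a n * of_real (integral {0<..} (h n))" for n
    unfolding eq[OF int, symmetric] by simp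
  moreover have "(\<integral>x. (\<Sum>n. a n * of_real (h n x)) \<partial>?M) = integral {0<..} (\<lambda>x. \<Sum>n. a n * of_real (h n x))"
    by (intro eq integrable_suminf[OF intc sp sn])
  moreover have "integral {0<..} (\<lambda>x. \<Sum>n. a n * of_real (h n x)) = integral {0<..} F"
    using F by (intro integral_cong) (auto simp: sums_iff)
  ultimately show ?thesis by (simp only:)
qed

section \<open>Symmetric sums over residue classes\<close>

lemma sum_int_symmetric:
  fixes g :: "int \<Rightarrow> 'a::comm_monoid_add"
  shows "(\<Sum>m\<in>{-int N<..int N}. g m) = (\<Sum>m<N. g (- int m) + g (int (Suc m)))"
proof (induction N)
  case (Suc N)
  have set: "{-int (Suc N)<..int (Suc N)} = insert (int N + 1) (insert (- int N) {-int N<..int N})"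
    by auto
  have "int N + 1 \<notin> insert (- int N) {-int N<..int N}" "- int N \<notin> {-int N<..int N}" by auto
  thus ?case unfolding set using Suc.IH by (simp add: ac_simps)
qed simp

text \<open>Each \<open>m\<close> in the range is \<open>q * k - j\<close> for a unique
  \<open>j\<close> in \<open>{0..<q}\<close>. With the minus sign the half-open ranges match
  exactly, from \<open>q * (1 - M) - (q - 1)\<close> up to \<open>q * M\<close>.\<close>

lemma sum_residue_blocks:
  fixes g :: "int \<Rightarrow> 'a::comm_monoid_add" and q M :: int
  assumes q: "q > 0"
  shows "(\<Sum>j\<in>{0..<q}. \<Sum>k\<in>{-M<..M}. g (q * k - j)) = (\<Sum>m\<in>{-(q * M)<..q * M}. g m)"
proof -
  have "(\<Sum>(j, k)\<in>{0..<q} \<times> {-M<..M}. g (q * k - j)) = (\<Sum>m\<in>{-(q * M)<..q * M}. g m)"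
  proof (rule sum.reindex_bij_witness[of _ "\<lambda>m. ((-m) mod q, (m + (-m) mod q) div q)" "\<lambda>(j, k). q * k - j"])
    fix jk assume "jk \<in> {0..<q} \<times> {-M<..M}"
    then obtain j k where jk: "jk = (j, k)" "0 \<le> j" "j < q" "-M < k" "k \<le> M" by auto
    have m: "(- (q * k - j)) mod q = j"
    proof -
      have "- (q * k - j) = j + q * (-k)" by simp
      thus ?thesis using jk by (simp only: mod_mult_self2) simp
    qed
    show "(case jk of (j, k) \<Rightarrow> q * k - j) \<in> {-(q * M)<..q * M}"
    proof -
      have "q * (-M + 1) \<le> q * k" and h2: "q * k \<le> q * M" using jk q by (intro mult_left_mono; simp)+
      hence h1: "q - q * M \<le> q * k" by (simp only: distrib_left mult_minus_right mult_1_right)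
      show ?thesis unfolding jk(1) prod.case greaterThanAtMost_iff using jk(2,3) h1 h2 by linarith
    qed
    show "(\<lambda>m. ((-m) mod q, (m + (-m) mod q) div q)) (case jk of (j, k) \<Rightarrow> q * k - j) = jk"
      unfolding jk(1) prod.case m using q by simp
  next
    fix m assume m: "m \<in> {-(q * M)<..q * M}"
    define r where "r = (-m) mod q"
    have r: "0 \<le> r" "r < q" using q by (auto simp: r_def)
    have "(m + r) mod q = 0" by (simp add: r_def mod_add_right_eq)
    then obtain k where k: "m + r = q * k" by (metis mod_0_imp_dvd dvdE)
    have kd: "(m + r) div q = k" using k q by simp
    show "(case ((-m) mod q, (m + (-m) mod q) div q) of (j, k) \<Rightarrow> q * k - j) = m"
      unfolding r_def[symmetric] kd using k by simp
    have "q * (-M) < q * k" "q * k < q * (M + 1)" using m r k by (simp_all add: algebra_simps)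
    hence "-M < k" "k < M + 1" using q by (simp_all only: mult_less_cancel_left_pos)
    thus "((-m) mod q, (m + (-m) mod q) div q) \<in> {0..<q} \<times> {-M<..M}"
      unfolding r_def[symmetric] kd using r by simp
  qed auto
  thus ?thesis by (simp add: sum.cartesian_product)
qed

text \<open>Two opposite poles \<open>\<plusminus>\<i> b\<close> of the partial fraction expansion, combined with the sign \<open>(-1) ^ k\<close>.
  The differences of the kernels at consecutive \<open>b\<close> are small enough to interchange the Abel-summed
  series with the Mellin integral for all \<open>0 < s < 1\<close>.\<close>

definition FE_kernel :: "nat \<Rightarrow> real \<Rightarrow> real \<Rightarrow> real" where
  "FE_kernel k b x = 2 * x ^ (1 - k) * b ^ k / (x^2 + b^2)"

lemma FE_kernel_partial_fraction:
  assumes k: "k \<le> 1" and x: "x > 0"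
  shows "1 / (of_real x - \<i> * of_real b) + (-1) ^ k / (of_real x + \<i> * of_real b) = \<i> ^ k * of_real (FE_kernel k b x)"
proof -
  have nz: "of_real x - \<i> * of_real b \<noteq> 0" "of_real x + \<i> * of_real b \<noteq> 0"
    using x by (auto simp: complex_eq_iff)
  have prod: "(of_real x - \<i> * of_real b) * (of_real x + \<i> * of_real b) = of_real (x^2 + b^2)"
    by (simp add: complex_eq_iff power2_eq_square)
  have "1 / (of_real x - \<i> * of_real b) + (-1) ^ k / (of_real x + \<i> * of_real b)
     = ((of_real x + \<i> * of_real b) + (-1)^k * (of_real x - \<i> * of_real b)) / of_real (x^2 + b^2)"
    using nz by (subst add_frac_eq) (auto simp: prod)
  also have "\<dots> = \<i> ^ k * of_real (FE_kernel k b x)"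
    using k by (cases k) (auto simp: FE_kernel_def)
  finally show ?thesis .
qed

text \<open>For either parity the derivative of the kernel in \<open>b\<close> is at most 2 / (x^2 +
  b^2); this is the corresponding finite difference. It gains a power of \<open>x\<close> or
  \<open>b\<close> over the kernel itself.\<close>

lemma FE_kernel_diff_le:
  assumes k: "k \<le> 1" and x: "x > 0" and b: "b > 0" and c: "0 \<le> c" "c \<le> b"
  shows "\<bar>FE_kernel k b x - FE_kernel k (b + c) x\<bar> \<le> 2 * c / (x^2 + b^2)"
proof -
  define P where "P = x^2 + b^2"
  define Q where "Q = x^2 + (b + c)^2"
  have P: "P > 0" and Q: "Q > 0" using x b c by (auto simp: P_def Q_def add_pos_nonneg)
  have "\<bar>FE_kernel k b x - FE_kernel k (b + c) x\<bar> = \<bar>(2 * x ^ (1 - k) * b ^ k * Q - 2 * x ^ (1 - k) * (b + c) ^ k * P) / (P * Q)\<bar>"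
    unfolding FE_kernel_def P_def[symmetric] Q_def[symmetric] using P Q by (subst diff_frac_eq) auto
  also have "\<dots> = \<bar>2 * x ^ (1 - k) * b ^ k * Q - 2 * x ^ (1 - k) * (b + c) ^ k * P\<bar> / (P * Q)"
    using P Q by (simp add: abs_div)
  also have "\<dots> \<le> (2 * c * Q) / (P * Q)"
  proof (rule divide_right_mono)
    consider "k = 0" | "k = 1" using k by linarith
    thus "\<bar>2 * x ^ (1 - k) * b ^ k * Q - 2 * x ^ (1 - k) * (b + c) ^ k * P\<bar> \<le> 2 * c * Q"
    proof cases
      case 1
      have "Q - P = c * (2 * b + c)" by (simp add: P_def Q_def power2_eq_square algebra_simps)
      hence "2 * x ^ (1 - k) * b ^ k * Q - 2 * x ^ (1 - k) * (b + c) ^ k * P = 2 * c * (x * (2 * b + c))"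
        using 1 by (simp add: algebra_simps)
      moreover have "x * (2 * b + c) \<le> Q"
      proof -
        have "0 \<le> (x - (b + c))^2" by simp
        hence "2 * (x * (b + c)) \<le> Q" by (simp add: Q_def power2_eq_square algebra_simps)
        moreover have "x * c \<ge> 0" using x c by simp
        ultimately show ?thesis by (simp add: algebra_simps)
      qed
      moreover have "0 \<le> x * (2 * b + c)" using x b c by simp
      ultimately show ?thesis using c by (simp add: abs_mult mult_left_mono)
    next
      case 2
      have "2 * x ^ (1 - k) * b ^ k * Q - 2 * x ^ (1 - k) * (b + c) ^ k * P = 2 * c * (b * (b + c) - x^2)"
        using 2 by (simp add: P_def Q_def power2_eq_square algebra_simps)
      moreover have "\<bar>b * (b + c) - x^2\<bar> \<le> Q"
      proof -
        have "b * (b + c) \<le> (b + c) * (b + c)" using b c by (intro mult_right_mono) auto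
        moreover have "0 \<le> b * (b + c)" using b c by simp
        ultimately show ?thesis by (simp add: Q_def power2_eq_square abs_le_iff) 
          (smt (verit) zero_le_square)
      qed
      ultimately show ?thesis using c by (simp add: abs_mult mult_left_mono)
    qed
  qed (use P Q in simp)
  also have "\<dots> = 2 * c / P" using Q by simp
  finally show ?thesis by (simp add: P_def)
qed

lemma FE_kernel_integral:
  assumes k: "k \<le> 1" and s: "0 < s" "s < 1" and b: "b > 0"
  shows "(\<lambda>x. x powr (s - 1) * FE_kernel k b x) absolutely_integrable_on {0<..}"
    "integral {0<..} (\<lambda>x. x powr (s - 1) * FE_kernel k b x) =
       b powr (s - 1) * (Gamma ((s + 1 - real k) / 2) * Gamma (1 - (s + 1 - real k) / 2))"
proof -
  define u where "u = s + 1 - real k"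
  have u: "0 < u" "u < 2" using s k by (auto simp: u_def)
  have eq: "x powr (s - 1) * FE_kernel k b x = b ^ k * (2 * x powr (u - 1) / (x^2 + b^2))" if "x \<in> {0<..}" for x
  proof -
    have x: "x > 0" using that by simp
    have "x powr (s - 1) * x ^ (1 - k) = x powr (u - 1)"
    proof -
      have "x powr (s - 1) * x ^ (1 - k) = x powr (s - 1) * x powr real (1 - k)" using x by (simp add: powr_realpow)
      also have "\<dots> = x powr (u - 1)" using k by (simp add: powr_add[symmetric] u_def of_nat_diff algebra_simps)
      finally show ?thesis .
    qed
    thus ?thesis by (simp add: FE_kernel_def mult_ac)
  qed
  note I = powr_over_square_plus_integral[OF u b]
  have "(\<lambda>x. b ^ k * (2 * x powr (u - 1) / (x^2 + b^2))) absolutely_integrable_on {0<..}"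
    by (intro set_integrable_mult_right I)
  moreover have "(\<lambda>x. x powr (s - 1) * FE_kernel k b x) absolutely_integrable_on {0<..} \<longleftrightarrow>
       (\<lambda>x. b ^ k * (2 * x powr (u - 1) / (x^2 + b^2))) absolutely_integrable_on {0<..}"
    by (intro set_integrable_cong refl eq)
  ultimately show "(\<lambda>x. x powr (s - 1) * FE_kernel k b x) absolutely_integrable_on {0<..}" by blast
  have "integral {0<..} (\<lambda>x. x powr (s - 1) * FE_kernel k b x) = integral {0<..} (\<lambda>x. b ^ k * (2 * x powr (u - 1) / (x^2 + b^2)))"
    by (intro integral_cong eq)
  also have "\<dots> = b ^ k * (b powr (u - 2) * (Gamma (u/2) * Gamma (1 - u/2)))"
    unfolding I(2)[symmetric] by (rule integral_mult_right)
  also have "\<dots> = (b ^ k * b powr (u - 2)) * (Gamma (u/2) * Gamma (1 - u/2))" by simp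
  also have "b ^ k * b powr (u - 2) = b powr (s - 1)"
  proof -
    have "b ^ k * b powr (u - 2) = b powr real k * b powr (u - 2)" using b by (simp add: powr_realpow)
    also have "\<dots> = b powr (s - 1)" by (simp add: powr_add[symmetric] u_def algebra_simps)
    finally show ?thesis .
  qed
  finally show "integral {0<..} (\<lambda>x. x powr (s - 1) * FE_kernel k b x) =
       b powr (s - 1) * (Gamma ((s + 1 - real k) / 2) * Gamma (1 - (s + 1 - real k) / 2))"
    by (simp only: u_def)
qed

section \<open>The exponential series and its Mellin transform\<close>

context nonprincipal_char
begin

definition exp_series :: "real \<Rightarrow> complex" where
  "exp_series x = (\<Sum>n. chi (int n) * of_real (exp (- real n * x)))"

lemma exp_series_sums:
  assumes "x > 0"
  shows "(\<lambda>n. chi (int n) * of_real (exp (- real n * x))) sums exp_series x"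
  unfolding exp_series_def
proof (rule summable_sums, rule summable_comparison_test)
  show "summable (\<lambda>n. exp (-x) ^ n)" using assms by (intro summable_geometric) simp
  show "\<exists>N. \<forall>n\<ge>N. norm (chi (int n) * of_real (exp (- real n * x))) \<le> exp (-x) ^ n"
  proof (intro exI allI impI)
    fix n :: nat
    have "norm (chi (int n) * of_real (exp (- real n * x))) \<le> 1 * exp (- real n * x)"
      unfolding norm_mult by (intro mult_mono norm_chi_le_1) auto
    thus "norm (chi (int n) * of_real (exp (- real n * x))) \<le> exp (-x) ^ n"
      by (simp add: exp_of_nat_mult[symmetric])
  qed
qed

text \<open>Indices start at 1: the partial sum at 0 is \<open>chi 0 = 0\<close>, and the constant
  \<open>exp 0\<close> would have a divergent Mellin integral.\<close>

abbreviation (input) exp_diff :: "nat \<Rightarrow> real \<Rightarrow> real" where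
  "exp_diff n x \<equiv> exp (- real (Suc n) * x) - exp (- real (Suc (Suc n)) * x)"

lemma exp_series_Abel_sums:
  assumes x: "x > 0"
  shows "(\<lambda>n. (\<Sum>j<Suc (Suc n). chi (int j)) * of_real (exp_diff n x)) sums exp_series x"
    and "summable (\<lambda>n. \<bar>exp_diff n x\<bar>)"
proof -
  have lim: "(\<lambda>n. exp (- real n * x)) \<longlonglongrightarrow> 0" using x by real_asymp
  have "(\<lambda>n. exp_diff n x) sums (exp (- real (Suc 0) * x) - 0)"
    using LIMSEQ_Suc[OF lim] by (intro telescope_sums')
  moreover have "\<bar>exp_diff n x\<bar> = exp_diff n x" for n
    using x by (intro abs_of_nonneg) (simp add: algebra_simps)
  ultimately show sm: "summable (\<lambda>n. \<bar>exp_diff n x\<bar>)"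
    by (simp only: sums_iff)
  define g where "g n = (\<Sum>j<Suc n. chi (int j)) * (complex_of_real (exp (- real n * x)) - of_real (exp (- real (Suc n) * x)))" for n
  have "summable (\<lambda>n. g (Suc n))"
  proof (rule summable_comparison_test)
    show "summable (\<lambda>n. real q * \<bar>exp_diff n x\<bar>)"
      by (intro summable_mult sm)
    show "\<exists>N. \<forall>n\<ge>N. norm (g (Suc n)) \<le> real q * \<bar>exp_diff n x\<bar>"
    proof (intro exI allI impI)
      fix n :: nat
      have "norm (g (Suc n)) = norm (\<Sum>j<Suc (Suc n). chi (int j)) * \<bar>exp_diff n x\<bar>"
        unfolding g_def norm_mult of_real_diff[symmetric] norm_of_real ..
      also have "\<dots> \<le> real q * \<bar>exp_diff n x\<bar>"
        by (intro mult_right_mono norm_psum_le) simp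
      finally show "norm (g (Suc n)) \<le> real q * \<bar>exp_diff n x\<bar>" .
    qed
  qed
  hence "summable g" by (simp only: summable_Suc_iff)
  then obtain S where T: "g sums S" unfolding summable_def by blast
  have "(\<lambda>n. complex_of_real (exp (- real n * x))) \<longlonglongrightarrow> of_real 0" using lim by (rule tendsto_of_real)
  hence lim': "(\<lambda>n. complex_of_real (exp (- real n * x))) \<longlonglongrightarrow> 0" by simp
  have "(\<lambda>n. chi (int n) * of_real (exp (- real n * x))) sums S"
    by (rule Abel_sums[OF norm_psum_le lim' T[unfolded g_def]])
  hence "exp_series x = S" using exp_series_sums[OF x] sums_unique2 by blast
  with T have "g sums exp_series x" by simp
  hence "(\<lambda>n. g (Suc n)) sums (exp_series x - g 0)" by (simp only: sums_Suc_iff diff_add_cancel)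
  moreover have "g 0 = 0" by (simp add: g_def chi_0)
  ultimately show "(\<lambda>n. (\<Sum>j<Suc (Suc n). chi (int j)) * of_real (exp_diff n x)) sums exp_series x"
    by (simp only: g_def diff_zero of_real_diff)
qed

text \<open>Integrating the Abel-summed series gives this for all \<open>s > 0\<close>, in
  particular for 0 < s < 1, where the kernel expansion will be integrated.\<close>

lemma Mellin_exp_series:
  assumes s: "s > 0"
  shows "integral {0<..} (\<lambda>x. of_real (x powr (s - 1)) * exp_series x) = of_real (Gamma s) * L (of_real s)"
proof -
  let ?h = "\<lambda>n x. x powr (s - 1) * exp_diff n x"
  have h: "?h n absolutely_integrable_on {0<..}" 
    "integral {0<..} (?h n) = Gamma s * (real (Suc n) powr (-s) - real (Suc (Suc n)) powr (-s))" for n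
  proof -
    note I = exp_powr_integral[OF _ s, of "real (Suc n)"] exp_powr_integral[OF _ s, of "real (Suc (Suc n))"]
    have eq: "?h n = (\<lambda>x. x powr (s - 1) * exp (- real (Suc n) * x) - x powr (s - 1) * exp (- real (Suc (Suc n)) * x))"
      by (simp only: right_diff_distrib)
    show "?h n absolutely_integrable_on {0<..}" unfolding eq by (intro set_integral_diff(1) I) auto
    have "(\<lambda>x. x powr (s - 1) * exp (- real (Suc n) * x)) integrable_on {0<..}" "(\<lambda>x. x powr (s - 1) * exp (- real (Suc (Suc n)) * x)) integrable_on {0<..}"
      using I(1,3) by (auto dest!: set_lebesgue_integral_eq_integral(1))
    thus "integral {0<..} (?h n) = Gamma s * (real (Suc n) powr (-s) - real (Suc (Suc n)) powr (-s))"
      unfolding eq using I(2,4) by (subst integral_diff) (auto simp: right_diff_distrib)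
  qed
  have nonneg: "?h n x \<ge> 0" if "x > 0" for n x
    using that by (intro mult_nonneg_nonneg) (auto simp: algebra_simps)
  have tel: "(\<lambda>n. Gamma s * (real (Suc n) powr (-s) - real (Suc (Suc n)) powr (-s))) sums (Gamma s * (real (Suc 0) powr (-s) - 0))"
  proof (intro sums_mult telescope_sums')
    show "(\<lambda>n. real (Suc n) powr (-s)) \<longlonglongrightarrow> 0" using s by real_asymp
  qed
  have "(\<lambda>n. (\<Sum>j<Suc (Suc n). chi (int j)) * of_real (integral {0<..} (?h n))) sums
      integral {0<..} (\<lambda>x. of_real (x powr (s - 1)) * exp_series x)"
  proof (rule sums_integral_Ioi[OF h(1) norm_psum_le])
    show "integral {0<..} (\<lambda>x. \<bar>?h n x\<bar>) \<le> Gamma s * (real (Suc n) powr (-s) - real (Suc (Suc n)) powr (-s))" for n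
    proof -
      have "integral {0<..} (\<lambda>x. \<bar>?h n x\<bar>) = integral {0<..} (?h n)"
        using nonneg by (intro integral_cong abs_of_nonneg) auto
      thus ?thesis using h(2) by simp
    qed
    show "summable (\<lambda>n. Gamma s * (real (Suc n) powr (-s) - real (Suc (Suc n)) powr (-s)))"
      using tel by (rule sums_summable)
    fix x :: real assume x: "x > 0"
    show "summable (\<lambda>n. \<bar>?h n x\<bar>)"
      using exp_series_Abel_sums(2)[OF x] unfolding abs_mult by (intro summable_mult)
    show "(\<lambda>n. (\<Sum>j<Suc (Suc n). chi (int j)) * of_real (?h n x)) sums (of_real (x powr (s - 1)) * exp_series x)"
      using sums_mult[OF exp_series_Abel_sums(1)[OF x], of "of_real (x powr (s - 1))"]
      by (simp only: of_real_mult mult.left_commute)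
  qed
  moreover have "(\<lambda>n. (\<Sum>j<Suc (Suc n). chi (int j)) * of_real (integral {0<..} (?h n))) sums (of_real (Gamma s) * L (of_real s))"
  proof -
    have "L_Abel_term 0 (of_real s) = 0" by (simp add: L_Abel_term_def chi_0)
    hence "(\<lambda>n. L_Abel_term (Suc n) (of_real s)) sums L (of_real s)"
      using L_Abel_sums[of "of_real s"] s sums_Suc_iff[of "\<lambda>n. L_Abel_term n (of_real s)" "L (of_real s)"] by simp
    hence "(\<lambda>n. of_real (Gamma s) * L_Abel_term (Suc n) (of_real s)) sums (of_real (Gamma s) * L (of_real s))" by (rule sums_mult)
    moreover have "of_real (Gamma s) * L_Abel_term (Suc n) (of_real s) = (\<Sum>j<Suc (Suc n). chi (int j)) * of_real (integral {0<..} (?h n))" for n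
    proof -
      have "of_nat m powr (- complex_of_real s) = of_real (real m powr (-s))" for m
        using powr_of_real[of "real m" "-s"] by simp
      thus ?thesis unfolding h(2) L_Abel_term_def by (simp only: of_real_mult of_real_diff mult_ac)
    qed
    ultimately show ?thesis by (simp only:)
  qed
  ultimately show ?thesis by (rule sums_unique2)
qed

end

section \<open>Partial fractions and the functional equation on the real segment\<close>

locale primitive_char_parity = primitive_char +
  fixes k :: nat
  assumes k_le: "k \<le> 1" and parity: "chi (-1) = (-1) ^ k"
begin

sublocale C: nonprincipal_char q "\<lambda>n. cnj (chi n)"
  by (rule nonprincipal_cnj)

text \<open>The spacing of the possible poles of \<open>exp_series\<close> on the imaginary
  axis.\<close>

abbreviation (input) cc :: real where "cc \<equiv> 2 * pi / real q"

text \<open>\<open>gauss_sum_twist\<close> replaces \<open>chi n\<close> by exponentials, and the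
  sum over \<open>n\<close> becomes geometric.\<close>

lemma gauss_sum_exp_series:
  assumes x: "x > 0"
  shows "gauss_sum * exp_series x = (\<Sum>j\<in>{0..<int q}. cnj (chi j) / (1 - additive_char q j * of_real (exp (-x))))"
proof -
  have "(\<lambda>n. \<Sum>j\<in>{0..<int q}. cnj (chi j) * (additive_char q j * of_real (exp (-x))) ^ n) sums
      (\<Sum>j\<in>{0..<int q}. cnj (chi j) * (1 / (1 - additive_char q j * of_real (exp (-x)))))"
  proof (intro sums_sum sums_mult geometric_sums)
    show "norm (additive_char q j * of_real (exp (-x))) < 1" for j
      using x by (simp add: norm_mult additive_char_def)
  qed
  moreover have "(\<Sum>j\<in>{0..<int q}. cnj (chi j) * (additive_char q j * of_real (exp (-x))) ^ n) =
      gauss_sum * (chi (int n) * of_real (exp (- real n * x)))" for n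
  proof -
    have e: "of_real (exp (-x)) ^ n = complex_of_real (exp (- real n * x))"
      by (simp add: exp_of_nat_mult[symmetric] flip: of_real_power)
    have "(\<Sum>j\<in>{0..<int q}. cnj (chi j) * (additive_char q j * of_real (exp (-x))) ^ n) =
      (\<Sum>j\<in>{0..<int q}. cnj (chi j) * additive_char q (j * int n)) * of_real (exp (- real n * x))"
      unfolding power_mult_distrib e additive_char_mult_nat sum_distrib_right by (simp only: mult.assoc)
    thus ?thesis unfolding gauss_sum_twist by (simp only: mult_ac)
  qed
  ultimately have "(\<lambda>n. gauss_sum * (chi (int n) * of_real (exp (- real n * x)))) sums
      (\<Sum>j\<in>{0..<int q}. cnj (chi j) * (1 / (1 - additive_char q j * of_real (exp (-x)))))" by (simp only:)
  moreover have "(\<lambda>n. gauss_sum * (chi (int n) * of_real (exp (- real n * x)))) sums (gauss_sum * exp_series x)"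
    by (intro sums_mult exp_series_sums x)
  ultimately show ?thesis using sums_unique2 by (auto simp: divide_inverse)
qed

text \<open>Each summand of \<open>gauss_sum_exp_series\<close> is expanded by
  \<open>inverse_one_minus_exp_partial_fractions\<close>; the constants 1/2 cancel because
  \<open>cnj chi\<close> sums to zero. Replacing \<open>j\<close> by \<open>-j\<close> brings the
  poles into the form required by \<open>sum_residue_blocks\<close>.\<close>

lemma exp_series_partial_fractions:
  assumes x: "x > 0"
  shows "(\<lambda>M. \<Sum>m\<in>{-int (q * M)<..int (q * M)}. cnj (chi m) / (of_real x - \<i> * of_real (cc * of_int m)))
     \<longlonglongrightarrow> gauss_sum * exp_series x"
proof -
  let ?w = "\<lambda>j::int. of_real x + \<i> * of_real (cc * of_int j)"
  have "(\<lambda>M. \<Sum>j\<in>{0..<int q}. cnj (chi (-j)) * (\<Sum>n\<in>{-int M<..int M}. 1 / (?w j - of_real (2 * pi) * \<i> * of_int n)))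
    \<longlonglongrightarrow> (\<Sum>j\<in>{0..<int q}. cnj (chi (-j)) * (1 / (1 - exp (- ?w j)) - 1 / 2))"
  proof (intro tendsto_sum tendsto_mult tendsto_const inverse_one_minus_exp_partial_fractions)
    fix j :: int
    have "norm (exp (?w j)) \<noteq> 1" using x by (simp add: norm_exp_eq_Re)
    thus "exp (?w j) \<noteq> 1" by (metis norm_one)
  qed
  also have "(\<Sum>j\<in>{0..<int q}. cnj (chi (-j)) * (1 / (1 - exp (- ?w j)) - 1 / 2))
     = gauss_sum * exp_series x"
  proof -
    have e: "exp (- ?w j) = additive_char q (-j) * of_real (exp (-x))" for j
    proof -
      have "exp (- ?w j) = exp (\<i> * of_real (- (cc * of_int j))) * exp (of_real (-x))"
        unfolding exp_add[symmetric] by (rule arg_cong[of _ _ exp]) simp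
      also have "exp (\<i> * of_real (- (cc * of_int j))) = additive_char q (-j)"
        unfolding additive_char_def cis_conv_exp by simp
      finally show ?thesis by (simp only: exp_of_real)
    qed
    have "(\<Sum>j\<in>{0..<int q}. cnj (chi (-j)) * (1 / (1 - exp (- ?w j)) - 1 / 2))
      = (\<Sum>j\<in>{0..<int q}. (\<lambda>j. cnj (chi j) * (1 / (1 - additive_char q j * of_real (exp (-x))) - 1 / 2)) ((-1) * j))"
      unfolding e by simp
    also have "\<dots> = (\<Sum>j\<in>{0..<int q}. cnj (chi j) * (1 / (1 - additive_char q j * of_real (exp (-x))) - 1 / 2))"
    proof (rule sum_periodic_mult)
      show "int q > 0" using q_pos by simp
      show "coprime (-1) (int q)" by simp
      fix m n assume mn: "[m = n] (mod int q)"
      show "cnj (chi m) * (1 / (1 - additive_char q m * of_real (exp (-x))) - 1 / 2) = cnj (chi n) * (1 / (1 - additive_char q n * of_real (exp (-x))) - 1 / 2)"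
        using chi_cong[OF mn] additive_char_cong[OF mn q_pos] by (simp only:)
    qed
    also have "\<dots> = (\<Sum>j\<in>{0..<int q}. cnj (chi j) / (1 - additive_char q j * of_real (exp (-x)))) - (\<Sum>j\<in>{0..<int q}. cnj (chi j)) / 2"
      by (simp add: right_diff_distrib sum_subtractf sum_divide_distrib)
    also have "\<dots> = gauss_sum * exp_series x"
      using C.sum_chi_zero by (simp add: gauss_sum_exp_series[OF x])
    finally show ?thesis .
  qed
  also have "(\<lambda>M. \<Sum>j\<in>{0..<int q}. cnj (chi (-j)) * (\<Sum>n\<in>{-int M<..int M}. 1 / (?w j - of_real (2 * pi) * \<i> * of_int n)))
     = (\<lambda>M. \<Sum>m\<in>{-int (q * M)<..int (q * M)}. cnj (chi m) / (of_real x - \<i> * of_real (cc * of_int m)))"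
  proof
    fix M :: nat
    have "(\<Sum>m\<in>{-int (q * M)<..int (q * M)}. cnj (chi m) / (of_real x - \<i> * of_real (cc * of_int m)))
      = (\<Sum>j\<in>{0..<int q}. \<Sum>n\<in>{-int M<..int M}. cnj (chi (int q * n - j)) / (of_real x - \<i> * of_real (cc * of_int (int q * n - j))))"
      unfolding of_nat_mult using q_pos by (intro sum_residue_blocks[symmetric]) simp
    also have "\<dots> = (\<Sum>j\<in>{0..<int q}. cnj (chi (-j)) * (\<Sum>n\<in>{-int M<..int M}. 1 / (?w j - of_real (2 * pi) * \<i> * of_int n)))"
    proof (intro sum.cong refl)
      fix j
      have "cnj (chi (int q * n - j)) / (of_real x - \<i> * of_real (cc * of_int (int q * n - j)))
        = cnj (chi (-j)) * (1 / (?w j - of_real (2 * pi) * \<i> * of_int n))" for n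
      proof -
        have 1: "chi (int q * n - j) = chi (-j)" by (rule chi_cong) (simp add: cong_iff_dvd_diff)
        have 2: "cc * of_int (int q * n - j) = 2 * pi * of_int n - cc * of_int j"
          using q_pos by (simp add: field_simps)
        have "of_real x - \<i> * of_real (2 * pi * of_int n - C) = of_real x + \<i> * of_real C - of_real (2 * pi) * \<i> * of_int n" for C
          by (simp add: algebra_simps)
        note 3 = this[of "cc * of_int j"]
        show ?thesis unfolding 1 2 3 times_divide_eq_right mult_1_right ..
      qed
      thus "(\<Sum>n\<in>{-int M<..int M}. cnj (chi (int q * n - j)) / (of_real x - \<i> * of_real (cc * of_int (int q * n - j))))
        = cnj (chi (-j)) * (\<Sum>n\<in>{-int M<..int M}. 1 / (?w j - of_real (2 * pi) * \<i> * of_int n))"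
        by (simp only: sum_distrib_left)
    qed
    finally show "(\<Sum>j\<in>{0..<int q}. cnj (chi (-j)) * (\<Sum>n\<in>{-int M<..int M}. 1 / (?w j - of_real (2 * pi) * \<i> * of_int n)))
      = (\<Sum>m\<in>{-int (q * M)<..int (q * M)}. cnj (chi m) / (of_real x - \<i> * of_real (cc * of_int m)))" ..
  qed
  finally show ?thesis .
qed

lemma exp_series_kernel_limit:
  assumes x: "x > 0"
  shows "(\<lambda>M. \<Sum>m<q * M. cnj (chi (int m)) * (\<i> ^ k * of_real (FE_kernel k (cc * real m) x))) \<longlonglongrightarrow> gauss_sum * exp_series x"
proof -
  let ?g = "\<lambda>m. cnj (chi m) / (of_real x - \<i> * of_real (cc * of_int m))"
  have "(\<Sum>m\<in>{-int (q * M)<..int (q * M)}. ?g m) = (\<Sum>m<q * M. cnj (chi (int m)) * (\<i> ^ k * of_real (FE_kernel k (cc * real m) x)))" for M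
  proof -
    have "(\<Sum>m\<in>{-int (q * M)<..int (q * M)}. ?g m) = (\<Sum>m<q * M. ?g (- int m)) + (\<Sum>m<q * M. ?g (int (Suc m)))"
      unfolding sum_int_symmetric by (rule sum.distrib)
    \<comment> \<open>The range pairs \<open>-m\<close> with \<open>m + 1\<close>. Shifting the
      second half costs the terms at 0 and at \<open>q * M\<close>, where \<open>chi\<close>
      vanishes.\<close>
    also have "(\<Sum>m<q * M. ?g (int (Suc m))) = (\<Sum>m<Suc (q * M). ?g (int m)) - ?g (int 0)"
      by (subst sum.lessThan_Suc_shift) simp
    also have "\<dots> = (\<Sum>m<q * M. ?g (int m))"
      using chi_mult_q[of "int M"] chi_0 by simp
    also have "(\<Sum>m<q * M. ?g (- int m)) + (\<Sum>m<q * M. ?g (int m)) = (\<Sum>m<q * M. cnj (chi (int m)) * (\<i> ^ k * of_real (FE_kernel k (cc * real m) x)))"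
      unfolding sum.distrib[symmetric]
    proof (intro sum.cong refl)
      fix m
      have "cnj (chi (- int m)) = (-1) ^ k * cnj (chi (int m))" by (simp add: chi_minus_parity[OF parity])
      hence "?g (- int m) + ?g (int m) = cnj (chi (int m)) * (1 / (of_real x - \<i> * of_real (cc * real m)) + (-1) ^ k / (of_real x + \<i> * of_real (cc * real m)))"
        by (simp add: algebra_simps)
      also have "\<dots> = cnj (chi (int m)) * (\<i> ^ k * of_real (FE_kernel k (cc * real m) x))"
        by (simp only: FE_kernel_partial_fraction[OF k_le x])
      finally show "?g (- int m) + ?g (int m) = cnj (chi (int m)) * (\<i> ^ k * of_real (FE_kernel k (cc * real m) x))" .
    qed
    finally show ?thesis .
  qed
  with exp_series_partial_fractions[OF x] show ?thesis by (simp only:)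
qed

lemma cc_pos: "cc > 0" using q_pos by simp

lemma kernel_diff_bound:
  assumes x: "x > 0" and m: "m > 0"
  shows "\<bar>FE_kernel k (cc * real m) x - FE_kernel k (cc * real (Suc m)) x\<bar> \<le> 2 * cc / (x^2 + (cc * real m)^2)"
proof -
  have "cc * 1 \<le> cc * real m" using cc_pos m by (intro mult_left_mono) auto
  hence "\<bar>FE_kernel k (cc * real m) x - FE_kernel k (cc * real m + cc) x\<bar> \<le> 2 * cc / (x^2 + (cc * real m)^2)"
    using cc_pos x m by (intro FE_kernel_diff_le k_le) (auto intro: mult_pos_pos)
  moreover have "cc * real m + cc = cc * real (Suc m)" unfolding of_nat_Suc distrib_left by simp
  ultimately show ?thesis by (simp only:)
qed

abbreviation (input) kernel_diff :: "nat \<Rightarrow> real \<Rightarrow> real" where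
  "kernel_diff n x \<equiv> FE_kernel k (cc * real (Suc n)) x - FE_kernel k (cc * real (Suc (Suc n))) x"

lemma kernel_summable:
  assumes x: "x > 0"
  shows "summable (\<lambda>n. \<bar>kernel_diff n x\<bar>)"
proof (rule summable_comparison_test)
  have "summable (\<lambda>n. real n powr (-2))" by (simp add: summable_real_powr_iff)
  hence "summable (\<lambda>n. real (Suc n) powr (-2))" by (subst (asm) summable_Suc_iff[symmetric])
  thus "summable (\<lambda>n. (2 / cc) * real (Suc n) powr (-2))" by (rule summable_mult)
  show "\<exists>N. \<forall>n\<ge>N. norm \<bar>kernel_diff n x\<bar> \<le> (2 / cc) * real (Suc n) powr (-2)"
  proof (intro exI allI impI)
    fix n :: nat
    have "\<bar>kernel_diff n x\<bar> \<le> 2 * cc / (x^2 + (cc * real (Suc n))^2)"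
      using x by (intro kernel_diff_bound) auto
    also have "\<dots> \<le> 2 * cc / (cc * real (Suc n))^2"
      using cc_pos by (intro divide_left_mono mult_pos_pos add_nonneg_pos zero_less_power) (auto simp del: of_nat_Suc)
    also have "\<dots> = (2 / cc) * real (Suc n) powr (-2)"
      using cc_pos by (simp add: powr_minus_divide power2_eq_square powr_numeral del: of_nat_Suc)
    finally show "norm \<bar>kernel_diff n x\<bar> \<le> (2 / cc) * real (Suc n) powr (-2)"
      by simp
  qed
qed

lemma exp_series_kernel_sums:
  assumes x: "x > 0"
  shows "(\<lambda>n. (\<i> ^ k * (\<Sum>j<Suc (Suc n). cnj (chi (int j)))) * of_real (kernel_diff n x))
     sums (gauss_sum * exp_series x)"
proof -
  let ?u = "\<lambda>m. \<i> ^ k * of_real (FE_kernel k (cc * real m) x)"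
  define g where "g n = (\<Sum>j<Suc n. cnj (chi (int j))) * (?u n - ?u (Suc n))" for n
  have "summable (\<lambda>n. g (Suc n))"
  proof (rule summable_comparison_test)
    show "summable (\<lambda>n. real q * \<bar>kernel_diff n x\<bar>)"
      by (intro summable_mult kernel_summable x)
    show "\<exists>N. \<forall>n\<ge>N. norm (g (Suc n)) \<le> real q * \<bar>kernel_diff n x\<bar>"
    proof (intro exI allI impI)
      fix n :: nat
      have "norm (g (Suc n)) = norm (\<Sum>j<Suc (Suc n). cnj (chi (int j))) * \<bar>kernel_diff n x\<bar>"
        unfolding g_def norm_mult right_diff_distrib[symmetric] of_real_diff[symmetric] norm_of_real norm_power by simp
      also have "\<dots> \<le> real q * \<bar>kernel_diff n x\<bar>"
        by (intro mult_right_mono C.norm_psum_le) simp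
      finally show "norm (g (Suc n)) \<le> real q * \<bar>kernel_diff n x\<bar>" .
    qed
  qed
  hence "summable g" by (simp only: summable_Suc_iff)
  then obtain S where T: "g sums S" unfolding summable_def by blast
  have u0: "?u \<longlonglongrightarrow> 0"
  proof (rule tendsto_norm_zero_cancel)
    have "(\<lambda>m. FE_kernel k (cc * real m) x) \<longlonglongrightarrow> 0"
    proof -
      have c0: "cc > 0" by (rule cc_pos)
      consider "k = 0" | "k = 1" using k_le by linarith
      thus ?thesis
      proof cases
        case 1
        have "(\<lambda>m. 2 * x / (x^2 + (C * real m)^2)) \<longlonglongrightarrow> 0" if "C > 0" for C using that by real_asymp
        from this[OF c0] 1 show ?thesis by (simp add: FE_kernel_def)
      next
        case 2
        have "(\<lambda>m. 2 * (C * real m) / (x^2 + (C * real m)^2)) \<longlonglongrightarrow> 0" if "C > 0" for C using that by real_asymp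
        from this[OF c0] 2 show ?thesis by (simp add: FE_kernel_def)
      qed
    qed
    hence "(\<lambda>m. norm (FE_kernel k (cc * real m) x)) \<longlonglongrightarrow> 0" by (rule tendsto_norm_zero)
    thus "(\<lambda>m. norm (?u m)) \<longlonglongrightarrow> 0" by (simp add: norm_mult norm_power)
  qed
  have "(\<lambda>m. cnj (chi (int m)) * ?u m) sums S"
    by (rule Abel_sums[OF C.norm_psum_le u0 T[unfolded g_def]])
  hence "(\<lambda>N. \<Sum>m<N. cnj (chi (int m)) * ?u m) \<longlonglongrightarrow> S" unfolding sums_def .
  \<comment> \<open>\<open>exp_series_kernel_limit\<close> gives the limit only along multiples of
    \<open>q\<close>; it identifies \<open>S\<close>, whose existence comes from Abel
    summation.\<close>
  moreover have "filterlim (\<lambda>M. q * M) at_top sequentially"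
    using q_pos by (intro filterlim_subseq) (auto simp: strict_mono_def)
  ultimately have "(\<lambda>M. \<Sum>m<q * M. cnj (chi (int m)) * ?u m) \<longlonglongrightarrow> S" by (rule filterlim_compose)
  hence "S = gauss_sum * exp_series x" using exp_series_kernel_limit[OF x] LIMSEQ_unique by blast
  moreover have "g 0 = 0" by (simp add: g_def chi_0)
  ultimately have "(\<lambda>n. g (Suc n)) sums (gauss_sum * exp_series x)"
    using T sums_Suc_iff[of g "gauss_sum * exp_series x"] by simp
  moreover have "g (Suc n) = (\<i> ^ k * (\<Sum>j<Suc (Suc n). cnj (chi (int j)))) * of_real (kernel_diff n x)" for n
    unfolding g_def of_real_diff right_diff_distrib[symmetric] by (simp only: mult_ac)
  ultimately show ?thesis by (simp only:)
qed

text \<open>Both expansions of \<open>exp_series\<close> are integrated against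
  \<open>x powr (s - 1)\<close>. The kernel integral at \<open>cc * m\<close> is a constant times
  \<open>(cc * m) powr (s - 1)\<close>, which turns the partial fractions into the conjugate series
  at 1 - s.\<close>

lemma functional_equation_Mellin:
  assumes s: "0 < s" "s < 1"
  shows "gauss_sum * (of_real (Gamma s) * L (of_real s)) =
    \<i> ^ k * of_real (cc powr (s - 1) * (Gamma ((s + 1 - real k) / 2) * Gamma (1 - (s + 1 - real k) / 2))) * C.L (of_real (1 - s))"
proof -
  define G where "G = Gamma ((s + 1 - real k) / 2) * Gamma (1 - (s + 1 - real k) / 2)"
  let ?h = "\<lambda>n x. x powr (s - 1) * kernel_diff n x"
  let ?a = "\<lambda>n. \<i> ^ k * (\<Sum>j<Suc (Suc n). cnj (chi (int j)))"
  have pos: "cc * real (Suc n) > 0" for n using cc_pos by (intro mult_pos_pos) auto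
  have h: "?h n absolutely_integrable_on {0<..}" 
    "integral {0<..} (?h n) = ((cc * real (Suc n)) powr (s - 1) - (cc * real (Suc (Suc n))) powr (s - 1)) * G" for n
  proof -
    note I = FE_kernel_integral[OF k_le s pos[of n], folded G_def] FE_kernel_integral[OF k_le s pos[of "Suc n"], folded G_def]
    have eq: "?h n = (\<lambda>x. x powr (s - 1) * FE_kernel k (cc * real (Suc n)) x - x powr (s - 1) * FE_kernel k (cc * real (Suc (Suc n))) x)"
      by (simp only: right_diff_distrib)
    show "?h n absolutely_integrable_on {0<..}" unfolding eq by (intro set_integral_diff(1) I)
    have "(\<lambda>x. x powr (s - 1) * FE_kernel k (cc * real (Suc n)) x) integrable_on {0<..}" "(\<lambda>x. x powr (s - 1) * FE_kernel k (cc * real (Suc (Suc n))) x) integrable_on {0<..}"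
      using I(1,3) by (auto dest!: set_lebesgue_integral_eq_integral(1))
    thus "integral {0<..} (?h n) = ((cc * real (Suc n)) powr (s - 1) - (cc * real (Suc (Suc n))) powr (s - 1)) * G"
      unfolding eq using I(2,4) by (subst integral_diff) (auto simp only: left_diff_distrib)
  qed
  have "(\<lambda>n. ?a n * of_real (integral {0<..} (?h n))) sums integral {0<..} (\<lambda>x. of_real (x powr (s - 1)) * (gauss_sum * exp_series x))"
  proof (rule sums_integral_Ioi[OF h(1)])
    show "norm (?a n) \<le> real q" for n using C.norm_psum_le[of "Suc (Suc n)"] by (simp add: norm_mult norm_power del: sum.lessThan_Suc)
    \<comment> \<open>The difference bound and the integral at exponent \<open>s\<close> leave terms
      of order \<open>n powr (s - 2)\<close>, summable because s < 1.\<close>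
    show "integral {0<..} (\<lambda>x. \<bar>?h n x\<bar>) \<le> cc * ((cc * real (Suc n)) powr (s - 2) * (Gamma (s/2) * Gamma (1 - s/2)))" for n
    proof -
      note J = powr_over_square_plus_integral[OF s(1) _ pos[of n]]
      have s2: "s < 2" using s by simp
      have "integral {0<..} (\<lambda>x. \<bar>?h n x\<bar>) \<le> integral {0<..} (\<lambda>x. cc * (2 * x powr (s - 1) / (x^2 + (cc * real (Suc n))^2)))"
      proof (rule integral_le)
        show "(\<lambda>x. \<bar>?h n x\<bar>) integrable_on {0<..}"
          using h(1)[of n] by (simp only: absolutely_integrable_on_def real_norm_def)
        show "(\<lambda>x. cc * (2 * x powr (s - 1) / (x^2 + (cc * real (Suc n))^2))) integrable_on {0<..}"
          by (intro set_lebesgue_integral_eq_integral(1) set_integrable_mult_right J(1) s2)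
        fix x :: real assume "x \<in> {0<..}"
        hence "\<bar>kernel_diff n x\<bar> \<le> 2 * cc / (x^2 + (cc * real (Suc n))^2)"
          by (intro kernel_diff_bound) auto
        hence "\<bar>?h n x\<bar> \<le> x powr (s - 1) * (2 * cc / (x^2 + (cc * real (Suc n))^2))"
          unfolding abs_mult by (intro mult_mono) auto
        thus "\<bar>?h n x\<bar> \<le> cc * (2 * x powr (s - 1) / (x^2 + (cc * real (Suc n))^2))"
          by (simp only: times_divide_eq_right mult_ac)
      qed
      also have "\<dots> = cc * ((cc * real (Suc n)) powr (s - 2) * (Gamma (s/2) * Gamma (1 - s/2)))"
        unfolding J(2)[OF s2, symmetric] by (rule integral_mult_right)
      finally show ?thesis .
    qed
    show "summable (\<lambda>n. cc * ((cc * real (Suc n)) powr (s - 2) * (Gamma (s/2) * Gamma (1 - s/2))))"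
    proof (intro summable_mult summable_mult2)
      have "summable (\<lambda>n. real n powr (s - 2))" using s by (simp add: summable_real_powr_iff)
      hence "summable (\<lambda>n. real (Suc n) powr (s - 2))" by (subst (asm) summable_Suc_iff[symmetric])
      hence "summable (\<lambda>n. cc powr (s - 2) * real (Suc n) powr (s - 2))" by (rule summable_mult)
      thus "summable (\<lambda>n. (cc * real (Suc n)) powr (s - 2))" using cc_pos by (simp only: powr_mult less_imp_le of_nat_0_le_iff)
    qed
    fix x :: real assume x: "x > 0"
    show "summable (\<lambda>n. \<bar>?h n x\<bar>)"
      using kernel_summable[OF x] unfolding abs_mult by (intro summable_mult)
    show "(\<lambda>n. ?a n * of_real (?h n x)) sums (of_real (x powr (s - 1)) * (gauss_sum * exp_series x))"
      using sums_mult[OF exp_series_kernel_sums[OF x], of "of_real (x powr (s - 1))"]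
      by (simp only: of_real_mult mult.left_commute)
  qed
  moreover have "integral {0<..} (\<lambda>x. of_real (x powr (s - 1)) * (gauss_sum * exp_series x)) = gauss_sum * (of_real (Gamma s) * L (of_real s))"
    unfolding Mellin_exp_series[OF s(1), symmetric] integral_mult_right[symmetric] by (simp only: mult.left_commute)
  moreover have "(\<lambda>n. ?a n * of_real (integral {0<..} (?h n))) sums (\<i> ^ k * of_real (cc powr (s - 1) * G) * C.L (of_real (1 - s)))"
  proof -
    have "C.L_Abel_term 0 (of_real (1 - s)) = 0" by (simp add: C.L_Abel_term_def chi_0)
    hence "(\<lambda>n. C.L_Abel_term (Suc n) (of_real (1 - s))) sums C.L (of_real (1 - s))"
      using C.L_Abel_sums[of "of_real (1 - s)"] s sums_Suc_iff[of "\<lambda>n. C.L_Abel_term n (of_real (1 - s))" "C.L (of_real (1 - s))"] by simp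
    hence "(\<lambda>n. \<i> ^ k * of_real (cc powr (s - 1) * G) * C.L_Abel_term (Suc n) (of_real (1 - s))) sums (\<i> ^ k * of_real (cc powr (s - 1) * G) * C.L (of_real (1 - s)))" by (rule sums_mult)
    moreover have "\<i> ^ k * of_real (cc powr (s - 1) * G) * C.L_Abel_term (Suc n) (of_real (1 - s)) = ?a n * of_real (integral {0<..} (?h n))" for n
    proof -
      have p: "of_nat m powr (- complex_of_real (1 - s)) = of_real (real m powr (s - 1))" for m
        using powr_of_real[of "real m" "s - 1"] by simp
      have d: "integral {0<..} (?h n) = cc powr (s - 1) * G * (real (Suc n) powr (s - 1) - real (Suc (Suc n)) powr (s - 1))"
      proof -
        have "(cc * real m) powr (s - 1) = cc powr (s - 1) * real m powr (s - 1)" for m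
          using cc_pos by (intro powr_mult) 
        thus ?thesis unfolding h(2) by (simp only: right_diff_distrib left_diff_distrib mult_ac)
      qed
      show ?thesis unfolding d C.L_Abel_term_def p of_real_diff[symmetric] of_real_mult by (simp only: mult_ac)
    qed
    ultimately show ?thesis by (simp only:)
  qed
  ultimately show ?thesis unfolding G_def[symmetric] by (simp add: sums_iff)
qed

end

section \<open>The completed L-function\<close>

context dirichlet_char
begin

definition gamma_factor :: "nat \<Rightarrow> complex \<Rightarrow> complex" where
  "gamma_factor k s = of_real (q / pi) powr (s / 2) * Gamma ((s + of_nat k) / 2)"

definition xi :: "nat \<Rightarrow> complex \<Rightarrow> complex" where
  "xi k s = gamma_factor k s * L s"

lemma q_pi_pos: "real q / pi > 0"
  using q_pos by simp

lemma half_not_nonpos_Int: "Re s > 0 \<Longrightarrow> (s + of_nat k) / 2 \<notin> \<int>\<^sub>\<le>\<^sub>0"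
  by (auto elim!: nonpos_Ints_cases simp: complex_eq_iff)

lemma norm_gamma_factor: "norm (gamma_factor k s) = (q / pi) powr (Re s / 2) * norm (Gamma ((s + of_nat k) / 2))"
  using norm_powr_real_powr[of "of_real (q / pi)" "s / 2"] q_pi_pos
  by (simp add: gamma_factor_def norm_mult)

lemma gamma_factor_nonzero: "Re s > 0 \<Longrightarrow> gamma_factor k s \<noteq> 0"
  using q_pos half_not_nonpos_Int[of s k] by (auto simp: gamma_factor_def Gamma_eq_zero_iff)

lemma gamma_factor_holomorphic: "gamma_factor k holomorphic_on {s. Re s > 0}"
  unfolding gamma_factor_def
  by (intro holomorphic_on_mult holomorphic_on_powr_right holomorphic_Gamma' holomorphic_intros)
     (use half_not_nonpos_Int in auto)

end

lemma (in nonprincipal_char) xi_holomorphic: "xi k holomorphic_on {s. Re s > 0}"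
  unfolding xi_def by (intro holomorphic_on_mult gamma_factor_holomorphic L_holomorphic)

context primitive_char_parity
begin

lemma L_cnj:
  assumes "Re s > 0"
  shows "C.L s = cnj (L (cnj s))"
proof -
  have "(\<lambda>n. cnj (chi (int n) * of_nat n powr (- cnj s))) sums cnj (L (cnj s))"
    using L_sums[of "cnj s"] assms by (subst sums_cnj) simp
  moreover have "cnj (chi (int n) * of_nat n powr (- cnj s)) = cnj (chi (int n)) * of_nat n powr (-s)" for n
    using cnj_powr[of "of_nat n" "- cnj s"] by (simp add: complex_nonpos_Reals_iff)
  ultimately have "(\<lambda>n. cnj (chi (int n)) * of_nat n powr (-s)) sums cnj (L (cnj s))" by (simp only:)
  thus ?thesis using C.L_sums[OF assms] sums_unique2 by blast
qed

lemma xi_cnj: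
  assumes "Re s > 0"
  shows "C.xi k s = cnj (xi k (cnj s))"
proof -
  have "cnj (of_real (q / pi) powr (cnj s / 2)) = of_real (q / pi) powr (s / 2)"
    using cnj_powr[of "of_real (q / pi)" "cnj s / 2"] q_pi_pos by (simp add: complex_nonpos_Reals_iff)
  moreover have "cnj (Gamma ((cnj s + of_nat k) / 2)) = Gamma ((s + of_nat k) / 2)"
    by (simp add: cnj_Gamma)
  ultimately show ?thesis using L_cnj[OF assms]
    by (simp add: C.xi_def xi_def gamma_factor_def)
qed

text \<open>Multiplying the Mellin form by \<open>g2\<close> produces \<open>g1 * g2\<close>, which
  Legendre duplication turns into a multiple of \<open>Gamma s\<close>; this cancels and leaves a
  symmetric relation. The parity decides which of \<open>g1\<close> and \<open>g2\<close> is
  \<open>Gamma (s / 2)\<close>.\<close>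

lemma xi_functional_equation_real:
  assumes s: "0 < s" "s < 1"
  shows "gauss_sum * xi k (of_real s) = \<i> ^ k * of_real (sqrt q) * C.xi k (of_real (1 - s))"
proof -
  define u where "u = s + 1 - real k"
  define g1 where "g1 = Gamma (u / 2)"
  define g2 where "g2 = Gamma ((s + real k) / 2)"
  define g3 where "g3 = Gamma ((1 - s + real k) / 2)"
  define gs where "gs = Gamma s"
  have pos: "gs > 0" unfolding gs_def using s by (intro Gamma_real_pos)
  have dup: "g1 * g2 = 2 powr (1 - s) * sqrt pi * gs"
  proof -
    define z where "z = complex_of_real (s / 2)"
    have nz: "z \<notin> \<int>\<^sub>\<le>\<^sub>0" "z + 1 / 2 \<notin> \<int>\<^sub>\<le>\<^sub>0"
      using s by (auto elim!: nonpos_Ints_cases simp: complex_eq_iff z_def)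
    have e: "z + 1 / 2 = complex_of_real ((s + 1) / 2)" "2 * z = complex_of_real s"
      "(1 - complex_of_real s) * of_real (ln 2) = complex_of_real ((1 - s) * ln 2)"
      by (simp_all add: z_def add_divide_distrib)
    have "complex_of_real (Gamma (s / 2)) * complex_of_real (Gamma ((s + 1) / 2)) =
        complex_of_real (exp ((1 - s) * ln 2)) * of_real (sqrt pi) * of_real (Gamma s)"
      using Gamma_legendre_duplication[OF nz] unfolding e unfolding z_def Gamma_complex_of_real exp_of_real .
    hence "Gamma (s / 2) * Gamma ((s + 1) / 2) = exp ((1 - s) * ln 2) * sqrt pi * Gamma s"
      unfolding of_real_mult[symmetric] of_real_eq_iff .
    also have "exp ((1 - s) * ln 2) = 2 powr (1 - s)" by (simp add: powr_def)
    finally have D: "Gamma (s / 2) * Gamma ((s + 1) / 2) = 2 powr (1 - s) * sqrt pi * gs"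
      unfolding gs_def .
    show ?thesis
    proof (cases "k = 0")
      case True
      hence "g1 = Gamma ((s + 1) / 2)" "g2 = Gamma (s / 2)" by (simp_all add: g1_def g2_def u_def)
      thus ?thesis using D by (simp only: mult.commute)
    next
      case False
      hence "k = 1" using k_le by linarith
      hence "g1 = Gamma (s / 2)" "g2 = Gamma ((s + 1) / 2)" by (simp_all add: g1_def g2_def u_def)
      thus ?thesis using D by (simp only:)
    qed
  qed
  have u3: "1 - u / 2 = (1 - s + real k) / 2" by (simp add: u_def field_simps)
  have M: "gauss_sum * (of_real gs * L (of_real s)) = \<i> ^ k * of_real (cc powr (s - 1) * (g1 * g3)) * C.L (of_real (1 - s))"
    using functional_equation_Mellin[OF s] unfolding u_def[symmetric] u3 g1_def g3_def gs_def .
  have "of_real gs * (gauss_sum * (of_real g2 * L (of_real s))) = of_real g2 * (gauss_sum * (of_real gs * L (of_real s)))"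
    by (simp only: mult_ac)
  also have "\<dots> = \<i> ^ k * of_real (cc powr (s - 1) * (g1 * g2) * g3) * C.L (of_real (1 - s))"
    unfolding M of_real_mult by (simp only: mult_ac)
  also have "\<dots> = of_real gs * (\<i> ^ k * of_real (cc powr (s - 1) * 2 powr (1 - s) * sqrt pi * g3) * C.L (of_real (1 - s)))"
    unfolding dup of_real_mult by (simp only: mult_ac)
  finally have E0: "of_real gs * (gauss_sum * (of_real g2 * L (of_real s))) = of_real gs * (\<i> ^ k * of_real (cc powr (s - 1) * 2 powr (1 - s) * sqrt pi * g3) * C.L (of_real (1 - s)))" .
  have "complex_of_real gs \<noteq> 0" using pos by simp
  from mult_left_cancel[OF this, THEN iffD1, OF E0]
  have E: "gauss_sum * (of_real g2 * L (of_real s)) = \<i> ^ k * of_real (cc powr (s - 1) * 2 powr (1 - s) * sqrt pi * g3) * C.L (of_real (1 - s))" .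
  have "of_real ((q / pi) powr (s / 2)) * (gauss_sum * (of_real g2 * L (of_real s))) = \<i> ^ k * of_real ((q / pi) powr (s / 2) * (cc powr (s - 1) * 2 powr (1 - s) * sqrt pi) * g3) * C.L (of_real (1 - s))"
    unfolding E unfolding of_real_mult by (simp only: mult_ac)
  also have "(q / pi) powr (s / 2) * (cc powr (s - 1) * 2 powr (1 - s) * sqrt pi) = sqrt q * (q / pi) powr ((1 - s) / 2)"
  proof -
    define X where "X = real q / pi"
    have X: "X > 0" using q_pi_pos by (simp add: X_def)
    have cX: "cc = 2 / X" by (simp add: X_def)
    have "(2 / X) powr (s - 1) = 2 powr (s - 1) / X powr (s - 1)" by (rule powr_divide)
    also have "\<dots> = 2 powr (s - 1) * X powr (- (s - 1))" by (simp only: powr_minus divide_inverse)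
    finally have cp: "cc powr (s - 1) = 2 powr (s - 1) * X powr (1 - s)" unfolding cX minus_diff_eq .
    have "X powr (s / 2) * (cc powr (s - 1) * 2 powr (1 - s) * sqrt pi) = (X powr (s / 2) * X powr (1 - s)) * (2 powr (s - 1) * 2 powr (1 - s)) * sqrt pi"
      unfolding cp by (simp only: mult_ac)
    also have "2 powr (s - 1) * 2 powr (1 - s) = (1::real)" by (simp add: powr_add[symmetric])
    also have "X powr (s / 2) * X powr (1 - s) = X powr ((1 - s) / 2) * X powr (1/2)"
    proof -
      have "s / 2 + (1 - s) = (1 - s) / 2 + 1 / 2" by (simp add: field_simps)
      thus ?thesis unfolding powr_add[symmetric] by (rule arg_cong)
    qed
    also have "X powr (1/2) = sqrt q / sqrt pi" using X by (simp add: powr_half_sqrt X_def real_sqrt_divide)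
    finally show ?thesis by (simp add: X_def)
  qed
  finally have main: "of_real ((q / pi) powr (s / 2)) * (gauss_sum * (of_real g2 * L (of_real s))) = \<i> ^ k * of_real (sqrt q * (q / pi) powr ((1 - s) / 2) * g3) * C.L (of_real (1 - s))" .
  have gf: "gamma_factor k (of_real t) = of_real ((q / pi) powr (t / 2) * Gamma ((t + real k) / 2))" for t
  proof -
    have "of_real (q / pi) powr (complex_of_real t / 2) = of_real ((q / pi) powr (t / 2))"
      using powr_of_real[of "q / pi" "t / 2"] q_pi_pos by simp
    moreover have "Gamma ((complex_of_real t + of_nat k) / 2) = of_real (Gamma ((t + real k) / 2))"
      using Gamma_complex_of_real[of "(t + real k) / 2"] by simp
    ultimately show ?thesis by (simp only: gamma_factor_def of_real_mult)
  qed
  have "gauss_sum * xi k (of_real s) = of_real ((q / pi) powr (s / 2)) * (gauss_sum * (of_real g2 * L (of_real s)))"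
    unfolding xi_def gf g2_def of_real_mult by (simp only: mult_ac)
  also note main
  also have "\<i> ^ k * of_real (sqrt q * (q / pi) powr ((1 - s) / 2) * g3) * C.L (of_real (1 - s)) = \<i> ^ k * of_real (sqrt q) * C.xi k (of_real (1 - s))"
    unfolding C.xi_def gf g3_def of_real_mult by (simp only: mult_ac)
  finally show ?thesis .
qed

lemma xi_functional_equation:
  assumes s: "0 < Re s" "Re s < 1"
  shows "gauss_sum * xi k s = \<i> ^ k * of_real (sqrt q) * C.xi k (1 - s)"
proof -
  define S where "S = {s. 0 < Re s \<and> Re s < 1}"
  define f where "f s = gauss_sum * xi k s - \<i> ^ k * of_real (sqrt q) * C.xi k (1 - s)" for s
  have S_eq: "S = {s. Re s > 0} \<inter> {s. Re s < 1}" by (auto simp: S_def)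
  have "f s = 0"
  proof (rule analytic_continuation[of f S "of_real ` {0<..<1}" "1/2"])
    have h1: "xi k holomorphic_on S" by (rule holomorphic_on_subset[OF xi_holomorphic]) (auto simp: S_def)
    have "C.xi k \<circ> (\<lambda>s. 1 - s) holomorphic_on S"
      by (rule holomorphic_on_compose_gen[OF _ C.xi_holomorphic]) (auto intro!: holomorphic_intros simp: S_def)
    hence h2: "(\<lambda>s. C.xi k (1 - s)) holomorphic_on S" by (simp add: o_def)
    show "f holomorphic_on S" unfolding f_def by (intro holomorphic_intros h1 h2)
    show "open S" unfolding S_eq by (intro open_Int open_halfspace_Re_gt open_halfspace_Re_lt)
    show "connected S" unfolding S_eq
      by (intro convex_connected convex_Int convex_halfspace_Re_gt convex_halfspace_Re_lt)
    show "complex_of_real ` {0<..<1} \<subseteq> S" by (auto simp: S_def)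
    show "1/2 \<in> S" by (simp add: S_def)
    show "(1/2::complex) islimpt of_real ` {0<..<1}"
      unfolding islimpt_approachable
    proof (intro allI impI)
      fix e :: real assume "e > 0"
      define y where "y = 1/2 + min (e/2) (1/4)"
      have "y \<in> {0<..<1}" "y \<noteq> 1/2" "\<bar>y - 1/2\<bar> < e" using \<open>e > 0\<close> by (auto simp: y_def)
      moreover have "dist (complex_of_real y) (1/2) = \<bar>y - 1/2\<bar>"
        using dist_of_real[of y "1/2", where 'a = complex] by (simp add: dist_real_def)
      moreover have "complex_of_real y \<noteq> 1/2" using \<open>y \<noteq> 1/2\<close> by (auto simp: complex_eq_iff)
      ultimately show "\<exists>x'\<in>complex_of_real ` {0<..<1}. x' \<noteq> 1/2 \<and> dist x' (1/2) < e"
        by (intro bexI[of _ "of_real y"]) auto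
    qed
    show "f z = 0" if "z \<in> of_real ` {0<..<1}" for z
      using that xi_functional_equation_real by (auto simp: f_def)
    show "s \<in> S" using s by (simp add: S_def)
  qed
  thus ?thesis by (simp add: f_def)
qed

definition root_number :: complex where
  "root_number = \<i> ^ k * of_real (sqrt q) / gauss_sum"

lemma norm_root_number: "norm root_number = 1"
  using norm_gauss_sum q_pos by (simp add: root_number_def norm_divide norm_mult norm_power)

text \<open>The series defining \<open>L\<close> reaches only \<open>Re s > 0\<close>. Both branches
  agree on \<open>0 < Re s < 1\<close>, so gluing at \<open>Re s = 0\<close> gives the continuation,
  and that of \<open>L\<close> is recovered from it later.\<close>

definition Lam :: "complex \<Rightarrow> complex" where
  "Lam s = (if Re s > 0 then xi k s else root_number * C.xi k (1 - s))"

lemma Lam_right: "Re s > 0 \<Longrightarrow> Lam s = xi k s"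
  by (simp add: Lam_def)

lemma Lam_left: "Re s < 1 \<Longrightarrow> Lam s = root_number * C.xi k (1 - s)"
proof -
  assume s: "Re s < 1"
  have "gauss_sum \<noteq> 0" using norm_gauss_sum q_pos by auto
  thus ?thesis using xi_functional_equation[of s] s by (auto simp: Lam_def root_number_def field_simps)
qed

lemma Lam_holomorphic: "Lam holomorphic_on UNIV"
proof -
  have "Lam holomorphic_on {s. Re s > 0}"
    by (rule holomorphic_transform[OF xi_holomorphic]) (simp add: Lam_right)
  moreover have "Lam holomorphic_on {s. Re s < 1}"
  proof (rule holomorphic_transform)
    have "C.xi k \<circ> (\<lambda>s. 1 - s) holomorphic_on {s. Re s < 1}"
      by (rule holomorphic_on_compose_gen[OF _ C.xi_holomorphic]) (auto intro!: holomorphic_intros)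
    thus "(\<lambda>s. root_number * C.xi k (1 - s)) holomorphic_on {s. Re s < 1}" by (auto simp: o_def intro!: holomorphic_intros)
  qed (simp add: Lam_left)
  ultimately have "Lam holomorphic_on ({s. Re s > 0} \<union> {s. Re s < 1})"
    by (intro holomorphic_on_Un open_halfspace_Re_gt open_halfspace_Re_lt)
  moreover have "{s. Re s > 0} \<union> {s. Re s < 1} = UNIV" by auto
  ultimately show ?thesis by simp
qed

lemma norm_Lam_reflect: "norm (Lam (1 - cnj s)) = norm (Lam s)"
proof -
  have *: "norm (Lam (1 - cnj s)) = norm (Lam s)" if "Re s < 1" for s
    using that xi_cnj[of "1 - s"] norm_root_number by (simp add: Lam_left[OF that] Lam_right norm_mult)
  show ?thesis
  proof (cases "Re s < 1")
    case False
    thus ?thesis using *[of "1 - cnj s"] by simp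
  qed (rule *)
qed

lemma Lam_nonzero_iff_L:
  assumes "Re s < 1"
  shows "Lam s \<noteq> 0 \<longleftrightarrow> L (1 - cnj s) \<noteq> 0"
proof -
  have r: "Re (1 - cnj s) > 0" using assms by simp
  have "norm (Lam s) = norm (gamma_factor k (1 - cnj s)) * norm (L (1 - cnj s))"
    unfolding norm_Lam_reflect[of s, symmetric] Lam_right[OF r] xi_def norm_mult ..
  thus ?thesis using gamma_factor_nonzero[OF r, of k] by (metis mult_eq_0_iff norm_eq_zero)
qed

lemma Lam_nonzero_left: "Re s < 0 \<Longrightarrow> Lam s \<noteq> 0"
  using L_nonzero_right[of "1 - cnj s"] by (subst Lam_nonzero_iff_L) simp_all

lemma Lam_0_nonzero: "Lam 0 \<noteq> 0"
  by (subst Lam_nonzero_iff_L) (simp_all add: L_1_nonzero)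

text \<open>The reciprocal gamma function is entire, so this expression is holomorphic everywhere
  without a discussion of poles, and uniqueness of the continuation applies.\<close>

lemma Dirichlet_L_eq:
  "Dirichlet_L chi = (\<lambda>s. Lam s * (of_real (q / pi) powr (- s / 2) * rGamma ((s + of_nat k) / 2)))"
proof (rule Dirichlet_L_eqI, unfold is_Dirichlet_L_def, intro conjI allI impI)
  let ?F = "\<lambda>s. Lam s * (of_real (q / pi) powr (- s / 2) * rGamma ((s + of_nat k) / 2))"
  have "?F holomorphic_on UNIV"
    by (intro holomorphic_on_mult Lam_holomorphic holomorphic_on_powr_right holomorphic_rGamma'
        holomorphic_on_divide holomorphic_on_add holomorphic_on_minus holomorphic_on_const holomorphic_on_ident) simp_all
  thus "?F nicely_meromorphic_on UNIV"
    by (intro analytic_on_imp_nicely_meromorphic_on) (simp add: analytic_on_open)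
  fix s :: complex assume s: "Re s > 1"
  have FL: "?F s = L s"
  proof -
    have 1: "of_real (q / pi) powr (s / 2) * of_real (q / pi) powr (- s / 2) = (1::complex)"
      using q_pos by (simp add: powr_add[symmetric])
    have 2: "Gamma ((s + of_nat k) / 2) * rGamma ((s + of_nat k) / 2) = 1"
      using half_not_nonpos_Int[of s k] s by (simp add: Gamma_def rGamma_eq_zero_iff)
    have "a * g * l * (b * r) = l * (a * b) * (g * r)" for a b g l r :: complex by (simp only: mult_ac)
    note 3 = this[of "of_real (q / pi) powr (s / 2)" "Gamma ((s + of_nat k) / 2)" "L s" "of_real (q / pi) powr (- s / 2)" "rGamma ((s + of_nat k) / 2)"]
    have 4: "Lam s = of_real (q / pi) powr (s / 2) * Gamma ((s + of_nat k) / 2) * L s"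
      using s by (simp add: Lam_right xi_def gamma_factor_def)
    show ?thesis unfolding 4 3 unfolding 1 2 by simp
  qed
  have "(\<lambda>n. chi (int n) * of_nat n powr (-s)) sums L s" using s by (intro L_sums) simp
  hence "(\<lambda>n. chi (int (Suc n)) * of_nat (Suc n) powr (-s)) sums L s"
    using sums_Suc_iff[of "\<lambda>n. chi (int n) * of_nat n powr (-s)" "L s"] by (simp add: chi_0)
  moreover have "chi (int (Suc n)) * of_nat (Suc n) powr (-s) = chi (int (Suc n)) / of_nat (Suc n) powr s" for n
    by (simp only: powr_minus divide_inverse)
  ultimately show "(\<lambda>n. chi (int (Suc n)) / of_nat (Suc n) powr s) sums ?F s" unfolding FL by (simp only:)
qed

end

subsection \<open>Monotonicity of the completed function\<close>

lemma norm_le_exp_Im: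
  assumes "\<bar>Re s\<bar> \<le> b"
  shows "norm s \<le> (b + 1) * exp \<bar>Im s\<bar>"
proof -
  have "norm s \<le> \<bar>Re s\<bar> + \<bar>Im s\<bar>" by (rule cmod_le)
  also have "\<dots> \<le> b * exp \<bar>Im s\<bar> + exp \<bar>Im s\<bar>"
  proof (rule add_mono)
    have "b * 1 \<le> b * exp \<bar>Im s\<bar>" using assms by (intro mult_left_mono) auto
    thus "\<bar>Re s\<bar> \<le> b * exp \<bar>Im s\<bar>" using assms by simp
    show "\<bar>Im s\<bar> \<le> exp \<bar>Im s\<bar>" using exp_ge_add_one_self[of "\<bar>Im s\<bar>"] by linarith
  qed
  finally show ?thesis by (simp add: algebra_simps)
qed

lemma Digamma_real_unbounded: "\<exists>x0>0. \<forall>x\<ge>x0. K \<le> Digamma (x::real)"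
proof -
  have "filterlim (\<lambda>n. harm n :: real) at_top sequentially" by (rule harm_at_top)
  hence "eventually (\<lambda>n. harm n \<ge> K + euler_mascheroni) sequentially" by (simp add: filterlim_at_top)
  then obtain n where n: "harm n \<ge> K + euler_mascheroni" by (auto simp: eventually_sequentially)
  have D: "K \<le> Digamma (real (Suc n))" using n Digamma_of_nat[of n, where 'a = real] by simp
  have "K \<le> Digamma x" if "x \<ge> real (Suc n)" for x
    using D Digamma_real_mono[of "real (Suc n)" x] that by simp
  thus ?thesis by (intro exI[of _ "real (Suc n)"]) auto
qed

section \<open>Growth and comparison of the completed function\<close>

context primitive_char_parity
begin

lemma gamma_arg: "(s + of_nat k) / 2 = Complex ((Re s + real k) / 2) (Im s / 2)"
  by (simp add: complex_eq_iff)

text \<open>The gamma factor at real points, a majorant for its modulus on the vertical line through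
  \<open>x\<close>.\<close>

definition real_factor :: "real \<Rightarrow> real" where
  "real_factor x = (q / pi) powr (x / 2) * Gamma ((x + real k) / 2)"

lemma real_factor_pos: "x > 0 \<Longrightarrow> real_factor x > 0"
  unfolding real_factor_def using q_pos by (intro mult_pos_pos Gamma_real_pos) auto

lemma continuous_on_real_factor: "continuous_on {0<..} real_factor"
proof -
  have "continuous_on {0<..} (\<lambda>x. Gamma ((x + real k) / 2))"
    by (rule continuous_on_compose2[OF continuous_on_Gamma[of "{0<..}"]])
       (auto intro!: continuous_intros elim!: nonpos_Ints_cases)
  thus ?thesis unfolding real_factor_def using q_pos by (intro continuous_intros) auto
qed

lemma norm_gamma_factor_le:
  assumes "Re s > 0"
  shows "norm (gamma_factor k s) \<le> real_factor (Re s)"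
proof -
  have "norm (Gamma ((s + of_nat k) / 2)) \<le> Gamma (Re ((s + of_nat k) / 2))"
    using assms by (intro norm_Gamma_le) simp
  thus ?thesis unfolding norm_gamma_factor real_factor_def by (intro mult_left_mono) auto
qed

lemma norm_gamma_factor_ge:
  assumes "Re s \<ge> 1"
  shows "real_factor (Re s) * exp (- pi * \<bar>Im s\<bar>) \<le> norm (gamma_factor k s)"
proof -
  have "Gamma (Re ((s + of_nat k) / 2)) * exp (- pi * \<bar>Im ((s + of_nat k) / 2)\<bar>) \<le> norm (Gamma ((s + of_nat k) / 2))"
    using assms by (intro norm_Gamma_ge) simp
  moreover have "Gamma ((Re s + real k) / 2) * exp (- pi * \<bar>Im s\<bar>) \<le> Gamma ((Re s + real k) / 2) * exp (- pi * \<bar>Im s / 2\<bar>)"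
    using assms by (intro mult_left_mono less_imp_le[OF Gamma_real_pos]) (auto simp: field_simps)
  ultimately have "Gamma ((Re s + real k) / 2) * exp (- pi * \<bar>Im s\<bar>) \<le> norm (Gamma ((s + of_nat k) / 2))"
    by simp
  thus ?thesis unfolding norm_gamma_factor real_factor_def mult.assoc by (intro mult_left_mono) auto
qed

lemma xi_growth:
  assumes b: "b \<ge> 1/2"
  obtains C where "\<And>s. 1/2 \<le> Re s \<Longrightarrow> Re s \<le> b \<Longrightarrow> norm (xi k s) \<le> C * exp \<bar>Im s\<bar>"
proof -
  have "continuous_on {1/2..b} real_factor"
    by (rule continuous_on_subset[OF continuous_on_real_factor]) auto
  hence "\<exists>x\<in>{1/2..b}. \<forall>y\<in>{1/2..b}. real_factor y \<le> real_factor x"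
    by (intro continuous_attains_sup) (use b in auto)
  then obtain x0 where x0: "\<And>x. x \<in> {1/2..b} \<Longrightarrow> real_factor x \<le> real_factor x0" by blast
  define Z where "Z = \<bar>zeta_sum (3/2)\<bar>"
  define R where "R = \<bar>real_factor x0\<bar>"
  have "norm (xi k s) \<le> (R * (real q * (b + 1) * Z)) * exp \<bar>Im s\<bar>" if s: "1/2 \<le> Re s" "Re s \<le> b" for s
  proof -
    have "norm (gamma_factor k s) \<le> R"
      using norm_gamma_factor_le[of s] x0[of "Re s"] s by (simp add: R_def)
    moreover have "norm (L s) \<le> real q * ((b + 1) * exp \<bar>Im s\<bar>) * Z"
    proof -
      have "norm (L s) \<le> real q * norm s * zeta_sum (3/2)" using s(1) by (rule norm_L_growth)
      also have "\<dots> \<le> real q * norm s * Z" by (intro mult_left_mono) (auto simp: Z_def)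
      also have "\<dots> \<le> real q * ((b + 1) * exp \<bar>Im s\<bar>) * Z"
        using norm_le_exp_Im[of s b] s by (intro mult_right_mono mult_left_mono) (auto simp: Z_def)
      finally show ?thesis .
    qed
    ultimately have "norm (xi k s) \<le> R * (real q * ((b + 1) * exp \<bar>Im s\<bar>) * Z)"
      unfolding xi_def norm_mult by (intro mult_mono) (auto simp: R_def)
    thus ?thesis by (simp only: mult_ac)
  qed
  thus ?thesis by (rule that)
qed

text \<open>The reflection keeps |Im s|, so growth on the right half of the symmetric strip
  suffices.\<close>

lemma Lam_growth:
  assumes b: "b \<ge> 1/2"
  obtains C where "\<And>s. 1 - b \<le> Re s \<Longrightarrow> Re s \<le> b \<Longrightarrow> norm (Lam s) \<le> C * exp \<bar>Im s\<bar>"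
proof -
  obtain C where C: "\<And>s. 1/2 \<le> Re s \<Longrightarrow> Re s \<le> b \<Longrightarrow> norm (xi k s) \<le> C * exp \<bar>Im s\<bar>"
    using xi_growth[OF b] by blast
  have "norm (Lam s) \<le> C * exp \<bar>Im s\<bar>" if s: "1 - b \<le> Re s" "Re s \<le> b" for s
  proof (cases "1/2 \<le> Re s")
    case True
    thus ?thesis using C[of s] s by (simp add: Lam_right)
  next
    case False
    hence "norm (Lam (1 - cnj s)) \<le> C * exp \<bar>Im (1 - cnj s)\<bar>"
      using C[of "1 - cnj s"] s by (simp add: Lam_right)
    thus ?thesis unfolding norm_Lam_reflect by simp
  qed
  thus ?thesis by (rule that)
qed

lemma norm_L_ge_right:
  assumes "Re s > 1"
  shows "(Re s - 1) / Re s \<le> norm (L s)"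
proof -
  have "1 \<le> norm (L s) * zeta_sum (Re s)" by (rule L_norm_ge[OF assms])
  also have "\<dots> \<le> norm (L s) * (Re s / (Re s - 1))" by (intro mult_left_mono zeta_sum_le assms) simp
  finally show ?thesis using assms by (simp add: field_simps)
qed

text \<open>Bounds the denominator in \<open>norm_Lam_shift_le\<close>; \<open>a > 1\<close> keeps
  \<open>(x - 1) / x\<close> positive on the compact range of real parts.\<close>

lemma Lam_lower_bound:
  assumes a: "1 < a" "a \<le> A"
  obtains c where "c > 0" "\<And>s. a \<le> Re s \<Longrightarrow> Re s \<le> A \<Longrightarrow> c * exp (- pi * \<bar>Im s\<bar>) \<le> norm (Lam s)"
proof -
  define m where "m x = real_factor x * ((x - 1) / x)" for x
  have "continuous_on {a..A} m"
    unfolding m_def using a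
    by (intro continuous_intros continuous_on_subset[OF continuous_on_real_factor]) auto
  then obtain x0 where x0: "x0 \<in> {a..A}" "\<And>x. x \<in> {a..A} \<Longrightarrow> m x0 \<le> m x"
    using continuous_attains_inf[of "{a..A}" m] a by auto
  have "m x0 > 0" unfolding m_def using x0 a by (intro mult_pos_pos real_factor_pos divide_pos_pos) auto
  moreover have "m x0 * exp (- pi * \<bar>Im s\<bar>) \<le> norm (Lam s)" if s: "a \<le> Re s" "Re s \<le> A" for s
  proof -
    have "m x0 * exp (- pi * \<bar>Im s\<bar>) \<le> m (Re s) * exp (- pi * \<bar>Im s\<bar>)"
      using x0(2)[of "Re s"] s by (intro mult_right_mono) auto
    also have "\<dots> = (real_factor (Re s) * exp (- pi * \<bar>Im s\<bar>)) * ((Re s - 1) / Re s)"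
      by (simp add: m_def)
    also have "\<dots> \<le> norm (gamma_factor k s) * norm (L s)"
      using s a by (intro mult_mono norm_gamma_factor_ge norm_L_ge_right) auto
    also have "\<dots> = norm (Lam s)" using s a by (simp add: Lam_right xi_def norm_mult)
    finally show ?thesis .
  qed
  ultimately show ?thesis by (rule that)
qed

text \<open>To the right of 2 the values of \<open>L\<close> lie between 1/2 and 2 in modulus, so a
  factor 4 from the gamma factor is enough. A digamma function of at least 4 over a distance
  \<open>d / 2\<close> yields \<open>exp (2 * d) \<ge> 4\<close>, and \<open>q / pi \<ge> 1\<close>
  makes the power monotone. The threshold on \<open>Re s\<close> ensures that the shifted point
  still has real part at least \<open>2 + 2 * x0\<close>.\<close>

lemma norm_Lam_le_far_right:
  assumes q4: "q \<ge> 4" and d: "d \<ge> 1"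
  obtains A0 where "\<And>s. Re s \<ge> A0 \<Longrightarrow> norm (Lam (s - of_real d)) \<le> norm (Lam s)"
proof -
  obtain x0 :: real where x0: "x0 > 0" "\<And>x. x \<ge> x0 \<Longrightarrow> 4 \<le> Digamma x"
    using Digamma_real_unbounded[of 4] by blast
  have "norm (Lam (s - of_real d)) \<le> norm (Lam s)" if s: "Re s \<ge> 2 + 2 * x0 + d" for s
  proof -
    define t where "t = s - of_real d"
    have t: "Re t \<ge> 2 + 2 * x0" "Re s \<ge> 2" "Im t = Im s" "Re t = Re s - d" using s d x0(1) by (auto simp: t_def)
    have z2: "zeta_sum x \<le> 2" if "x \<ge> 2" for x
    proof -
      have "zeta_sum x \<le> x / (x - 1)" using that by (intro zeta_sum_le) auto
      also have "\<dots> \<le> 2" using that by (simp add: field_simps)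
      finally show ?thesis .
    qed
    have Lt: "norm (L t) \<le> 2" using norm_L_le_zeta_sum[of t] z2[of "Re t"] t x0(1) by simp
    have Ls: "1/2 \<le> norm (L s)"
    proof -
      have "(Re s - 1) / Re s \<le> norm (L s)" using t by (intro norm_L_ge_right) auto
      moreover have "1/2 \<le> (Re s - 1) / Re s" using t by (simp add: field_simps)
      ultimately show ?thesis by linarith
    qed
    have G: "4 * norm (gamma_factor k t) \<le> norm (gamma_factor k s)"
    proof -
      have "exp (4 * ((Re s + real k) / 2) - 4 * ((Re t + real k) / 2)) * norm (Gamma (Complex ((Re t + real k) / 2) (Im s / 2)))
         \<le> norm (Gamma (Complex ((Re s + real k) / 2) (Im s / 2)))"
      proof (rule norm_Gamma_ratio_ge[where k = "\<lambda>_. 4"])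
        show "0 < (Re t + real k) / 2" "(Re t + real k) / 2 \<le> (Re s + real k) / 2" using t x0 d by auto
        fix x assume x: "(Re t + real k) / 2 \<le> x"
        have "x \<ge> x0" using x t by simp
        thus "4 \<le> Re (Digamma (Complex x (Im s / 2)))"
          using x0 Re_Digamma_ge[of "Complex x (Im s / 2)"] by (smt (verit) complex.sel(1))
        show "((\<lambda>x. 4 * x) has_real_derivative 4) (at x)" by (auto intro!: derivative_eq_intros)
      qed
      moreover have "4 * ((Re s + real k) / 2) - 4 * ((Re t + real k) / 2) = 2 * d" using t by (simp add: field_simps)
      ultimately have e: "exp (2 * d) * norm (Gamma ((t + of_nat k) / 2)) \<le> norm (Gamma ((s + of_nat k) / 2))"
        unfolding gamma_arg using t by simp
      have "4 \<le> exp (2 * d)"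
      proof -
        have "(2::real) \<le> exp 1" using exp_ge_add_one_self[of 1] by simp
        hence "2 * 2 \<le> exp 1 * exp (1::real)" by (intro mult_mono) auto
        also have "\<dots> = exp 2" by (simp add: exp_add[symmetric])
        also have "exp 2 \<le> exp (2 * d)" using d by simp
        finally show ?thesis by simp
      qed
      hence "4 * norm (Gamma ((t + of_nat k) / 2)) \<le> norm (Gamma ((s + of_nat k) / 2))"
        using e by (meson mult_right_mono norm_ge_zero order_trans)
      moreover have "(q / pi) powr (Re t / 2) \<le> (q / pi) powr (Re s / 2)"
      proof (rule powr_mono)
        have "pi \<le> 4" using pi_less_4 by simp
        thus "1 \<le> real q / pi" using q4 by (simp add: field_simps)
      qed (use t d in simp)
      ultimately have "(q / pi) powr (Re t / 2) * (4 * norm (Gamma ((t + of_nat k) / 2))) \<le> (q / pi) powr (Re s / 2) * norm (Gamma ((s + of_nat k) / 2))"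
        by (intro mult_mono) auto
      thus ?thesis unfolding norm_gamma_factor by simp
    qed
    have "norm (Lam t) = norm (gamma_factor k t) * norm (L t)" using t x0 by (simp add: Lam_right xi_def norm_mult)
    also have "\<dots> \<le> norm (gamma_factor k t) * 2" by (intro mult_left_mono Lt) auto
    also have "\<dots> = (4 * norm (gamma_factor k t)) * (1/2)" by simp
    also have "\<dots> \<le> norm (gamma_factor k s) * norm (L s)" by (intro mult_mono G Ls) auto
    also have "\<dots> = norm (Lam s)" using t by (simp add: Lam_right xi_def norm_mult)
    finally show ?thesis by (simp add: t_def)
  qed
  thus ?thesis by (rule that)
qed

lemma norm_Lam_shift_le:
  assumes q4: "q \<ge> 4" and a: "a > 1" and s: "Re s \<ge> a"
  shows "norm (Lam (s - of_real (2 * a - 1))) \<le> norm (Lam s)"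
proof -
  \<comment> \<open>The shift that takes the line Re z = a to its own reflection: there
    \<open>z - of_real d = 1 - cnj z\<close>.\<close>
  define d where "d = 2 * a - 1"
  have d: "d \<ge> 1" using a by (simp add: d_def)
  obtain A0 where A0: "\<And>s. Re s \<ge> A0 \<Longrightarrow> norm (Lam (s - of_real d)) \<le> norm (Lam s)"
    using norm_Lam_le_far_right[OF q4 d] by blast
  \<comment> \<open>The right edge depends on \<open>s\<close>: it must not lie to the left of
    \<open>s\<close>, and it must be in the range of the far-right comparison.\<close>
  define A where "A = max A0 (Re s)"
  have A: "a \<le> A" "Re s \<le> A" "A0 \<le> A" using s by (auto simp: A_def)
  obtain c where c: "c > 0" "\<And>s. a \<le> Re s \<Longrightarrow> Re s \<le> A \<Longrightarrow> c * exp (- pi * \<bar>Im s\<bar>) \<le> norm (Lam s)"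
    using Lam_lower_bound[OF a A(1)] by blast
  obtain C where C: "\<And>s. 1 - A \<le> Re s \<Longrightarrow> Re s \<le> A \<Longrightarrow> norm (Lam s) \<le> C * exp \<bar>Im s\<bar>"
    using Lam_growth[of A] a A by auto
  have nz: "Lam z \<noteq> 0" if "Re z > 1" for z
    using that gamma_factor_nonzero[of z k] L_nonzero_right[of z] by (simp add: Lam_right xi_def)
  have "norm (Lam (s - of_real d) / Lam s) \<le> 1"
  proof (rule Phragmen_Lindelof_strip[where f = "\<lambda>s. Lam (s - of_real d) / Lam s" and s = s and U = "{s. Re s > 1}" and a = a and b = A and C = "C / c" and D = "1 + pi"])
    have "Lam \<circ> (\<lambda>s. s - of_real d) holomorphic_on {s. Re s > 1}"
      by (rule holomorphic_on_compose_gen[OF _ Lam_holomorphic]) (auto intro!: holomorphic_intros)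
    thus "(\<lambda>s. Lam (s - of_real d) / Lam s) holomorphic_on {s. Re s > 1}"
      using nz by (intro holomorphic_on_divide holomorphic_on_subset[OF Lam_holomorphic]) (auto simp: o_def)
    show "open {s. Re s > 1}" by (rule open_halfspace_Re_gt)
    show "{s. a \<le> Re s \<and> Re s \<le> A} \<subseteq> {s. Re s > 1}" using a by auto
    show "a \<le> Re s" "Re s \<le> A" using s A by auto
    show "norm (Lam (z - of_real d) / Lam z) \<le> C / c * exp ((1 + pi) * \<bar>Im z\<bar>)" if z: "a \<le> Re z" "Re z \<le> A" for z
    proof -
      have n: "norm (Lam (z - of_real d)) \<le> C * exp \<bar>Im z\<bar>"
        using C[of "z - of_real d"] z a A by (simp add: d_def)
      have "norm (Lam (z - of_real d) / Lam z) = norm (Lam (z - of_real d)) / norm (Lam z)" by (rule norm_divide)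
      also have "\<dots> \<le> (C * exp \<bar>Im z\<bar>) / (c * exp (- pi * \<bar>Im z\<bar>))"
        using n c(1) c(2)[OF z] by (intro frac_le order_trans[OF norm_ge_zero n]) auto
      also have "\<dots> = C / c * exp ((1 + pi) * \<bar>Im z\<bar>)"
        using c(1) by (simp add: exp_add exp_minus distrib_right divide_simps)
      finally show ?thesis .
    qed
    show "norm (Lam (z - of_real d) / Lam z) \<le> 1" if z: "Re z = a \<or> Re z = A" for z
    proof -
      have "norm (Lam (z - of_real d)) \<le> norm (Lam z)" using z
      proof
        assume "Re z = a"
        hence "z - of_real d = 1 - cnj z" by (simp add: complex_eq_iff d_def)
        thus ?thesis by (simp only: norm_Lam_reflect)
      next
        assume "Re z = A"
        thus ?thesis using A0[of z] A by simp
      qed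
      moreover have "norm (Lam z) > 0" using z a A nz[of z] by auto
      ultimately show ?thesis by (simp add: norm_divide)
    qed
  qed
  moreover have "norm (Lam s) > 0" using s a nz[of s] by auto
  ultimately show ?thesis by (simp add: norm_divide d_def)
qed

lemma norm_Lam_antimono_left:
  assumes q4: "q \<ge> 4" and "x < y" "y \<le> 0"
  shows "norm (Lam (Complex y t)) \<le> norm (Lam (Complex x t))"
proof -
  \<comment> \<open>With this \<open>a\<close> the shift \<open>2 * a - 1\<close> takes the
    reflected abscissa \<open>1 - x\<close> to \<open>y\<close>.\<close>
  define a where "a = 1 - (x + y) / 2"
  have "a > 1" using assms by (simp add: a_def)
  have "norm (Lam (Complex (1 - x) t - of_real (2 * a - 1))) \<le> norm (Lam (Complex (1 - x) t))"
    using assms by (intro norm_Lam_shift_le q4 \<open>a > 1\<close>) (simp add: a_def field_simps)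
  moreover have "Complex (1 - x) t - of_real (2 * a - 1) = Complex y t" by (simp add: complex_eq_iff a_def field_simps)
  moreover have "Complex (1 - x) t = 1 - cnj (Complex x t)" by (simp add: complex_eq_iff)
  ultimately show ?thesis by (simp only: norm_Lam_reflect)
qed

lemma Lam_has_derivative: "(Lam has_field_derivative deriv Lam s) (at s)"
  using Lam_holomorphic by (intro holomorphic_derivI) auto

lemma Lam_horizontal_derivative:
  "((\<lambda>x. Lam (Complex x t)) has_vector_derivative deriv Lam (Complex x t)) (at x)"
proof -
  have "((\<lambda>x. of_real x + \<i> * of_real t) has_vector_derivative (1::complex)) (at x)"
    by (auto intro!: derivative_eq_intros)
  hence "((\<lambda>x. Complex x t) has_vector_derivative 1) (at x)" by (simp add: Complex_eq)
  from field_vector_diff_chain_at[OF this Lam_has_derivative]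
  show ?thesis by (simp add: o_def)
qed

text \<open>The left side is half the horizontal derivative of \<open>|Lam|\<^sup>2\<close>; a
  positive value would contradict \<open>norm_Lam_antimono_left\<close>. As nothing is divided by
  \<open>Lam\<close>, zeros are allowed.\<close>

lemma Re_cnj_Lam_deriv_nonpos:
  assumes q4: "q \<ge> 4" and s: "Re s \<le> 0"
  shows "Re (cnj (Lam s) * deriv Lam s) \<le> 0"
proof (rule ccontr)
  assume neg: "\<not> ?thesis"
  define x where "x = Re s"
  define t where "t = Im s"
  define D where "D = deriv Lam s"
  have sc: "s = Complex x t" by (simp add: x_def t_def)
  let ?\<phi> = "\<lambda>x. (Re (Lam (Complex x t)))^2 + (Im (Lam (Complex x t)))^2"
  have v: "((\<lambda>x. Lam (Complex x t)) has_vector_derivative D) (at x)"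
    using Lam_horizontal_derivative[of t x] by (simp add: D_def sc)
  have R: "((\<lambda>x. Re (Lam (Complex x t))) has_real_derivative Re D) (at x)"
    and I: "((\<lambda>x. Im (Lam (Complex x t))) has_real_derivative Im D) (at x)"
    using bounded_linear.has_vector_derivative[OF bounded_linear_Re v] bounded_linear.has_vector_derivative[OF bounded_linear_Im v]
    by (simp_all add: has_real_derivative_iff_has_vector_derivative)
  have "(?\<phi> has_real_derivative (2 * Re (cnj (Lam s) * D))) (at x)"
    by (rule DERIV_cong[OF DERIV_add[OF DERIV_power[OF R, of 2] DERIV_power[OF I, of 2]]])
       (simp add: sc algebra_simps)
  moreover have "2 * Re (cnj (Lam s) * D) > 0" using neg by (simp add: D_def)
  ultimately obtain d where d: "d > 0" "\<And>h. 0 < h \<Longrightarrow> h < d \<Longrightarrow> ?\<phi> (x - h) < ?\<phi> x"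
    using DERIV_pos_inc_left by blast
  have "?\<phi> (x - d/2) < ?\<phi> x" using d by simp
  hence "(norm (Lam (Complex (x - d/2) t)))^2 < (norm (Lam (Complex x t)))^2" by (simp only: cmod_power2)
  hence "norm (Lam (Complex (x - d/2) t)) < norm (Lam (Complex x t))" by (rule power2_less_imp_less) simp
  moreover have "norm (Lam (Complex x t)) \<le> norm (Lam (Complex (x - d/2) t))"
    using d(1) s by (intro norm_Lam_antimono_left q4) (auto simp: x_def)
  ultimately show False by simp
qed

lemma Re_Lam_log_deriv_nonpos:
  assumes "q \<ge> 4" "Re s \<le> 0" "Lam s \<noteq> 0"
  shows "Re (deriv Lam s / Lam s) \<le> 0"
proof -
  have "deriv Lam s / Lam s = (cnj (Lam s) * deriv Lam s) / of_real ((norm (Lam s))^2)"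
    unfolding complex_norm_square using assms(3) by (simp add: field_simps)
  thus ?thesis using Re_cnj_Lam_deriv_nonpos[OF assms(1,2)] by (simp add: divide_nonpos_nonneg)
qed

text \<open>On the line \<open>Re s = 1\<close> a multiple zero is excluded by \<open>|L s| \<ge> (Re s - 1) / Re s\<close> to its right.\<close>

lemma Lam_zero_simple:
  assumes s: "Re s = 0" "Lam s = 0"
  shows "deriv Lam s \<noteq> 0"
proof
  assume D0: "deriv Lam s = 0"
  define t where "t = Im s"
  have sc: "s = Complex 0 t" using s by (simp add: t_def complex_eq_iff)
  have op: "open {s. Re s > 0}" by (rule open_halfspace_Re_gt)
  have lim0: "filterlim (\<lambda>x. complex_of_real (-x)) (at 0) (at_right 0)"
    by (intro filterlim_atI) (auto intro!: tendsto_eq_intros simp: eventually_at_filter)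
  have "((\<lambda>h. Lam (s + h) / h) \<longlongrightarrow> 0) (at 0)"
    using Lam_has_derivative[of s] by (simp add: DERIV_def s D0)
  from filterlim_compose[OF this lim0]
  have "((\<lambda>x. (1 + x) * norm (Lam (s + of_real (-x)) / of_real (-x))) \<longlongrightarrow> (1 + 0) * norm (0::complex)) (at_right 0)"
    by (intro tendsto_intros)
  hence lim: "((\<lambda>x. (1 + x) * norm (Lam (s + of_real (-x)) / of_real (-x))) \<longlongrightarrow> 0) (at_right 0)" by simp
  have "isCont (gamma_factor k) (Complex 1 t)"
    using holomorphic_on_imp_continuous_on[OF gamma_factor_holomorphic] op
    by (auto simp: continuous_on_eq_continuous_at)
  moreover have "((\<lambda>x. Complex (1 + x) t) \<longlongrightarrow> Complex (1 + 0) t) (at_right 0)"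
    by (intro tendsto_intros)
  ultimately have lim2: "((\<lambda>x. norm (gamma_factor k (Complex (1 + x) t))) \<longlongrightarrow> norm (gamma_factor k (Complex 1 t))) (at_right 0)"
    by (intro tendsto_norm isCont_tendsto_compose[where g = "gamma_factor k"]) simp_all
  have "eventually (\<lambda>x. norm (gamma_factor k (Complex (1 + x) t)) \<le> (1 + x) * norm (Lam (s + of_real (-x)) / of_real (-x))) (at_right 0)"
    using eventually_at_right_less[of "0::real"]
  proof eventually_elim
    case (elim x)
    define w where "w = Complex (1 + x) t"
    have "w = 1 - cnj (s + of_real (-x))" by (simp add: complex_eq_iff w_def sc)
    hence "norm (Lam (s + of_real (-x))) = norm (Lam w)" by (simp only: norm_Lam_reflect)
    also have "\<dots> = norm (gamma_factor k w) * norm (L w)" using elim by (simp add: w_def Lam_right xi_def norm_mult)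
    also have "\<dots> \<ge> norm (gamma_factor k w) * (x / (1 + x))"
      using norm_L_ge_right[of w] elim by (intro mult_left_mono) (simp_all add: w_def)
    finally have "norm (gamma_factor k w) * (x / (1 + x)) \<le> norm (Lam (s + of_real (-x)))" .
    thus ?case using elim by (simp add: w_def norm_divide field_simps)
  qed
  hence "norm (gamma_factor k (Complex 1 t)) \<le> 0"
    by (intro tendsto_le[OF _ lim lim2]) auto
  moreover have "gamma_factor k (Complex 1 t) \<noteq> 0" by (rule gamma_factor_nonzero) simp
  ultimately show False by simp
qed

end

subsection \<open>Zeros of the derivative\<close>

lemma pi_less: "pi < 79 / 25"
proof -
  \<comment> \<open>Machin's formula asks for an upper bound of arctan(1/5), taken from the Taylor
    polynomial, and a lower bound of arctan(1/239), for which 0 is enough.\<close>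
  have "arctan (1/5) \<le> 1/5 - (1/5)^3 / 3 + (1/5)^5 / (5::real)"
  proof -
    let ?f = "\<lambda>x::real. x - x^3 / 3 + x^5 / 5 - arctan x"
    have "?f 0 \<le> ?f (1/5)"
    proof (rule DERIV_nonneg_imp_nondecreasing[of 0 "1/5" ?f])
      fix x :: real
      have p: "1 + x^2 > 0" by (rule add_pos_nonneg) auto
      have "(?f has_real_derivative (1 - x^2 + x^4 - inverse (1 + x^2))) (at x)"
        by (auto intro!: derivative_eq_intros)
      moreover have "1 - x^2 + x^4 - inverse (1 + x^2) = x^6 / (1 + x^2)"
      proof -
        have "(1 - x^2 + x^4) * (1 + x^2) = 1 + x^6" by (simp add: algebra_simps flip: power_add)
        hence "1 - x^2 + x^4 = (1 + x^6) / (1 + x^2)" using p by (simp add: eq_divide_eq)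
        thus ?thesis by (simp add: inverse_eq_divide diff_divide_distrib[symmetric])
      qed
      ultimately show "\<exists>y. (?f has_real_derivative y) (at x) \<and> 0 \<le> y" using p by (auto intro!: exI[of _ "x^6 / (1 + x^2)"])
    qed simp
    thus ?thesis by simp
  qed
  hence "arctan (1/5) \<le> (9253 / 46875 :: real)" by (simp add: power_numeral_reduce)
  moreover have "arctan (1/239) \<ge> 0" by simp
  ultimately show ?thesis using machin by linarith
qed

text \<open>The inequality (1 - x/32)^32 \<le> exp(-x) at x = 13/22, where 704 = 32 * 22. The number
  13/22 is an upper bound for \<gamma>.\<close>

lemma exp_13_22_less: "exp (13/22 :: real) < 1817 / 1000"
proof -
  have "1 - 13/704 \<le> exp (- (13/704) :: real)" using exp_ge_add_one_self[of "- (13/704)"] by simp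
  hence "(1 - 13/704) ^ 32 \<le> exp (- (13/704) :: real) ^ 32" by (intro power_mono) auto
  also have "\<dots> = exp (- (13/22))" by (simp add: exp_of_nat_mult[symmetric])
  finally have 1: "(1 - 13/704) ^ 32 \<le> exp (- (13/22) :: real)" .
  have "1000 / 1817 < (1 - 13/704 :: real) ^ 32" by (simp add: power_divide)
  with 1 have "1000 / 1817 < exp (- (13/22) :: real)" by linarith
  thus ?thesis by (simp add: exp_minus field_simps)
qed

lemma exp_less_imp_less_ln: "exp x < y \<Longrightarrow> x < ln y" for x y :: real
  using ln_less_cancel_iff[of "exp x" y] less_trans[OF exp_gt_zero, of x y] by simp

text \<open>The binding requirement is 23/4: four times this value must stay below 23, the 4 being
  \<open>exp (2 * ln 2)\<close>. The requirement 7 leaves ample room.\<close>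

lemma pi_exp_13_22_less: "pi * exp (13/22) < 5742 / 1000"
proof -
  have "pi * exp (13/22) < 79 / 25 * (1817 / 1000)"
    using pi_less exp_13_22_less by (intro mult_strict_mono) auto
  thus ?thesis by simp
qed

lemma euler_mascheroni_less_ln_quotient:
  assumes "q \<ge> 7"
  shows "euler_mascheroni < ln (real q / pi)"
proof -
  have "exp (13/22 :: real) < 7 / pi" using pi_exp_13_22_less by (simp add: pos_less_divide_eq mult.commute)
  also have "7 / pi \<le> real q / pi" using assms by (simp add: divide_right_mono)
  finally have "13/22 < ln (real q / pi)" by (rule exp_less_imp_less_ln)
  thus ?thesis using euler_mascheroni_less_13_over_22 by simp
qed

lemma minus_Digamma_half_less_ln_quotient:
  assumes "q \<ge> 23"
  shows "- Digamma (1/2) < ln (real q / pi)"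
proof -
  have "4 * exp (13/22 :: real) < 23 / pi" using pi_exp_13_22_less by (simp add: pos_less_divide_eq mult_ac)
  also have "23 / pi \<le> real q / pi" using assms by (simp add: divide_right_mono)
  also have "4 * exp (13/22) = exp (2 * ln 2 + 13/22 :: real)"
  proof -
    have "exp (2 * ln 2 + 13/22 :: real) = exp (ln 2 + ln 2) * exp (13/22)" by (simp only: exp_add mult_2)
    also have "exp (ln 2 + ln 2) = (4::real)" unfolding exp_add by simp
    finally show ?thesis ..
  qed
  finally have "2 * ln 2 + 13/22 < ln (real q / pi)" by (rule exp_less_imp_less_ln)
  thus ?thesis using euler_mascheroni_less_13_over_22 by (simp add: Digamma_one_half)
qed

lemma not_nonpos_Int_strip:
  fixes z :: complex
  assumes "-1 < Re z" "z \<noteq> 0"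
  shows "z \<notin> \<int>\<^sub>\<le>\<^sub>0"
proof
  assume "z \<in> \<int>\<^sub>\<le>\<^sub>0"
  then obtain n where "z = - of_nat n" by (elim nonpos_Ints_cases')
  thus False using assms by (cases n) auto
qed

text \<open>Rouche's theorem counts zeros with multiplicity and winding number. The latter is 1 in
  the box and 0 outside the rectangle, and no zero of the sum lies on the boundary. As every order
  is at least 1, a total of 1 forces a single zero.\<close>

lemma Rouche_rectangle_unique_zero:
  assumes U: "open U" "connected U" "cbox a b \<subseteq> U" and ab: "Re a < Re b" "Im a < Im b"
    and hol: "f holomorphic_on U" "g holomorphic_on U"
    and fin: "finite {z \<in> U. f z + g z = 0}"
    and p: "p \<in> box a b" "zorder f p = 1" "{z \<in> U. f z = 0} = {p}"
    and less: "\<And>z. z \<in> path_image (rectpath a b) \<Longrightarrow> norm (g z) < norm (f z)"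
  shows "\<exists>!z. z \<in> box a b \<and> f z + g z = 0"
proof -
  define F where "F = (\<lambda>z. f z + g z)"
  define Z where "Z = {z \<in> U. F z = 0}"
  define Z' where "Z' = {z \<in> box a b. F z = 0}"
  have fZ: "finite Z" using fin by (simp add: Z_def F_def)
  have Z'Z: "Z' \<subseteq> Z" using U(3) box_subset_cbox[of a b] by (auto simp: Z'_def Z_def)
  have FU: "F holomorphic_on U" unfolding F_def by (intro holomorphic_intros hol)
  have "(\<Sum>z\<in>Z. winding_number (rectpath a b) z * zorder F z) = (\<Sum>z\<in>{z \<in> U. f z = 0}. winding_number (rectpath a b) z * zorder f z)"
    unfolding Z_def F_def
  proof (rule Rouche_theorem)
    show "\<forall>z. z \<notin> U \<longrightarrow> winding_number (rectpath a b) z = 0"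
      using U(3) ab by (auto intro!: winding_number_rectpath_outside)
    show "path_image (rectpath a b) \<subseteq> U"
      using path_image_rectpath_subset_cbox[of a b] ab U(3) by auto
  qed (use U hol fin p less in auto)
  also have "\<dots> = 1" using p(1,2) by (simp add: p(3) winding_number_rectpath)
  also have "(\<Sum>z\<in>Z. winding_number (rectpath a b) z * zorder F z) = (\<Sum>z\<in>Z'. of_int (zorder F z))"
  proof (rule sum.mono_neutral_cong_right[OF fZ Z'Z])
    show "\<forall>z\<in>Z - Z'. winding_number (rectpath a b) z * zorder F z = 0"
    proof
      fix z assume z: "z \<in> Z - Z'"
      hence "z \<notin> box a b" "F z = 0" by (auto simp: Z_def Z'_def)
      have "z \<notin> path_image (rectpath a b)"
      proof
        assume "z \<in> path_image (rectpath a b)"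
        moreover have "f z = - g z" using \<open>F z = 0\<close> by (simp add: F_def eq_neg_iff_add_eq_0)
        ultimately show False using less[of z] by simp
      qed
      hence "z \<notin> cbox a b"
        using \<open>z \<notin> box a b\<close> ab by (auto simp: path_image_rectpath_cbox_minus_box)
      hence "winding_number (rectpath a b) z = 0" using ab by (intro winding_number_rectpath_outside) auto
      thus "winding_number (rectpath a b) z * zorder F z = 0" by simp
    qed
    show "winding_number (rectpath a b) z * of_int (zorder F z) = of_int (zorder F z)" if "z \<in> Z'" for z
      using that by (simp add: Z'_def winding_number_rectpath)
  qed
  finally have "complex_of_int (\<Sum>z\<in>Z'. zorder F z) = of_int 1" by simp
  hence sum1: "(\<Sum>z\<in>Z'. zorder F z) = 1" by (simp only: of_int_eq_iff)
  \<comment> \<open>The finitely many zeros are isolated, so \<open>F\<close> is not locally zero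
    and each order is positive.\<close>
  have pos: "zorder F z \<ge> 1" if z: "z \<in> Z'" for z
  proof -
    have zU: "z \<in> U" "F z = 0" using z Z'Z by (auto simp: Z_def)
    have "open (U - (Z - {z}))" using fZ by (intro open_Diff U finite_imp_closed) auto
    hence "eventually (\<lambda>w. w \<in> U - (Z - {z}) - {z}) (at z)" using zU by (intro eventually_at_in_open) auto
    hence "eventually (\<lambda>w. F w \<noteq> 0) (at z)" by eventually_elim (auto simp: Z_def)
    hence "frequently (\<lambda>w. F w \<noteq> 0) (at z)" by (intro eventually_frequently) auto
    hence "zorder F z > 0" using zorder_pos_iff[OF FU U(1) zU(1)] zU(2) by blast
    thus ?thesis by simp
  qed
  have fZ': "finite Z'" using Z'Z fZ by (rule finite_subset)
  have "int (card Z') \<le> (\<Sum>z\<in>Z'. zorder F z)"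
    using sum_mono[of Z' "\<lambda>_. 1" "zorder F"] pos by simp
  moreover have "Z' \<noteq> {}" using sum1 by auto
  ultimately have "card Z' = 1" using sum1 fZ' by (metis One_nat_def card_gt_0_iff le_antisym Suc_leI of_nat_le_1_iff)
  then obtain z where "Z' = {z}" by (auto simp: card_1_singleton_iff)
  hence "z' \<in> Z' \<longleftrightarrow> z' = z" for z' by simp
  thus ?thesis unfolding Z'_def F_def mem_Collect_eq by (intro ex1I[of _ z]) simp_all
qed

section \<open>Logarithmic derivatives in the two strips\<close>

context primitive_char_parity
begin

text \<open>The product rule without division by \<open>Lam\<close>, so that zeros of
  \<open>Lam\<close> are covered.\<close>

lemma Dirichlet_L_has_derivative:
  assumes "(s + of_nat k) / 2 \<notin> \<int>\<^sub>\<le>\<^sub>0"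
  shows "(Dirichlet_L chi has_field_derivative
    (of_real (q / pi) powr (- s / 2) * rGamma ((s + of_nat k) / 2)) *
      (deriv Lam s - Lam s * (of_real (ln (q / pi)) / 2 + Digamma ((s + of_nat k) / 2) / 2))) (at s)"
proof -
  have P: "((\<lambda>s. of_real (q / pi) powr (- s / 2)) has_field_derivative
     (of_real (q / pi) powr (- s / 2) * (- of_real (ln (q / pi)) / 2))) (at s)"
  proof -
    have "((\<lambda>s. of_real (q / pi) powr (- s / 2)) has_field_derivative
       (Ln (of_real (q / pi)) * of_real (q / pi) powr (- s / 2) * (- 1 / 2))) (at s)"
      by (rule DERIV_chain2[OF has_field_derivative_powr_right])
         (use q_pos in \<open>auto intro!: derivative_eq_intros\<close>)
    moreover have "Ln (of_real (q / pi)) = complex_of_real (ln (q / pi))"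
      by (rule Ln_of_real) (use q_pos in simp)
    ultimately show ?thesis by (simp only: mult_ac) simp
  qed
  have G: "((\<lambda>s. rGamma ((s + of_nat k) / 2)) has_field_derivative
     (- rGamma ((s + of_nat k) / 2) * Digamma ((s + of_nat k) / 2) * (1 / 2))) (at s)"
    by (rule DERIV_chain2[where f = rGamma and g = "\<lambda>s. (s + of_nat k) / 2",
          OF has_field_derivative_rGamma_no_nonpos_int[OF assms]])
       (auto intro!: derivative_eq_intros)
  show ?thesis unfolding Dirichlet_L_eq
    by (rule DERIV_cong[OF DERIV_mult[OF Lam_has_derivative DERIV_mult[OF P G]]]) (simp add: algebra_simps)
qed

text \<open>Where \<open>Lam s \<noteq> 0\<close>, the bracket divided by \<open>Lam s\<close> has
  negative real part. A zero of \<open>Lam\<close> with \<open>Re s \<le> 0\<close> lies on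
  \<open>Re s = 0\<close> and is simple, so there the bracket is
  \<open>deriv Lam s \<noteq> 0\<close>.\<close>

lemma deriv_Dirichlet_L_nonzero:
  assumes q4: "q \<ge> 4" and s: "Re s \<le> 0" "(s + of_nat k) / 2 \<notin> \<int>\<^sub>\<le>\<^sub>0"
    and D: "- Re (Digamma ((s + of_nat k) / 2)) < ln (q / pi)"
  shows "deriv (Dirichlet_L chi) s \<noteq> 0"
proof -
  define E where "E = deriv Lam s - Lam s * (of_real (ln (q / pi)) / 2 + Digamma ((s + of_nat k) / 2) / 2)"
  have "E \<noteq> 0"
  proof (cases "Lam s = 0")
    case True
    hence "Re s = 0" using Lam_nonzero_left[of s] s(1) by force
    thus ?thesis using Lam_zero_simple[of s] True by (simp add: E_def)
  next
    case False
    hence "Re (E / Lam s) = Re (deriv Lam s / Lam s) - (ln (q / pi) / 2 + Re (Digamma ((s + of_nat k) / 2)) / 2)"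
      by (simp add: E_def diff_divide_distrib)
    also have "\<dots> < 0" using Re_Lam_log_deriv_nonpos[OF q4 s(1) False] D by simp
    finally show ?thesis by auto
  qed
  moreover have "deriv (Dirichlet_L chi) s = (of_real (q / pi) powr (- s / 2) * rGamma ((s + of_nat k) / 2)) * E"
    unfolding E_def by (rule DERIV_imp_deriv[OF Dirichlet_L_has_derivative[OF s(2)]])
  ultimately show ?thesis using s(2) q_pos by (simp add: rGamma_eq_zero_iff)
qed

lemma deriv_Dirichlet_L_nonzero_left:
  assumes q7: "q \<ge> 7" and s: "- 1 - real k \<le> Re s" "Re s \<le> - real k"
  shows "deriv (Dirichlet_L chi) s \<noteq> 0"
proof (cases "s = - of_nat k")
  case False
  define z where "z = (s + of_nat k) / 2"
  have z: "-1/2 \<le> Re z" "Re z \<le> 0" using s by (auto simp: z_def)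
  have "z \<noteq> 0" using False by (auto simp: z_def eq_neg_iff_add_eq_0)
  moreover have "z \<notin> \<int>\<^sub>\<le>\<^sub>0" by (rule not_nonpos_Int_strip) (use z \<open>z \<noteq> 0\<close> in auto)
  ultimately show ?thesis
    using Re_Digamma_ge_left[of z] z euler_mascheroni_less_ln_quotient[OF q7] q7 s
    by (intro deriv_Dirichlet_L_nonzero) (auto simp: z_def)
next
  \<comment> \<open>At the trivial zero the digamma function has its pole, so the derivative is
    computed from \<open>rGamma\<close>, which vanishes there with derivative 1.\<close>
  case True
  have nz: "Lam s \<noteq> 0" using Lam_0_nonzero Lam_nonzero_left[of s] True by (cases "k = 0") auto
  define P where "P = (\<lambda>s. of_real (q / pi) powr (- s / 2) :: complex)"
  have P: "(P has_field_derivative deriv P s) (at s)"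
    unfolding P_def by (intro holomorphic_derivI[of _ UNIV] holomorphic_intros) auto
  have "(rGamma has_field_derivative 1) (at ((s + of_nat k) / 2))"
    using has_field_derivative_rGamma_nonpos_int[of 0] True by simp
  hence "((\<lambda>s. rGamma ((s + of_nat k) / 2)) has_field_derivative (1 * (1 / 2))) (at s)"
    by (rule DERIV_chain2) (auto intro!: derivative_eq_intros)
  from DERIV_mult[OF Lam_has_derivative DERIV_mult[OF P this]]
  have "(Dirichlet_L chi has_field_derivative (Lam s * P s / 2)) (at s)"
    unfolding Dirichlet_L_eq P_def using True by (simp add: mult_ac)
  hence D: "deriv (Dirichlet_L chi) s = Lam s * P s / 2" by (rule DERIV_imp_deriv)
  have "P s \<noteq> 0" using q_pos by (simp add: P_def)
  thus ?thesis unfolding D using nz by simp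
qed

lemma even_deriv_nonzero:
  assumes "k = 0" "q \<ge> 7"
  shows "\<not> (\<exists>s. -1 \<le> Re s \<and> Re s \<le> 0 \<and> deriv (Dirichlet_L chi) s = 0)"
  using deriv_Dirichlet_L_nonzero_left assms by auto

text \<open>For odd \<open>chi\<close> this is L'/L without its pole: raising the digamma argument
  from (s + 1)/2 to (s + 3)/2 splits off the term \<open>1 / (s + 1)\<close> of the simple zero at
  -1.\<close>

definition log_deriv_part :: "complex \<Rightarrow> complex" where
  "log_deriv_part s = deriv Lam s / Lam s - of_real (ln (q / pi)) / 2 - Digamma ((s + 3) / 2) / 2"

lemma log_deriv_part_holomorphic: "log_deriv_part holomorphic_on {s. -3 < Re s \<and> Re s < 0}"
proof -
  let ?S = "{s. -3 < Re s \<and> Re s < 0}"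
  have dL: "deriv Lam holomorphic_on ?S"
    by (rule holomorphic_on_subset[OF holomorphic_deriv[OF Lam_holomorphic]]) auto
  have "Digamma holomorphic_on {z. Re z > 0}"
    by (intro holomorphic_on_Polygamma) (auto elim!: nonpos_Ints_cases)
  hence "Digamma \<circ> (\<lambda>s. (s + 3) / 2) holomorphic_on ?S"
    by (rule holomorphic_on_compose_gen[rotated]) (auto intro!: holomorphic_intros)
  hence "(\<lambda>s. Digamma ((s + 3) / 2)) holomorphic_on ?S" by (simp add: o_def)
  thus ?thesis unfolding log_deriv_part_def
    by (intro holomorphic_on_diff holomorphic_on_divide holomorphic_on_const dL holomorphic_on_subset[OF Lam_holomorphic])
       (use Lam_nonzero_left in auto)
qed

lemma Re_log_deriv_part_less:
  assumes "q \<ge> 4" "-2 \<le> Re s" "Re s < 0"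
  shows "Re (log_deriv_part s) \<le> - (ln (q / pi) + Digamma (1/2)) / 2"
proof -
  have "Digamma (1/2) \<le> Digamma (Re ((s + 3) / 2))" using assms by (intro Digamma_real_mono) auto
  also have "\<dots> \<le> Re (Digamma ((s + 3) / 2))" using assms by (intro Re_Digamma_ge) auto
  finally have 1: "Digamma (1/2) \<le> Re (Digamma ((s + 3) / 2))" .
  have 2: "Re (log_deriv_part s) = Re (deriv Lam s / Lam s) - ln (q / pi) / 2 - Re (Digamma ((s + 3) / 2)) / 2"
    by (simp add: log_deriv_part_def)
  have 3: "Re (deriv Lam s / Lam s) \<le> 0"
    using Lam_nonzero_left[of s] assms by (intro Re_Lam_log_deriv_nonpos) auto
  have "X \<le> - (l + A) / 2" if "A \<le> B" "X = Y - l / 2 - B / 2" "Y \<le> 0" for A B X Y l :: real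
    using that by simp
  from this[OF 1 2 3] show ?thesis .
qed

lemma odd_parity_log_deriv:
  assumes k1: "k = 1" and s: "-3 < Re s" "Re s < 0" "s \<noteq> -1"
  shows "log_deriv_part s + 1 / (s + 1) = deriv Lam s / Lam s - of_real (ln (q / pi)) / 2 - Digamma ((s + 1) / 2) / 2"
proof -
  have nz: "(s + 1) / 2 \<noteq> 0" using s(3) by (simp add: eq_neg_iff_add_eq_0)
  have "(s + 3) / 2 = (s + 1) / 2 + 1" by (simp add: field_simps)
  hence *: "Digamma ((s + 3) / 2) = Digamma ((s + 1) / 2) + 1 / ((s + 1) / 2)" by (simp only: Digamma_plus1[OF nz])
  have **: "(D + 1 / ((s + 1) / 2)) / 2 = D / 2 + 1 / (s + 1)" for D
    by (simp add: add_divide_distrib)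
  show ?thesis unfolding log_deriv_part_def * ** by simp
qed

lemma odd_deriv_zero_iff:
  assumes k1: "k = 1" and q7: "q \<ge> 7" and s: "-2 < Re s" "Re s < 0"
  shows "deriv (Dirichlet_L chi) s = 0 \<longleftrightarrow> 1 + (s + 1) * log_deriv_part s = 0"
proof (cases "s = -1")
  \<comment> \<open>Both sides are false at -1: the derivative is nonzero there, and the right side
    reads 1 = 0.\<close>
  case True
  thus ?thesis using deriv_Dirichlet_L_nonzero_left[OF q7, of "-1"] k1 by simp
next
  case False
  have "-1 < Re ((s + 1) / 2)" "(s + 1) / 2 \<noteq> 0" using s False by (auto simp: eq_neg_iff_add_eq_0)
  hence z: "(s + of_nat k) / 2 \<notin> \<int>\<^sub>\<le>\<^sub>0" unfolding k1 of_nat_1 by (rule not_nonpos_Int_strip)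
  have nz: "Lam s \<noteq> 0" using s by (intro Lam_nonzero_left)
  have "(s + of_nat k) / 2 = (s + 1) / 2" using k1 by simp
  hence e: "log_deriv_part s + 1 / (s + 1) = deriv Lam s / Lam s - of_real (ln (q / pi)) / 2 - Digamma ((s + of_nat k) / 2) / 2"
    using odd_parity_log_deriv[OF k1 _ s(2) False] s(1) by simp
  have "deriv Lam s - Lam s * (of_real (ln (q / pi)) / 2 + Digamma ((s + of_nat k) / 2) / 2) = Lam s * (log_deriv_part s + 1 / (s + 1))"
    unfolding e right_diff_distrib distrib_left using nz by (simp only: times_divide_eq_right nonzero_mult_div_cancel_left diff_diff_eq not_False_eq_True)
  hence "deriv (Dirichlet_L chi) s = of_real (q / pi) powr (- s / 2) * rGamma ((s + of_nat k) / 2) * (Lam s * (log_deriv_part s + 1 / (s + 1)))"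
    using DERIV_imp_deriv[OF Dirichlet_L_has_derivative[OF z]] by simp
  hence "deriv (Dirichlet_L chi) s = 0 \<longleftrightarrow> log_deriv_part s + 1 / (s + 1) = 0"
    using z nz q_pos by (simp add: rGamma_eq_zero_iff)
  also have "\<dots> \<longleftrightarrow> 1 + (s + 1) * log_deriv_part s = 0"
  proof -
    have "1 + (s + 1) * log_deriv_part s = (s + 1) * (log_deriv_part s + 1 / (s + 1))"
      using False by (simp add: distrib_left eq_neg_iff_add_eq_0)
    thus ?thesis using False by (simp add: eq_neg_iff_add_eq_0)
  qed
  finally show ?thesis .
qed

text \<open>Rouche's theorem compares \<open>1 + (s + 1) h\<close>, where \<open>h\<close> is \<open>log_deriv_part\<close>, with the linear function
  \<open>1 - C (s + 1)\<close>: since \<open>Re (h + 1 / (s + 1)) < 0\<close> on the boundary, the latter dominates their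
  difference for large \<open>C\<close>.\<close>

lemma odd_box_unique_zero:
  assumes k1: "k = 1" and q7: "q \<ge> 7" and b: "0 < b" "b < 1"
    and d: "0 < d" "\<And>s. -2 \<le> Re s \<Longrightarrow> Re s < 0 \<Longrightarrow> Re (log_deriv_part s) \<le> - d"
    and right: "- Digamma (b / 2) < ln (q / pi)" and T: "T > 0" "1 / T^2 \<le> d / 2"
  shows "\<exists>!z. z \<in> box (Complex (-1) (-T)) (Complex (b - 1) T) \<and> 1 + (z + 1) * log_deriv_part z = 0"
proof -
  let ?A = "Complex (-1) (-T)" and ?B = "Complex (b - 1) T"
  define S where "S = {s. -3 < Re s \<and> Re s < 0}"
  \<comment> \<open>\<open>U\<close> is the open set for Rouche's theorem; the compact
    \<open>K\<close> around it stays inside \<open>S\<close>, which makes the zeros in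
    \<open>U\<close> finite in number.\<close>
  define K where "K = cbox (Complex (-3/2) (-T-1)) (Complex ((b - 1) / 2) (T+1))"
  define U where "U = box (Complex (-3/2) (-T-1)) (Complex ((b - 1) / 2) (T+1))"
  let ?R = "cbox ?A ?B"
  let ?h = log_deriv_part
  have KS: "K \<subseteq> S" using b by (auto simp: K_def S_def in_cbox_complex_iff)
  have UK: "U \<subseteq> K" unfolding U_def K_def by (rule box_subset_cbox)
  have RU: "?R \<subseteq> U" using b T(1) by (auto simp: U_def in_cbox_complex_iff in_box_complex_iff field_simps)
  have hS: "?h holomorphic_on S" unfolding S_def by (rule log_deriv_part_holomorphic)
  have S: "open S" "connected S"
  proof -
    have "S = {s. Re s > -3} \<inter> {s. Re s < 0}" by (auto simp: S_def)
    thus "open S" "connected S"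
      by (auto intro!: open_Int open_halfspace_Re_gt open_halfspace_Re_lt convex_connected convex_Int convex_halfspace_Re_gt convex_halfspace_Re_lt)
  qed
  have "compact (?h ` ?R)"
    using RU UK KS by (intro compact_continuous_image holomorphic_on_imp_continuous_on holomorphic_on_subset[OF hS]) auto
  then obtain H where H: "H > 0" "\<And>z. z \<in> ?R \<Longrightarrow> norm (?h z) \<le> H"
    using bounded_pos[of "?h ` ?R"] compact_imp_bounded by auto
  define \<nu> where "\<nu> = (ln (q / pi) + Digamma (b / 2)) / 2"
  define \<mu> where "\<mu> = min (d / 2) \<nu>"
  have \<mu>: "\<mu> > 0" using d(1) right by (auto simp: \<mu>_def \<nu>_def)
  \<comment> \<open>The first bound decides the comparison on the boundary; the second puts the zero
    \<open>1 / C - 1\<close> of the linear function to the left of the edge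
    \<open>b - 1\<close>.\<close>
  define C where "C = max (H^2 / \<mu>) (2 / b)"
  have C: "C > 0" "2 / b \<le> C" "H^2 \<le> C * \<mu>"
  proof -
    show "2 / b \<le> C" by (simp add: C_def)
    thus "C > 0" using b by (smt (verit) divide_pos_pos)
    have "H^2 / \<mu> \<le> C" by (simp add: C_def)
    thus "H^2 \<le> C * \<mu>" using \<mu> by (simp add: field_simps)
  qed
  define f where "f = (\<lambda>z. 1 - of_real C * (z + 1) :: complex)"
  define g where "g = (\<lambda>z. (z + 1) * (?h z + of_real C))"
  define p where "p = (of_real (1 / C - 1) :: complex)"
  have fg: "f z + g z = 1 + (z + 1) * ?h z" for z by (simp add: f_def g_def algebra_simps)
  have Cb: "1 / C < b" using C(1,2) b by (simp add: field_simps)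
  have pR: "p \<in> box ?A ?B"
    using C Cb T by (auto simp: p_def in_box_complex_iff)
  have f_eq: "f z = of_real (- C) * (z - p)" for z
    using C(1) by (simp add: f_def p_def algebra_simps)
  have "\<exists>!z. z \<in> box ?A ?B \<and> f z + g z = 0"
  proof (rule Rouche_rectangle_unique_zero[where U = U and p = p])
    show "open U" "connected U" by (auto simp: U_def intro!: convex_connected convex_box)
    show "?R \<subseteq> U" by (rule RU)
    show "Re ?A < Re (?B)" "Im (?A) < Im (?B)"
      using b T by auto
    show "f holomorphic_on U" unfolding f_def by (intro holomorphic_intros)
    show "g holomorphic_on U" unfolding g_def
      using UK KS by (intro holomorphic_intros holomorphic_on_subset[OF hS]) auto
    show "p \<in> box ?A ?B" by (rule pR)
    show "zorder f p = 1"
      by (rule simple_zeroI[of UNIV p "\<lambda>_. of_real (- C)"]) (use C(1) f_eq in auto)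
    have "p \<in> U" using pR RU box_subset_cbox by blast
    thus "{z \<in> U. f z = 0} = {p}" using C(1) by (auto simp: f_eq)
    show "finite {z \<in> U. f z + g z = 0}"
    proof (cases "(\<lambda>z. 1 + (z + 1) * ?h z) constant_on S")
      \<comment> \<open>A constant function takes the value 1, as at -1, and has no zeros.\<close>
      case True
      then obtain c where c: "\<And>z. z \<in> S \<Longrightarrow> 1 + (z + 1) * ?h z = c" by (auto simp: constant_on_def)
      have "c = 1" using c[of "-1"] by (simp add: S_def)
      hence "f z + g z = 1" if "z \<in> U" for z using c[of z] that UK KS fg[of z] by auto
      hence "{z \<in> U. f z + g z = 0} = {}" by auto
      thus ?thesis by (simp only: finite.emptyI)
    next
      case False
      have "finite {z \<in> K. 1 + (z + 1) * ?h z = 0}"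
      proof (rule holomorphic_compact_finite_zeros[OF _ S _ KS False])
        show "(\<lambda>z. 1 + (z + 1) * ?h z) holomorphic_on S" by (intro holomorphic_intros hS)
        show "compact K" by (simp add: K_def)
      qed
      thus ?thesis by (rule finite_subset[rotated]) (use UK fg in auto)
    qed
    fix z assume z: "z \<in> path_image (rectpath ?A ?B)"
    hence zR: "z \<in> ?R" using path_image_rectpath_subset_cbox[of ?A ?B] b T by auto
    hence Re_z: "-1 \<le> Re z" "Re z \<le> b - 1" by (auto simp: in_cbox_complex_iff)
    have edges: "Re z = -1 \<or> Re z = b - 1 \<or> \<bar>Im z\<bar> = T"
      using z b T by (auto simp: path_image_rectpath)
    show "norm (g z) < norm (f z)"
    proof (cases "z = -1")
      \<comment> \<open>The point -1 lies on the left edge; there \<open>f\<close> is 1 and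
        \<open>g\<close> is 0. Elsewhere division by z + 1 is possible.\<close>
      case False
      define w where "w = z + 1"
      have w: "w \<noteq> 0" "0 \<le> Re w" "Re w \<le> b" using False Re_z by (auto simp: w_def eq_neg_iff_add_eq_0)
      have hz: "Re (?h z) \<le> - d" using d(2)[of z] Re_z b by simp
      \<comment> \<open>On the left edge \<open>Re (1 / w)\<close> is zero. On the right edge the
        digamma bound at \<open>b / 2\<close> applies to the sum. On the horizontal edges
        \<open>Re (1 / w)\<close> is at most 1 / T^2, hence at most half of
        \<open>d\<close>.\<close>
      have key: "Re (?h z) + Re (1 / w) \<le> - \<mu>" using edges
      proof (elim disjE)
        assume "Re z = -1"
        hence "Re (1 / w) = 0" by (simp add: w_def Re_divide)
        thus ?thesis using hz d(1) by (simp add: \<mu>_def min_def)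
      next
        assume e: "Re z = b - 1"
        have "?h z + 1 / w = deriv Lam z / Lam z - of_real (ln (q / pi)) / 2 - Digamma ((z + 1) / 2) / 2"
          unfolding w_def using Re_z b False by (intro odd_parity_log_deriv k1) auto
        hence "Re (?h z) + Re (1 / w) = Re (deriv Lam z / Lam z) - ln (q / pi) / 2 - Re (Digamma ((z + 1) / 2)) / 2"
          by (metis Re_complex_of_real Re_divide_numeral minus_complex.sel(1) plus_complex.sel(1))
        moreover have "Re (deriv Lam z / Lam z) \<le> 0"
          using Lam_nonzero_left[of z] e b q7 by (intro Re_Lam_log_deriv_nonpos) auto
        moreover have "Digamma (b / 2) \<le> Re (Digamma ((z + 1) / 2))"
          using Re_Digamma_ge[of "(z + 1) / 2"] e b by simp
        ultimately have "Re (?h z) + Re (1 / w) \<le> - \<nu>" by (simp add: \<nu>_def field_simps)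
        thus ?thesis by (simp add: \<mu>_def min_def)
      next
        assume e: "\<bar>Im z\<bar> = T"
        have "Im w = Im z" by (simp add: w_def)
        hence I: "(Im w)^2 = T^2" using power2_abs[of "Im z"] unfolding e by (simp only:)
        have "Re (1 / w) = Re w / ((Re w)^2 + T^2)" by (simp add: Re_divide I)
        also have "\<dots> \<le> 1 / T^2" using w b T by (intro frac_le) auto
        also have "\<dots> \<le> d / 2" by (rule T(2))
        finally show ?thesis using hz by (simp add: \<mu>_def min_def)
      qed
      \<comment> \<open>The inequality |g| < |f| divided by |w|. The squares share
        \<open>C^2\<close>, and the rest is decided by \<open>H^2 < 2 * (C * \<mu>)\<close>.\<close>
      have "(norm (?h z + of_real C))^2 < (norm (of_real C - 1 / w))^2"
      proof -
        have "(norm (?h z + of_real C))^2 = (norm (?h z))^2 + 2 * C * Re (?h z) + C^2"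
          unfolding cmod_power2 by (simp add: power2_eq_square algebra_simps)
        moreover have "(norm (of_real C - 1 / w))^2 = (norm (1 / w))^2 - 2 * C * Re (1 / w) + C^2"
          unfolding cmod_power2 by (simp add: power2_eq_square algebra_simps)
        moreover have "(norm (?h z))^2 \<le> H^2" using H(2)[OF zR] by (intro power_mono) auto
        moreover have "2 * C * Re (?h z) + 2 * C * Re (1 / w) \<le> - (2 * (C * \<mu>))"
          using mult_left_mono[OF key, of "2 * C"] C(1) by (simp add: distrib_left)
        moreover have "H^2 < 2 * (C * \<mu>)" using C(3) H(1) by (smt (verit) zero_less_power)
        moreover have "0 \<le> (norm (1 / w))^2" by simp
        ultimately show ?thesis by linarith
      qed
      hence less: "norm (?h z + of_real C) < norm (of_real C - 1 / w)" by (rule power2_less_imp_less) simp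
      have "norm (g z) = norm w * norm (?h z + of_real C)" by (simp add: g_def w_def norm_mult)
      also have "\<dots> < norm w * norm (of_real C - 1 / w)" using less w(1) by (intro mult_strict_left_mono) auto
      also have "\<dots> = norm (f z)"
      proof -
        have "w * (of_real C - 1 / w) = - f z" using w(1) by (simp add: f_def w_def[symmetric] right_diff_distrib)
        thus ?thesis by (metis norm_mult norm_minus_cancel)
      qed
      finally show ?thesis .
    qed (simp add: f_def g_def)
  qed
  thus ?thesis by (simp only: fg)
qed

text \<open>All zeros in the strip satisfy -1 < Re s < b - 1, and every tall box over that range
  contains exactly one; two zeros would lie in a common box.\<close>

lemma odd_deriv_unique_zero:
  assumes k1: "k = 1" and q23: "q \<ge> 23"
  shows "\<exists>!s. -2 \<le> Re s \<and> Re s \<le> 0 \<and> deriv (Dirichlet_L chi) s = 0"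
proof -
  have q: "q \<ge> 7" "q \<ge> 4" using q23 by auto
  define d where "d = (ln (q / pi) + Digamma (1/2)) / 2"
  have d: "d > 0" using minus_Digamma_half_less_ln_quotient[OF q23] by (simp add: d_def)
  have dle: "Re (log_deriv_part s) \<le> - d" if "-2 \<le> Re s" "Re s < 0" for s
    using Re_log_deriv_part_less[OF q(2) that] by (simp only: d_def minus_divide_left)
  \<comment> \<open>Continuity of \<open>Digamma\<close> at 1/2 leaves room for some b < 1; the
    boxes then avoid the line Re s = 0, where \<open>Lam\<close> may vanish.\<close>
  obtain b :: real where b: "0 < b" "b < 1" "- Digamma (b / 2) < ln (q / pi)"
  proof -
    have "isCont (Digamma :: real \<Rightarrow> real) (1/2)"
      by (rule isCont_Polygamma[OF continuous_ident]) (auto elim!: nonpos_Ints_cases)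
    hence "(Digamma \<longlongrightarrow> Digamma (1/2)) (at_left (1/2::real))"
      unfolding isCont_def by (rule tendsto_within_subset) auto
    moreover have "- ln (q / pi) < Digamma (1/2::real)" using minus_Digamma_half_less_ln_quotient[OF q23] by simp
    ultimately have "eventually (\<lambda>x::real. - ln (q / pi) < Digamma x) (at_left (1/2))" by (rule order_tendstoD)
    moreover have "eventually (\<lambda>x::real. x \<in> {0<..<1/2}) (at_left (1/2))" by (rule eventually_at_left_real) simp
    ultimately have "eventually (\<lambda>x::real. - ln (q / pi) < Digamma x \<and> x \<in> {0<..<1/2}) (at_left (1/2))"
      by (rule eventually_conj)
    then obtain x :: real where "- ln (q / pi) < Digamma x" "0 < x" "x < 1/2"
      by (auto dest: eventually_happens)
    thus ?thesis by (intro that[of "2 * x"]) auto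
  qed
  define P where "P s \<longleftrightarrow> -2 \<le> Re s \<and> Re s \<le> 0 \<and> deriv (Dirichlet_L chi) s = 0" for s
  define B where "B T = box (Complex (-1) (-T)) (Complex (b - 1) T)" for T
  define T0 where "T0 = sqrt (2 / d)"
  have T0: "T0 > 0" using d by (simp add: T0_def)
  have box: "\<exists>!z. z \<in> B T \<and> 1 + (z + 1) * log_deriv_part z = 0" if T: "T \<ge> T0" for T
    unfolding B_def
  proof (rule odd_box_unique_zero[OF k1 q(1) b(1,2) d dle b(3)])
    show "T > 0" using T T0 by simp
    have "2 / d = T0^2" using d by (simp add: T0_def)
    also have "\<dots> \<le> T^2" using T T0 by (intro power_mono) auto
    finally have "1 / T^2 \<le> 1 / (2 / d)" using d by (intro divide_left_mono mult_pos_pos) (auto intro: zero_less_power \<open>T > 0\<close>)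
    thus "1 / T^2 \<le> d / 2" by simp
  qed
  have loc: "-1 < Re s \<and> Re s < b - 1" if "P s" for s
  proof -
    have s: "-2 \<le> Re s" "Re s \<le> 0" "deriv (Dirichlet_L chi) s = 0" using that by (auto simp: P_def)
    have 1: "-1 < Re s"
      using deriv_Dirichlet_L_nonzero_left[OF q(1), of s] s k1 by force
    have "Re s < b - 1"
    proof (rule ccontr)
      assume "\<not> Re s < b - 1"
      hence r: "b / 2 \<le> Re ((s + 1) / 2)" by simp
      have "Digamma (b / 2) \<le> Digamma (Re ((s + 1) / 2))" using r b by (intro Digamma_real_mono) auto
      also have "\<dots> \<le> Re (Digamma ((s + 1) / 2))" using r b by (intro Re_Digamma_ge) auto
      finally have "- Re (Digamma ((s + of_nat k) / 2)) < ln (q / pi)" using b(3) k1 by simp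
      moreover have "(s + of_nat k) / 2 \<notin> \<int>\<^sub>\<le>\<^sub>0"
        unfolding k1 of_nat_1 using r b by (intro not_nonpos_Int_strip) (auto simp: complex_eq_iff)
      ultimately show False using deriv_Dirichlet_L_nonzero[OF q(2) s(2)] s(3) by blast
    qed
    with 1 show ?thesis by blast
  qed
  have P_box: "P s \<longleftrightarrow> 1 + (s + 1) * log_deriv_part s = 0" if "s \<in> B T" for s T
  proof -
    have "-1 < Re s" "Re s < b - 1" using that by (auto simp: B_def in_box_complex_iff)
    thus ?thesis using odd_deriv_zero_iff[OF k1 q(1), of s] b by (auto simp: P_def)
  qed
  have in_box: "s \<in> B T" if "P s" "T > \<bar>Im s\<bar>" for s T
    using loc[OF that(1)] that(2) by (auto simp: B_def in_box_complex_iff)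
  have "\<exists>!s. P s"
  proof (rule ex_ex1I)
    obtain z where "z \<in> B T0" "1 + (z + 1) * log_deriv_part z = 0" using box[of T0] by blast
    thus "\<exists>s. P s" using P_box by blast
    fix s s' assume ss: "P s" "P s'"
    define T where "T = max T0 (max (\<bar>Im s\<bar> + 1) (\<bar>Im s'\<bar> + 1))"
    have "s \<in> B T" "s' \<in> B T" using ss by (auto intro!: in_box simp: T_def)
    moreover have "T \<ge> T0" by (simp add: T_def)
    ultimately show "s = s'" using box[of T] P_box ss by blast
  qed
  thus ?thesis unfolding P_def .
qed

end

theorem theorem4:
  fixes q :: nat and chi :: "int \<Rightarrow> complex"
  assumes "primitive_dirichlet_character q chi" and "q > 1"
  shows "(chi (-1) = 1 \<and> q \<ge> 7 \<longrightarrow>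
            \<not> (\<exists>s. -1 \<le> Re s \<and> Re s \<le> 0 \<and> deriv (Dirichlet_L chi) s = 0)) \<and>
         (chi (-1) = -1 \<and> q \<ge> 23 \<longrightarrow>
            (\<exists>!s. -2 \<le> Re s \<and> Re s \<le> 0 \<and> deriv (Dirichlet_L chi) s = 0))"
proof (intro conjI impI)
  interpret primitive_char q chi using assms by unfold_locales
  {
    assume "chi (-1) = 1 \<and> q \<ge> 7"
    then interpret primitive_char_parity q chi 0 by unfold_locales auto
    show "\<not> (\<exists>s. -1 \<le> Re s \<and> Re s \<le> 0 \<and> deriv (Dirichlet_L chi) s = 0)"
      by (rule even_deriv_nonzero) (use \<open>chi (-1) = 1 \<and> q \<ge> 7\<close> in auto)
  next
    assume "chi (-1) = -1 \<and> q \<ge> 23"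
    then interpret primitive_char_parity q chi 1 by unfold_locales auto
    show "\<exists>!s. -2 \<le> Re s \<and> Re s \<le> 0 \<and> deriv (Dirichlet_L chi) s = 0"
      by (rule odd_deriv_unique_zero) (use \<open>chi (-1) = -1 \<and> q \<ge> 23\<close> in auto)
  }
qed

end
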